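(* Let $S$ be a cut-free net and $\Gamma$ a sequent. (1) If $S\in[\![\Gamma]\!]_{\mathcal B}$ for all interpretation bases $\mathcal B$, then $S\vdash_{\mathsf{MLL}^\maltese}\Gamma$. (2) $S\in[\![\Gamma]\!]_{\mathcal B}$ for every approximable interpretation basis $\mathcal B$ if and only if $S\vdash_{\mathsf{MLL}^\maltese}\Gamma$.
   Context: **Nets.** Fix a countable set of positions. A hypergraph has a finite set $V$ of positions and a finite set $E$ of labelled links; each link has a source and a target, which are finite sequences of pairwise distinct positions, the source and the target being disjoint. The only links used are: tensor links $\langle p_1,p_2\rhd_\otimes p\rangle$ and par links $\langle p_1,p_2\rhd_\wp p\rangle$ (two inputs, one output), cut links $\langle p_1,p_2\rhd_{\mathsf{cut}}\rangle$ (two inputs, no output), and daimon links $\langle\rhd_\maltese p_1,\dots,p_n\rangle$, $n\ge 0$ (no input). ($\wp$ denotes the par connective.) The sum $H_1+H_2$ takes the union of positions and the disjoint union of links. A conclusion is a position that is in the source of no link. A (multiplicative) net $S$ is a finite sum of such links in which every position is in the target of exactly one link and in the source of at most one link, together with a total order on its conclusions; $S(i)$ is the $i$-th conclusion and $\#S$ the number of conclusions. A net is cut-free if it has no cut link. Nets are considered up to isomorphism. $S\parallel T$ is the disjoint union (after renaming positions), with the conclusions of $S$ ordered before those of $T$. $\maltese_n$ is the net made of one daimon link with $n$ outputs. **Cut elimination** $\to$ is the closure under sum with a context of the following rules (insensitive to the order of the inputs of cut links; conclusions and their order are unchanged): (i) $\langle p_1,p_2\rhd_\wp p\rangle+\langle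 p,q\rhd_{\mathsf{cut}}\rangle+\langle q_1,q_2\rhd_\otimes q\rangle\to\langle p_1,q_1\rhd_{\mathsf{cut}}\rangle+\langle p_2,q_2\rhd_{\mathsf{cut}}\rangle$; (ii) for two distinct daimon links, $\langle\rhd_\maltese\bar p\rangle+\langle p_i,q_j\rhd_{\mathsf{cut}}\rangle+\langle\rhd_\maltese\bar q\rangle\to\langle\rhd_\maltese\bar p\setminus p_i,\bar q\setminus q_j\rangle$; (iii) $\langle p_1,p_2\rhd_\otimes p\rangle+\langle p,q\rhd_{\mathsf{cut}}\rangle+\langle\rhd_\maltese\bar a,q,\bar b\rangle\to\langle p_1,q^1\rhd_{\mathsf{cut}}\rangle+\langle p_2,q^2\rhd_{\mathsf{cut}}\rangle+\langle\rhd_\maltese\bar a,q^1,q^2,\bar b\rangle$ with $q^1,q^2$ fresh; (iv) $\langle q_1,q_2\rhd_\wp q\rangle+\langle q,p\rhd_{\mathsf{cut}}\rangle+\langle\rhd_\maltese\bar a,p,\bar b\rangle\to\langle q_1,p^1\rhd_{\mathsf{cut}}\rangle+\langle q_2,p^2\rhd_{\mathsf{cut}}\rangle+\langle\rhd_\maltese\bar a',p^1,\bar b'\rangle+\langle\rhd_\maltese\bar a'',p^2,\bar b''\rangle$ with $p^1,p^2$ fresh, for any choice of sequences such that $\bar a',\bar a''$ enumerate a splitting of $\bar a$ into two (possibly empty) parts and $\bar b',\bar b''$ one of $\bar b$. In (iii) and (iv) the inputs of the connective link may themselves be outputs of the daimon link involved. Other cuts are not reducible. $\to^*$ is the reflexive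 transitive closure. **Orthogonality and types.** For nets $S,T$ with $k=\min(\#S,\#T)$, the interaction $S::T$ is $S+T+\sum_{1\le i\le k}\langle S(i),T(i)\rhd_{\mathsf{cut}}\rangle$ ($S,T$ made disjoint), the remaining conclusions keeping their order. $S\perp T$ iff there exists a reduction $S::T\to^*\maltese_0$. For a set $A$ of nets, $A^\bot=\{P\mid\forall R\in A,\ P\perp R\}$; a type is a set $\mathbf A$ with $\mathbf A^{\bot\bot}=\mathbf A$. If $\mathbf A,\mathbf A^\bot$ are nonempty, all their nets have the same number of conclusions, written $\#\mathbf A$; otherwise the condition $\#S\ge\#\mathbf A$ below is read as vacuous. Define $\mathbf A\rightthreetimes\mathbf B=\{S\mid \forall T\in\mathbf A^\bot,\ S::T\in\mathbf B,\text{ and }\#S\ge\#\mathbf A\}$, $\mathbf A\parallel\mathbf B=\{S\parallel T\mid S\in\mathbf A,T\in\mathbf B\}^{\bot\bot}$, and, for types whose nets have one conclusion and $p$ a fresh position, $\mathbf A\otimes\mathbf B=\{S+\langle S(1),S(2)\rhd_\otimes p\rangle\mid S\in\mathbf A\parallel\mathbf B\}^{\bot\bot}$, $\mathbf A\wp\mathbf B=\{S+\langle S(1),S(2)\rhd_\wp p\rangle\mid S\in\mathbf A\rightthreetimes\mathbf B\}^{\bot\bot}$. **Logic.** Propositional variables form a countable set with an involution $X\mapsto X^\bot$. Formulas: $A,B::=X\mid A\wp B\mid A\otimes B$, with $(A\wp B)^\bot=A^\bot\otimes B^\bot$, $(A\otimes B)^\bot=A^\bot\wp B^\bot$. Sequents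 are finite sequences of formulas. $\mathsf{MLL}^\maltese$ proofs are trees built with the rules: ($\maltese$) infer any $\Gamma$ with no premise; ($\wp$) from $\Gamma,A,B$ infer $\Gamma,A\wp B$; ($\otimes$) from $\Gamma,A$ and $\Delta,B$ infer $\Gamma,\Delta,A\otimes B$; (cut) from $\Gamma,A$ and $\Delta,A^\bot$ infer $\Gamma,\Delta$; (ex) exchange of two consecutive formulas. A net $S$ represents a proof $\pi$ of $A_1,\dots,A_n$ (the $i$-th conclusion of $S$ corresponding to $A_i$), inductively: a $\maltese$-rule is represented by a single daimon link $\langle\rhd_\maltese p_1,\dots,p_n\rangle$ with conclusions ordered $p_1,\dots,p_n$; a $\wp$-rule by adding a par link with fresh output to the conclusions for $A,B$ of a net representing the premise; a $\otimes$-rule (resp. cut-rule) by the disjoint sum of nets representing the premises plus a tensor link with fresh output (resp. a cut link) on the conclusions for the two active formulas; exchange by exchanging the two conclusions in the order. $S\vdash_{\mathsf{MLL}^\maltese}\Gamma$ means that $S$ represents some $\mathsf{MLL}^\maltese$ proof of $\Gamma$. **Interpretation.** An interpretation basis $\mathcal B$ associates to each propositional variable $X$ a type $[\![X]\!]_{\mathcal B}$ all of whose nets have one conclusion, with $[\![X^\bot]\!]_{\mathcal B}\subseteq[\![X]\!]_{\mathcal B}^\bot$ for all $X$. It is extended by $[\![A\otimes B]\!]_{\mathcal B}=[\![A]\!]_{\mathcal B}\otimes[\![B]\!]_{\mathcal B}$, $[\![A\wp B]\!]_{\mathcal B}=[\![A]\!]_{\mathcal B}\wp[\![B]\!]_{\mathcal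 B}$, and for a sequent $[\![A_1,\dots,A_n]\!]_{\mathcal B}=[\![A_1]\!]_{\mathcal B}\rightthreetimes\cdots\rightthreetimes[\![A_n]\!]_{\mathcal B}$ ($\rightthreetimes$ is associative on types). $\mathcal B$ is approximable if $\maltese_1\in[\![X]\!]_{\mathcal B}$ for every propositional variable $X$. *)

theory Defs
  imports "HOL-Library.Multiset" "HOL-Library.Countable"
begin

section \<open>Nets\<close>

datatype 'p link =
    Tensor 'p 'p 'p  \<comment> \<open>two inputs, then the output\<close>
  | Par 'p 'p 'p  \<comment> \<open>two inputs, then the output\<close>
  | Cut 'p 'p
  | Daimon "'p list"

fun source :: "'p link \<Rightarrow> 'p list" where
  "source (Tensor p1 p2 p) = [p1, p2]"
| "source (Par p1 p2 p) = [p1, p2]"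
| "source (Cut p1 p2) = [p1, p2]"
| "source (Daimon ps) = []"

fun target :: "'p link \<Rightarrow> 'p list" where
  "target (Tensor p1 p2 p) = [p]"
| "target (Par p1 p2 p) = [p]"
| "target (Cut p1 p2) = []"
| "target (Daimon ps) = ps"

text \<open>
  Positions are natural numbers. The links form a multiset because distinct links may share label,
  source and target (as several daimons without outputs do). The set of positions need not be
  recorded: in a net every position is the target of some link. The second component lists the
  conclusions in their order.
\<close>

datatype net = Net (links: "nat link multiset") (concl: "nat list")

definition positions :: "nat link multiset \<Rightarrow> nat set" where
  "positions L = (\<Union>l\<in>set_mset L. set (source l) \<union> set (target l))"

definition is_net :: "net \<Rightarrow> bool" where
  "is_net S \<longleftrightarrow>
     (\<forall>l \<in># links S. distinct (source l @ target l)) \<and>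
     (\<forall>p \<in> positions (links S).
        size {#l \<in># links S. p \<in> set (target l)#} = 1 \<and>
        size {#l \<in># links S. p \<in> set (source l)#} \<le> 1) \<and>
     distinct (concl S) \<and>
     set (concl S) = {p \<in> positions (links S). \<forall>l \<in># links S. p \<notin> set (source l)}"

abbreviation nconcl :: "net \<Rightarrow> nat" where
  "nconcl S \<equiv> length (concl S)"

definition cut_free :: "net \<Rightarrow> bool" where
  "cut_free S \<longleftrightarrow> (\<forall>p q. Cut p q \<notin># links S)"

definition daimon_net :: "nat \<Rightarrow> net" where
  "daimon_net n = Net {#Daimon [0..<n]#} [0..<n]"

text \<open>
  Nets are meant up to isomorphism, that is, up to injective renaming of positions. We work with
  representatives, and make two nets disjoint by sending their positions to the even and to the odd
  numbers. Orthogonality is insensitive to renaming, so that every type is closed under isomorphism.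
\<close>

definition rename :: "(nat \<Rightarrow> nat) \<Rightarrow> net \<Rightarrow> net" where
  "rename f S = Net (image_mset (map_link f) (links S)) (map f (concl S))"

definition left_copy :: "net \<Rightarrow> net" where
  "left_copy = rename (\<lambda>n. 2 * n)"

definition right_copy :: "net \<Rightarrow> net" where
  "right_copy = rename (\<lambda>n. 2 * n + 1)"

definition parallel :: "net \<Rightarrow> net \<Rightarrow> net" where
  "parallel S T =
     Net (links (left_copy S) + links (right_copy T)) (concl (left_copy S) @ concl (right_copy T))"

definition interaction :: "net \<Rightarrow> net \<Rightarrow> net" where
  "interaction S T =
     (let S' = left_copy S; T' = right_copy T; k = min (nconcl S) (nconcl T) in
      Net (links S' + links T' + mset (map (\<lambda>i. Cut (concl S' ! i) (concl T' ! i)) [0..<k]))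
          (drop k (concl S') @ drop k (concl T')))"


section \<open>Cut elimination\<close>

text \<open>
  The multiset \<open>C\<close> is the context. In the last rule, the two equations between multisets say that
  \<open>as'\<close>, \<open>as''\<close> and \<open>bs'\<close>, \<open>bs''\<close> enumerate, in any order, splittings of the (repetition-free)
  lists \<open>as\<close> and \<open>bs\<close>.
\<close>

inductive red :: "net \<Rightarrow> net \<Rightarrow> bool" where
  red_par_tensor:
    "c \<in> {Cut p q, Cut q p} \<Longrightarrow>
     red (Net (C + {#Par p1 p2 p, c, Tensor q1 q2 q#}) cs)
         (Net (C + {#Cut p1 q1, Cut p2 q2#}) cs)"
| red_daimon_daimon:
    "c \<in> {Cut p q, Cut q p} \<Longrightarrow>
     red (Net (C + {#Daimon (as @ [p] @ bs), c, Daimon (as' @ [q] @ bs')#}) cs)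
         (Net (C + {#Daimon (as @ bs @ as' @ bs')#}) cs)"
| red_tensor_daimon:
    "c \<in> {Cut p q, Cut q p} \<Longrightarrow>
     L = C + {#Tensor p1 p2 p, c, Daimon (as @ [q] @ bs)#} \<Longrightarrow>
     r1 \<notin> positions L \<Longrightarrow> r2 \<notin> positions L \<Longrightarrow> r1 \<noteq> r2 \<Longrightarrow>
     red (Net L cs)
         (Net (C + {#Cut p1 r1, Cut p2 r2, Daimon (as @ [r1, r2] @ bs)#}) cs)"
| red_par_daimon:
    "c \<in> {Cut p q, Cut q p} \<Longrightarrow>
     L = C + {#Par q1 q2 q, c, Daimon (as @ [p] @ bs)#} \<Longrightarrow>
     r1 \<notin> positions L \<Longrightarrow> r2 \<notin> positions L \<Longrightarrow> r1 \<noteq> r2 \<Longrightarrow>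
     mset as' + mset as'' = mset as \<Longrightarrow> mset bs' + mset bs'' = mset bs \<Longrightarrow>
     red (Net L cs)
         (Net (C + {#Cut q1 r1, Cut q2 r2,
                     Daimon (as' @ [r1] @ bs'), Daimon (as'' @ [r2] @ bs'')#}) cs)"


section \<open>Orthogonality and types\<close>

definition orthogonal :: "net \<Rightarrow> net \<Rightarrow> bool" where
  "orthogonal S T \<longleftrightarrow> red\<^sup>*\<^sup>* (interaction S T) (daimon_net 0)"

definition orth :: "net set \<Rightarrow> net set" where
  "orth A = {P. is_net P \<and> (\<forall>R\<in>A. orthogonal P R)}"

definition is_type :: "net set \<Rightarrow> bool" where
  "is_type A \<longleftrightarrow> orth (orth A) = A"

text \<open>Meaningful only when both \<open>A\<close> and its orthogonal are nonempty.\<close>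

definition type_nconcl :: "net set \<Rightarrow> nat" where
  "type_nconcl A = (THE n. \<forall>S \<in> A \<union> orth A. nconcl S = n)"

text \<open>In symbols, A \<open>\<rightthreetimes>\<close> B; the last condition reads nconcl S \<open>\<ge>\<close> \<open>#A\<close> when \<open>#A\<close> is defined.\<close>

definition type_seq :: "net set \<Rightarrow> net set \<Rightarrow> net set" where
  "type_seq A B =
     {S. is_net S \<and> (\<forall>T \<in> orth A. interaction S T \<in> B) \<and>
         (A \<noteq> {} \<and> orth A \<noteq> {} \<longrightarrow> nconcl S \<ge> type_nconcl A)}"

definition type_parallel :: "net set \<Rightarrow> net set \<Rightarrow> net set" where
  "type_parallel A B = orth (orth {parallel S T | S T. S \<in> A \<and> T \<in> B})"

text \<open>
  The next two constructions are meant for types whose nets have one conclusion; then the nets \<open>S\<close>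
  below have exactly two conclusions \<open>s1\<close> and \<open>s2\<close>, and \<open>ss\<close> is empty.
\<close>

definition type_tensor :: "net set \<Rightarrow> net set \<Rightarrow> net set" where
  "type_tensor A B = orth (orth
     {Net (links S + {#Tensor s1 s2 p#}) (p # ss) | S s1 s2 ss p.
        S \<in> type_parallel A B \<and> concl S = s1 # s2 # ss \<and> p \<notin> positions (links S)})"

definition type_par :: "net set \<Rightarrow> net set \<Rightarrow> net set" where
  "type_par A B = orth (orth
     {Net (links S + {#Par s1 s2 p#}) (p # ss) | S s1 s2 ss p.
        S \<in> type_seq A B \<and> concl S = s1 # s2 # ss \<and> p \<notin> positions (links S)})"


section \<open>Formulas and proofs\<close>

datatype 'v form = Var 'v | ParF "'v form" "'v form" | TensorF "'v form" "'v form"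

text \<open>The argument \<open>dual\<close> is the involution on propositional variables.\<close>

primrec neg :: "('v \<Rightarrow> 'v) \<Rightarrow> 'v form \<Rightarrow> 'v form" where
  "neg dual (Var X) = Var (dual X)"
| "neg dual (ParF A B) = TensorF (neg dual A) (neg dual B)"
| "neg dual (TensorF A B) = ParF (neg dual A) (neg dual B)"

text \<open>
  Proof trees, labelled by rule names. A daimon carries its sequent, and an exchange the index
  (from 0) of the first of the two consecutive formulas that it swaps.
\<close>

datatype 'v tree =
    DaimonR "'v form list"
  | ParR "'v tree"
  | TensorR "'v tree" "'v tree"
  | CutR "'v tree" "'v tree"
  | ExR nat "'v tree"

inductive proof_of :: "('v \<Rightarrow> 'v) \<Rightarrow> 'v tree \<Rightarrow> 'v form list \<Rightarrow> bool" for dual where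
  "proof_of dual (DaimonR \<Gamma>) \<Gamma>"
| "proof_of dual \<pi> (\<Gamma> @ [A, B]) \<Longrightarrow> proof_of dual (ParR \<pi>) (\<Gamma> @ [ParF A B])"
| "proof_of dual \<pi> (\<Gamma> @ [A]) \<Longrightarrow> proof_of dual \<rho> (\<Delta> @ [B]) \<Longrightarrow>
     proof_of dual (TensorR \<pi> \<rho>) (\<Gamma> @ \<Delta> @ [TensorF A B])"
| "proof_of dual \<pi> (\<Gamma> @ [A]) \<Longrightarrow> proof_of dual \<rho> (\<Delta> @ [neg dual A]) \<Longrightarrow>
     proof_of dual (CutR \<pi> \<rho>) (\<Gamma> @ \<Delta>)"
| "proof_of dual \<pi> (\<Gamma> @ [A, B] @ \<Delta>) \<Longrightarrow>
     proof_of dual (ExR (length \<Gamma>) \<pi>) (\<Gamma> @ [B, A] @ \<Delta>)"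

inductive represents :: "net \<Rightarrow> 'v tree \<Rightarrow> bool" where
  "distinct ps \<Longrightarrow> length ps = length \<Gamma> \<Longrightarrow> represents (Net {#Daimon ps#} ps) (DaimonR \<Gamma>)"
| "represents (Net L (cs @ [p, q])) \<pi> \<Longrightarrow> r \<notin> positions L \<Longrightarrow>
     represents (Net (L + {#Par p q r#}) (cs @ [r])) (ParR \<pi>)"
| "represents (Net L (cs @ [p])) \<pi> \<Longrightarrow> represents (Net M (ds @ [q])) \<rho> \<Longrightarrow>
     positions L \<inter> positions M = {} \<Longrightarrow> r \<notin> positions L \<union> positions M \<Longrightarrow>
     represents (Net (L + M + {#Tensor p q r#}) (cs @ ds @ [r])) (TensorR \<pi> \<rho>)"
| "represents (Net L (cs @ [p])) \<pi> \<Longrightarrow> represents (Net M (ds @ [q])) \<rho> \<Longrightarrow>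
     positions L \<inter> positions M = {} \<Longrightarrow> c \<in> {Cut p q, Cut q p} \<Longrightarrow>
     represents (Net (L + M + {#c#}) (cs @ ds)) (CutR \<pi> \<rho>)"
| "represents (Net L (cs @ [p, q] @ ds)) \<pi> \<Longrightarrow>
     represents (Net L (cs @ [q, p] @ ds)) (ExR (length cs) \<pi>)"

definition derives :: "('v \<Rightarrow> 'v) \<Rightarrow> net \<Rightarrow> 'v form list \<Rightarrow> bool" where
  "derives dual S \<Gamma> \<longleftrightarrow> (\<exists>\<pi>. proof_of dual \<pi> \<Gamma> \<and> represents S \<pi>)"


section \<open>Interpretation\<close>

definition is_basis :: "('v \<Rightarrow> 'v) \<Rightarrow> ('v \<Rightarrow> net set) \<Rightarrow> bool" where
  "is_basis dual \<B> \<longleftrightarrow>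
     (\<forall>X. is_type (\<B> X) \<and> (\<forall>S \<in> \<B> X. nconcl S = 1) \<and> \<B> (dual X) \<subseteq> orth (\<B> X))"

definition approximable :: "('v \<Rightarrow> net set) \<Rightarrow> bool" where
  "approximable \<B> \<longleftrightarrow> (\<forall>X. daimon_net 1 \<in> \<B> X)"

primrec interp :: "('v \<Rightarrow> net set) \<Rightarrow> 'v form \<Rightarrow> net set" where
  "interp \<B> (Var X) = \<B> X"
| "interp \<B> (ParF A B) = type_par (interp \<B> A) (interp \<B> B)"
| "interp \<B> (TensorF A B) = type_tensor (interp \<B> A) (interp \<B> B)"

text \<open>
  The empty sequent is interpreted by the neutral element of \<^const>\<open>type_seq\<close>: the empty net is
  the only net orthogonal to \<open>daimon_net 0\<close>, so this is the set of nets reducing to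
  \<open>daimon_net 0\<close>. Longer sequents are nested to the right; on types the nesting does not matter.
\<close>

fun interp_sequent :: "('v \<Rightarrow> net set) \<Rightarrow> 'v form list \<Rightarrow> net set" where
  "interp_sequent \<B> [] = orth (orth {daimon_net 0})"
| "interp_sequent \<B> [A] = interp \<B> A"
| "interp_sequent \<B> (A # B # \<Gamma>) = type_seq (interp \<B> A) (interp_sequent \<B> (B # \<Gamma>))"

end

(*
The order of the outputs of a daimon and of the inputs of a cut plays no role, so reduction is studied
on nets with multisets. Soundness: [[A]] and its orthogonal both contain the daimon with one output,
because a tensor of two daimons and a par of one daimon can be contracted to a daimon without losing a
successful reduction; hence a daimon passes against any opponents, and the other rules follow from the
definitions of the types.

Completeness: interpret every variable by the biorthogonal of the daimon. Opposing the terminal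
tensors and pars of a cut-free net S to tests ending with a par or a tensor peels off these links one
by one. A test with the wrong connective never wins, so the formulas of Gamma propagate to all
positions of S; and since a tensor test splits, every switching of the pars can be chosen, with
winning meaning that the switching is a tree. In a net all of whose switchings are trees, a tensor
joins two daimons or a par has both premises on one daimon; contracting this link into a daimon
preserves correctness, and undoing the contractions builds a proof.
*)

theory Submission
  imports Defs
begin

text \<open>Orthogonality asks for some successful reduction, and splitting a daimon against a par
  is a genuine choice, so reduction is not confluent and normal forms are of no use. Structural
  arguments are therefore permutations of plays: a step without choice (tensor against par, fusion
  of two daimons) can be moved to the front of any winning play, and a clash stays in place forever.
  The tests used for completeness keep conclusions in groups, one group for each opposing test.
  Removing a terminal tensor leaves both its premises in the group of its conclusion; removing a
  terminal par splits the opposing test, one premise staying in the group and the other forming a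
  group alone. Letting the switching decide which one stays makes the final flat game, where only
  daimons are left, the graph of that switching. Finding a link to contract needs a global argument,
  as the premises of a par may be far apart: a par edge is taken whose removal cuts off as few
  positions as possible.\<close>

section \<open>Nets with unordered daimons and cuts, and winning plays\<close>

datatype 'p alink = AT 'p 'p 'p | AP 'p 'p 'p | AC "'p multiset" | AD "'p multiset"

primrec asrc :: "'p alink \<Rightarrow> 'p multiset" where
  "asrc (AT p q r) = {#p, q#}"
| "asrc (AP p q r) = {#p, q#}"
| "asrc (AC ps) = ps"
| "asrc (AD ps) = {#}"

primrec atgt :: "'p alink \<Rightarrow> 'p multiset" where
  "atgt (AT p q r) = {#r#}"
| "atgt (AP p q r) = {#r#}"
| "atgt (AC ps) = {#}"
| "atgt (AD ps) = ps"

definition src :: "'p alink multiset \<Rightarrow> 'p multiset" where "src N = (\<Sum>l\<in>#N. asrc l)"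
definition tgt :: "'p alink multiset \<Rightarrow> 'p multiset" where "tgt N = (\<Sum>l\<in>#N. atgt l)"
definition pos :: "'p alink multiset \<Rightarrow> 'p set" where "pos N = set_mset (src N) \<union> set_mset (tgt N)"

lemma src_simps [simp]:
  "src {#} = {#}" "src (add_mset l N) = asrc l + src N" "src (M + N) = src M + src N"
  by (simp_all add: src_def)

lemma tgt_simps [simp]:
  "tgt {#} = {#}" "tgt (add_mset l N) = atgt l + tgt N" "tgt (M + N) = tgt M + tgt N"
  by (simp_all add: tgt_def)

lemma pos_simps [simp]:
  "pos {#} = {}" "pos (add_mset l N) = set_mset (asrc l) \<union> set_mset (atgt l) \<union> pos N"
  "pos (M + N) = pos M \<union> pos N"
  by (auto simp: pos_def)

lemma finite_pos [simp]: "finite (pos N)"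
  by (simp add: pos_def)

definition simple_mset :: "'p multiset \<Rightarrow> bool" where
  "simple_mset M \<longleftrightarrow> (\<forall>p. count M p \<le> 1)"

lemma simple_mset_add: "simple_mset (M + N) \<longleftrightarrow> simple_mset M \<and> simple_mset N \<and> set_mset M \<inter> set_mset N = {}"
proof
  assume a: "simple_mset (M + N)"
  have "p \<notin># N" if "p \<in># M" for p
  proof
    assume "p \<in># N"
    with that have "count M p > 0" "count N p > 0" by simp_all
    then have "count (M + N) p \<ge> 2" unfolding count_union by linarith
    with a show False by (metis simple_mset_def not_less_eq_eq numeral_2_eq_2 One_nat_def)
  qed
  moreover have "count M p \<le> 1 \<and> count N p \<le> 1" for p
    using a[unfolded simple_mset_def, rule_format, of p] by simp
  ultimately show "simple_mset M \<and> simple_mset N \<and> set_mset M \<inter> set_mset N = {}"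
    by (auto simp: simple_mset_def)
next
  assume a: "simple_mset M \<and> simple_mset N \<and> set_mset M \<inter> set_mset N = {}"
  show "simple_mset (M + N)" unfolding simple_mset_def
  proof
    fix p
    have "count M p \<le> 1" "count N p \<le> 1" "count M p = 0 \<or> count N p = 0"
      using a by (auto simp: simple_mset_def simp flip: not_in_iff)
    then show "count (M + N) p \<le> 1" by auto
  qed
qed

lemma simple_mset_simps [simp]:
  "simple_mset {#}" "simple_mset (add_mset p M) \<longleftrightarrow> p \<notin># M \<and> simple_mset M"
proof -
  show "simple_mset {#}" by (simp add: simple_mset_def)
  have "simple_mset {#p#}" by (simp add: simple_mset_def)
  then show "simple_mset (add_mset p M) \<longleftrightarrow> p \<notin># M \<and> simple_mset M"
    using simple_mset_add[of "{#p#}" M] by auto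
qed

lemma simple_mset_mset [simp]: "simple_mset (mset xs) \<longleftrightarrow> distinct xs"
  by (induction xs) auto

lemma simple_mset_mono: "simple_mset N \<Longrightarrow> M \<subseteq># N \<Longrightarrow> simple_mset M"
  by (metis simple_mset_add subset_mset.le_iff_add)

lemma simple_mset_image: "inj_on f (set_mset M) \<Longrightarrow> simple_mset (image_mset f M) \<longleftrightarrow> simple_mset M"
  by (induction M) (auto dest: inj_on_subset simp: inj_on_def)

text \<open>With repetition-free targets, the equation gives every position one producer and one
  consumer. No conclusion is left: this is a completed interaction.\<close>

definition closed :: "'p alink multiset \<Rightarrow> bool" where
  "closed N \<longleftrightarrow> src N = tgt N \<and> simple_mset (tgt N)"

definition rn :: "('p \<Rightarrow> 'q) \<Rightarrow> 'p alink multiset \<Rightarrow> 'q alink multiset" where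
  "rn f N = image_mset (map_alink f) N"

lemma rn_simps [simp]:
  "rn f {#} = {#}" "rn f (add_mset l N) = add_mset (map_alink f l) (rn f N)"
  "rn f (M + N) = rn f M + rn f N"
  by (simp_all add: rn_def)

lemma asrc_map [simp]: "asrc (map_alink f l) = image_mset f (asrc l)"
  and atgt_map [simp]: "atgt (map_alink f l) = image_mset f (atgt l)"
  by (cases l; simp)+

lemma src_rn [simp]: "src (rn f N) = image_mset f (src N)"
  and tgt_rn [simp]: "tgt (rn f N) = image_mset f (tgt N)"
  by (induction N) simp_all

lemma pos_rn [simp]: "pos (rn f N) = f ` pos N"
  by (auto simp: pos_def)

lemma set_alink_eq: "set_alink l = set_mset (asrc l) \<union> set_mset (atgt l)"
  by (cases l) auto

lemma rn_cong: "(\<And>x. x \<in> pos N \<Longrightarrow> f x = g x) \<Longrightarrow> rn f N = rn g N"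
proof (induction N)
  case (add l N)
  have "map_alink f l = map_alink g l"
    by (rule alink.map_cong) (auto simp: set_alink_eq add.prems)
  with add show ?case by simp
qed simp

lemma rn_comp: "rn f (rn g N) = rn (f \<circ> g) N"
  by (simp add: rn_def multiset.map_comp alink.map_comp comp_def)

lemma rn_id: "(\<And>x. x \<in> pos N \<Longrightarrow> f x = x) \<Longrightarrow> rn f N = N"
  using rn_cong[of N f id] by (simp add: rn_def alink.map_id0)

lemma closed_rn: "inj_on f (pos N) \<Longrightarrow> closed N \<Longrightarrow> closed (rn f N)"
  by (simp add: closed_def simple_mset_image pos_def)

text \<open>
  The rules for a daimon facing a connective reuse the positions of the cut instead of fresh ones, so
  that reduction never leaves the positions of a net.
\<close>

inductive rstep :: "'p \<Rightarrow> 'p \<Rightarrow> 'p alink \<Rightarrow> 'p alink \<Rightarrow> 'p alink multiset \<Rightarrow> bool" where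
  TP: "rstep p q (AT p1 p2 p) (AP q1 q2 q) {#AC {#p1, q1#}, AC {#p2, q2#}#}"
| DD: "rstep p q (AD (add_mset p ds)) (AD (add_mset q es)) {#AD (ds + es)#}"
| TD: "rstep p q (AT p1 p2 p) (AD (add_mset q ds))
         {#AC {#p1, p#}, AC {#p2, q#}, AD (add_mset p (add_mset q ds))#}"
| PD: "rstep p q (AP p1 p2 p) (AD (add_mset q (ds + es)))
         {#AC {#p1, p#}, AC {#p2, q#}, AD (add_mset p ds), AD (add_mset q es)#}"

definition redex :: "'p alink multiset \<Rightarrow> 'p alink multiset \<Rightarrow> bool" where
  "redex R R' \<longleftrightarrow> (\<exists>p q l l'. R = {#AC {#p, q#}, l, l'#} \<and> rstep p q l l' R')"

lemma redexI: "rstep p q l l' R' \<Longrightarrow> redex {#AC {#p, q#}, l, l'#} R'"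
  by (auto simp: redex_def)

text \<open>Winning is existential: some choice of redexes and, for a par against a daimon, some
  splitting ends at the empty daimon. Closedness is recorded at every step so that an induction on
  plays always has unique producers and consumers at hand.\<close>

inductive win :: "'p alink multiset \<Rightarrow> bool" where
  win_base: "win {#AD {#}#}"
| win_step: "redex R R' \<Longrightarrow> closed (C + R) \<Longrightarrow> win (C + R') \<Longrightarrow> win (C + R)"

lemma win_closed: "win N \<Longrightarrow> closed N"
  by (induction rule: win.induct) (simp_all add: closed_def)

lemma redex_pos: "redex R R' \<Longrightarrow> pos R' \<subseteq> pos R"
  by (auto simp: redex_def elim!: rstep.cases)

lemma redex_rn: "redex R R' \<Longrightarrow> redex (rn f R) (rn f R')"
proof -
  have "rstep (f p) (f q) (map_alink f l) (map_alink f l') (rn f R')" if "rstep p q l l' R'" for p q l l'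
    using that by induction (simp_all add: rstep.intros)
  then show "redex R R' \<Longrightarrow> redex (rn f R) (rn f R')" by (fastforce simp: redex_def)
qed

lemma redex_closed: "redex R R' \<Longrightarrow> closed (C + R) \<Longrightarrow> closed (C + R')"
  unfolding redex_def
  by (elim exE conjE, erule rstep.cases)
    (auto simp: closed_def simple_mset_add; simp add: add_mset_commute)+

lemma win_rn: "win N \<Longrightarrow> inj_on f (pos N) \<Longrightarrow> win (rn f N)"
proof (induction rule: win.induct)
  case win_base
  then show ?case by (simp add: win.win_base)
next
  case (win_step R R' C)
  have "win (rn f (C + R'))"
    by (rule win_step.IH, rule inj_on_subset[OF win_step.prems])
      (use redex_pos[OF win_step.hyps(1)] in auto)
  moreover have "closed (rn f (C + R))" by (rule closed_rn) (use win_step in auto)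
  ultimately show ?case using win.win_step[OF redex_rn[OF win_step.hyps(1)], of "rn f C" f] by simp
qed

lemma win_rn_iff: "inj_on f (pos N) \<Longrightarrow> win (rn f N) \<longleftrightarrow> win N"
proof
  assume inj: "inj_on f (pos N)" and w: "win (rn f N)"
  let ?g = "inv_into (pos N) f"
  have "win (rn ?g (rn f N))" by (rule win_rn[OF w]) (simp add: inj_on_inv_into)
  also have "rn ?g (rn f N) = N" unfolding rn_comp by (rule rn_id) (simp add: inj)
  finally show "win N" .
qed (rule win_rn)

section \<open>Permuting the steps of a winning play\<close>

text \<open>The diamond behind the permutation arguments: two patterns without common link, each
  with its own context, sit side by side in one smaller context.\<close>

lemma split_disjoint:
  assumes "C + X = D + Y" "\<And>x. x \<in># X \<Longrightarrow> x \<notin># Y"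
  obtains E where "C = E + Y" "D = E + X"
proof
  have "Y \<subseteq># C"
  proof (rule mset_subset_eqI)
    fix a
    have "count C a + count X a = count D a + count Y a"
      using assms(1) by (metis count_union)
    moreover have "count X a = 0 \<or> count Y a = 0" using assms(2) by (meson not_in_iff)
    ultimately show "count Y a \<le> count C a" by auto
  qed
  then show c: "C = (C - Y) + Y" by simp
  show "D = (C - Y) + X" using assms(1) c
    by (metis add.commute add.left_commute add_left_cancel)
qed

lemma unique_producer:
  assumes "closed N" "l \<in># N" "l' \<in># N" "p \<in># atgt l" "p \<in># atgt l'"
  shows "l = l'"
proof (rule ccontr)
  assume "l \<noteq> l'"
  then obtain M where "N = add_mset l (add_mset l' M)"
    using assms(2,3) by (metis insert_noteq_member mset_add)
  with assms show False by (auto simp: closed_def simple_mset_add)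
qed

lemma unique_consumer:
  assumes "closed N" "l \<in># N" "l' \<in># N" "p \<in># asrc l" "p \<in># asrc l'"
  shows "l = l'"
proof (rule ccontr)
  assume "l \<noteq> l'"
  then obtain M where N: "N = add_mset l (add_mset l' M)"
    using assms(2,3) by (metis insert_noteq_member mset_add)
  have "simple_mset (src N)" using assms(1) by (simp add: closed_def)
  with assms N show False by (auto simp: simple_mset_add)
qed

lemma closed_simple: "closed N \<Longrightarrow> simple_mset (src N) \<and> simple_mset (tgt N)"
  by (simp add: closed_def)

lemma rstep_producer: "rstep p q l l' R' \<Longrightarrow> p \<in># atgt l \<and> q \<in># atgt l'"
  by (induction rule: rstep.induct) auto

lemma cut_eq_iff: "{#a, b#} = {#p, q#} \<longleftrightarrow> a = p \<and> b = q \<or> a = q \<and> b = p"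
  by (auto simp: add_eq_conv_ex)

text \<open>A cut determines the redex around it: each of its ends has only one producer, so only
  the orientation of the cut remains open.\<close>

lemma redex_at_cut:
  assumes c: "closed (C + R)" and r: "redex R R'" and m: "AC {#p, q#} \<in># R"
    and l: "l \<in># C + R" "p \<in># atgt l" and l': "l' \<in># C + R" "q \<in># atgt l'"
  shows "R = {#AC {#p, q#}, l, l'#} \<and> (rstep p q l l' R' \<or> rstep q p l' l R')"
proof -
  obtain a b k k' where R: "R = {#AC {#a, b#}, k, k'#}" and s: "rstep a b k k' R'"
    using r by (auto simp: redex_def)
  have pr: "a \<in># atgt k" "b \<in># atgt k'" using rstep_producer[OF s] by auto
  then have "AC {#p, q#} \<noteq> k" "AC {#p, q#} \<noteq> k'" by auto
  then have "{#p, q#} = {#a, b#}" using m R by auto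
  then consider "a = p" "b = q" | "a = q" "b = p" by (metis cut_eq_iff)
  then show ?thesis
  proof cases
    case 1
    then have "k = l" "k' = l'" using unique_producer[OF c] pr l l' R by (metis union_iff insert_iff set_mset_add_mset_insert)+
    with R s 1 show ?thesis by simp
  next
    case 2
    then have "k = l'" "k' = l" using unique_producer[OF c] pr l l' R by (metis union_iff insert_iff set_mset_add_mset_insert)+
    with R s 2 show ?thesis by (simp add: add_mset_commute)
  qed
qed

lemma redex_at_link:
  assumes r: "redex R R'" and l: "l \<in># R" "atgt l \<noteq> {#}"
  obtains p q l' where "R = {#AC {#p, q#}, l, l'#}" "p \<in># atgt l" "q \<in># atgt l'"
    "rstep p q l l' R' \<or> rstep q p l' l R'"
proof -
  obtain a b k k' where R: "R = {#AC {#a, b#}, k, k'#}" and s: "rstep a b k k' R'"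
    using r by (auto simp: redex_def)
  have pr: "a \<in># atgt k" "b \<in># atgt k'" using rstep_producer[OF s] by auto
  from l R consider "l = k" | "l = k'" by auto
  then show thesis
  proof cases
    case 1 then show ?thesis using that[of a b k'] R s pr by auto
  next
    case 2 then show ?thesis using that[of b a k] R s pr by (auto simp: add_mset_commute)
  qed
qed

text \<open>A play is followed while the links \<open>X\<close> are watched. Redexes away from
  \<open>X\<close> commute with anything done to \<open>X\<close>; only the first redex sharing a
  link with \<open>X\<close> has to be analysed, in the case \<open>overlap\<close>.\<close>

lemma win_pattern_induct [consumes 1, case_names base step overlap]:
  assumes w: "win (C + X)"
    and base: "\<And>C. C + X = {#AD {#}#} \<Longrightarrow> Q C"
    and step: "\<And>R R' E. redex R R' \<Longrightarrow> closed (E + R + X) \<Longrightarrow> Q (E + R') \<Longrightarrow> Q (E + R)"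
    and overlap: "\<And>R R' C0 C x. redex R R' \<Longrightarrow> closed (C + X) \<Longrightarrow> C0 + R = C + X \<Longrightarrow>
      win (C0 + R') \<Longrightarrow> x \<in># R \<Longrightarrow> x \<in># X \<Longrightarrow> Q C"
  shows "Q C"
proof -
  have "N = C + X \<Longrightarrow> Q C" if "win N" for N C
    using that
  proof (induction arbitrary: C rule: win.induct)
    case win_base then show ?case by (auto intro!: base)
  next
    case (win_step R R' C0)
    show ?case
    proof (cases "\<exists>x. x \<in># R \<and> x \<in># X")
      case True
      then obtain x where x: "x \<in># R" "x \<in># X" by blast
      show ?thesis
        by (rule overlap[of R R' C C0 x]) (use win_step x in \<open>simp_all\<close>)
    next
      case False
      then obtain E where E: "C0 = E + X" "C = E + R"
        using split_disjoint[OF win_step.prems] by auto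
      have "Q (E + R')" by (rule win_step.IH) (simp add: E add_ac)
      moreover have "closed (E + R + X)" using win_step.hyps win_step.prems E by (simp add: add_ac)
      ultimately show ?thesis unfolding E(2) using step win_step.hyps by blast
    qed
  qed
  with w show ?thesis by blast
qed

text \<open>A link enters a redex through one of its outputs. If \<open>p\<close> is its only
  output, the cut of the redex must be the consumer of \<open>p\<close>; when that consumer is a
  connective, this is absurd.\<close>

lemma redex_single_overlap:
  assumes c: "closed N" and sub: "N = C0 + R" and r: "redex R R'"
    and l: "l \<in># R" "atgt l = {#p#}" and k: "k \<in># N" "p \<in># asrc k"
  shows "k \<in># R"
proof -
  obtain a b l' where R: "R = {#AC {#a, b#}, l, l'#}" "a \<in># atgt l"
    by (rule redex_at_link[OF r l(1)]) (use l(2) in auto)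
  then have "p = a" using l by simp
  then have "AC {#a, b#} = k" using unique_consumer[OF c _ k(1) _ k(2)] R sub by auto
  then show ?thesis using R by simp
qed

text \<open>Both connectives can only fire through the cut between them, and that step involves no
  choice. All earlier steps of the play take place elsewhere, so they can be replayed after
  it.\<close>

lemma win_TP_inv:
  assumes "win (C + {#AC {#p, q#}, AT p1 p2 p, AP q1 q2 q#})" (is "win (C + ?X)")
  shows "win (C + {#AC {#p1, q1#}, AC {#p2, q2#}#})" (is "win (C + ?Y)")
  using assms
proof (induction C rule: win_pattern_induct)
  case (base C) then show ?case by (simp add: add_eq_conv_ex)
next
  case (step R R' E)
  have "redex ?X ?Y" by (intro redexI rstep.intros)
  then have "closed (E + R + ?Y)" using step redex_closed by metis
  then have "closed ((E + ?Y) + R)" by (simp add: add_ac)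
  moreover have "win ((E + ?Y) + R')" using step by (simp add: add_ac)
  ultimately have "win ((E + ?Y) + R)" using step win_step by blast
  then show ?case by (simp add: add_ac)
next
  case (overlap R R' C0 C x)
  have cl: "closed (C0 + R)" using overlap by simp
  have "AC {#p, q#} \<in># R"
    using overlap redex_single_overlap[OF cl refl overlap(1), of "AT p1 p2 p" p "AC {#p, q#}"]
      redex_single_overlap[OF cl refl overlap(1), of "AP q1 q2 q" q "AC {#p, q#}"] by auto
  from redex_at_cut[OF cl overlap(1) this, of "AT p1 p2 p" "AP q1 q2 q"]
  have R: "R = ?X" and s: "rstep p q (AT p1 p2 p) (AP q1 q2 q) R' \<or> rstep q p (AP q1 q2 q) (AT p1 p2 p) R'"
    by (auto simp: overlap(3))
  from s have "R' = ?Y" by (auto elim: rstep.cases)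
  with R overlap show ?case by simp
qed

text \<open>No rule matches two connectives of the same kind, and neither of them can fire through
  another cut, so the pattern would survive to the end of the play, where only an empty daimon is
  left.\<close>

lemma win_clash:
  assumes w: "win (C + {#AC {#p, q#}, l, l'#})" (is "win (C + ?X)")
    and l: "l = AT p1 p2 p \<and> l' = AT q1 q2 q \<or> l = AP p1 p2 p \<and> l' = AP q1 q2 q"
  shows False
  using w
proof (induction C rule: win_pattern_induct)
  case (base C) then show ?case by (simp add: add_eq_conv_ex)
next
  case (overlap R R' C0 C x)
  have cl: "closed (C0 + R)" using overlap by simp
  have t: "atgt l = {#p#}" "atgt l' = {#q#}" using l by auto
  have "AC {#p, q#} \<in># R"
    using overlap t redex_single_overlap[OF cl refl overlap(1), of "l" p "AC {#p, q#}"]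
      redex_single_overlap[OF cl refl overlap(1), of "l'" q "AC {#p, q#}"] by auto
  from redex_at_cut[OF cl overlap(1) this, of "l" "l'"]
  have s: "rstep p q l l' R' \<or> rstep q p l' l R'"
    by (auto simp: overlap(3) t)
  with l show ?case by (auto elim: rstep.cases)
qed

text \<open>A daimon without outputs belongs to no redex, and no step makes the other links vanish
  altogether, so such a daimon wins only alone.\<close>

lemma win_empty_daimon: "win (add_mset (AD {#}) C) \<Longrightarrow> C = {#}"
proof -
  assume "win (add_mset (AD {#}) C)"
  then have "win (C + {#AD {#}#})" by simp
  then show ?thesis
  proof (induction C rule: win_pattern_induct)
    case (step R R' E)
    then show ?case by (auto simp: redex_def elim: rstep.cases)
  next
    case (overlap R R' C0 C x)
    then show ?case by (auto simp: redex_def elim: rstep.cases)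
  qed simp
qed

text \<open>A rank rising from inputs to outputs witnesses that no connective lies above itself;
  \<open>is_net\<close> by itself allows such cycles.\<close>

definition ranked :: "('p \<Rightarrow> nat) \<Rightarrow> 'p alink multiset \<Rightarrow> bool" where
  "ranked h N \<longleftrightarrow> (\<forall>l\<in>#N. \<forall>s\<in>#asrc l. \<forall>t\<in>#atgt l. h s < h t)"

lemma ranked_cong: "(\<And>x. x \<in> pos N \<Longrightarrow> h x = k x) \<Longrightarrow> ranked h N = ranked k N"
proof -
  have "set_mset (asrc l) \<subseteq> pos N" "set_mset (atgt l) \<subseteq> pos N" if "l \<in># N" for l
    using multi_member_split[OF that] by auto
  then show "(\<And>x. x \<in> pos N \<Longrightarrow> h x = k x) \<Longrightarrow> ranked h N = ranked k N"
    unfolding ranked_def by (intro ball_cong refl) (simp add: subset_iff)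
qed

lemma ranked_add [simp]: "ranked h (M + N) \<longleftrightarrow> ranked h M \<and> ranked h N"
  "ranked h (add_mset l N) \<longleftrightarrow> (\<forall>s\<in>#asrc l. \<forall>t\<in>#atgt l. h s < h t) \<and> ranked h N"
  "ranked h {#}"
  by (auto simp: ranked_def)

text \<open>The rank is built backwards along the play, starting from the final net, where there is
  nothing to order.\<close>

lemma win_ranked: "win N \<Longrightarrow> \<exists>h. ranked h N"
proof (induction rule: win.induct)
  case (win_step R R' C)
  then obtain h where h: "ranked h (C + R')" by blast
  obtain p q l l' where R: "R = {#AC {#p, q#}, l, l'#}" and s: "rstep p q l l' R'"
    using win_step(1) by (auto simp: redex_def)
  have cl: "simple_mset (src (C + R))" "simple_mset (tgt (C + R))"
    using closed_simple[OF win_step(2)] by auto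
  \<comment> \<open>\<open>p\<close> and \<open>q\<close> occur in no link of \<open>C\<close>, so
    they can be lifted above all inputs in the redex without disturbing the ranks elsewhere.\<close>
  define k where "k = h(p := Suc (\<Sum>x\<in>#src R. h x), q := Suc (\<Sum>x\<in>#src R. h x))"
  have pq: "p \<notin> pos C" "q \<notin> pos C"
    using cl s rstep_producer[OF s] by (auto simp: R pos_def simple_mset_add disjoint_iff)
  have "ranked k C" using ranked_cong[of C k h] h pq unfolding k_def
    by (metis fun_upd_other ranked_add(1))
  moreover have "ranked k R"
    using s cl by cases (auto simp: R k_def simple_mset_add intro: )
  ultimately show ?case by auto
qed (auto simp: ranked_def)

text \<open>Flat nets, made of cuts and daimons, are seen as graphs whose edges are the cuts.\<close>

definition flat :: "'p alink multiset \<Rightarrow> bool" where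
  "flat N \<longleftrightarrow> (\<forall>l\<in>#N. (\<exists>ps. l = AC ps) \<or> (\<exists>ps. l = AD ps))"

definition const_on :: "('p \<Rightarrow> bool) \<Rightarrow> 'p set \<Rightarrow> bool" where
  "const_on U A \<longleftrightarrow> (\<forall>x\<in>A. \<forall>y\<in>A. U x = U y)"

lemma const_on_alt: "const_on U A \<longleftrightarrow> (\<exists>b. \<forall>x\<in>A. U x = b)"
  unfolding const_on_def by (cases "A = {}") (simp, metis ex_in_conv)

lemma const_onD: "const_on U A \<Longrightarrow> x \<in> A \<Longrightarrow> y \<in> A \<Longrightarrow> U x = U y"
  unfolding const_on_def by blast

lemma const_onI: "(\<And>x. x \<in> A \<Longrightarrow> U x = b) \<Longrightarrow> const_on U A"
  by (simp add: const_on_def)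

lemma const_on_insert: "const_on U (insert x A) \<longleftrightarrow> (\<forall>y\<in>A. U y = U x)"
  using const_onD[of U "insert x A" _ x] const_onI[of "insert x A" U "U x"] by blast

lemma union_eq_add_mset:
  assumes "M + N = add_mset p P"
  shows "(\<exists>M'. M = add_mset p M' \<and> P = M' + N) \<or> (\<exists>N'. N = add_mset p N' \<and> P = M + N')"
proof -
  have "p \<in># M + N" using assms by simp
  then consider "p \<in># M" | "p \<in># N" by auto
  then show ?thesis
  proof cases
    case 1 then obtain M' where "M = add_mset p M'" by (metis mset_add)
    with assms show ?thesis by simp
  next
    case 2 then obtain N' where "N = add_mset p N'" by (metis mset_add)
    with assms show ?thesis by simp
  qed
qed

lemma flat_redex:
  assumes "redex R R'" "flat R"
  shows "\<exists>p q ds es. R = {#AC {#p, q#}, AD (add_mset p ds), AD (add_mset q es)#} \<and> R' = {#AD (ds + es)#}"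
  using assms by (auto simp: redex_def flat_def elim!: rstep.cases)

lemma flat_add [simp]: "flat (M + N) \<longleftrightarrow> flat M \<and> flat N"
  "flat (add_mset l N) \<longleftrightarrow> ((\<exists>ps. l = AC ps) \<or> (\<exists>ps. l = AD ps)) \<and> flat N" "flat {#}"
  by (auto simp: flat_def)

text \<open>A colouring that respects all links survives the fusion of two daimons, so connectedness
  is pulled back along the play from the final one-node graph.\<close>

lemma flat_connected:
  assumes "win N" "flat N" "\<And>ps. AD ps \<in># N \<Longrightarrow> const_on U (set_mset ps)"
    "\<And>ps. AC ps \<in># N \<Longrightarrow> const_on U (set_mset ps)"
  shows "const_on U (pos N)"
  using assms
proof (induction rule: win.induct)
  case win_base show ?case by (simp add: const_on_def)
next
  case (win_step R R' C)
  have "flat R" using win_step by simp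
  then obtain p q ds es where R: "R = {#AC {#p, q#}, AD (add_mset p ds), AD (add_mset q es)#}" "R' = {#AD (ds + es)#}"
    by (elim flat_redex[OF win_step(1), elim_format] exE conjE) iprover
  have "AC {#p, q#} \<in># C + R" by (simp add: R)
  then have pq: "U p = U q" using const_onD[OF win_step.prems(3), of "{#p, q#}" p q] by simp
  have d: "\<forall>x\<in>#ds. U x = U p"
    by (intro ballI const_onD[OF win_step.prems(2), of "add_mset p ds"]) (simp_all add: R)
  have e: "\<forall>x\<in>#es. U x = U p"
    unfolding pq by (intro ballI const_onD[OF win_step.prems(2), of "add_mset q es"]) (simp_all add: R)
  have c: "const_on U (pos (C + R'))"
  proof (rule win_step.IH)
    show "flat (C + R')" using win_step.prems by (simp add: R)
    show "const_on U (set_mset ps)" if "AD ps \<in># C + R'" for ps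
    proof (cases "ps = ds + es")
      case True
      with d e show ?thesis by (intro const_onI[of _ _ "U p"]) auto
    next
      case False
      with that show ?thesis by (intro win_step.prems(2)) (simp add: R)
    qed
    show "const_on U (set_mset ps)" if "AC ps \<in># C + R'" for ps
      by (rule win_step.prems(3)) (use that in \<open>simp add: R\<close>)
  qed
  \<comment> \<open>An empty fused daimon carries no colour that would tie the redex to its context;
    but then the context is empty.\<close>
  show ?case
  proof (cases "ds + es = {#}")
    case True
    then have "C = {#}" using win_step(3) win_empty_daimon by (simp add: R)
    with True pq show ?thesis by (intro const_onI[of _ _ "U p"]) (auto simp: R)
  next
    case False
    then obtain x where x: "x \<in># ds + es" by (metis multiset_nonemptyE)
    then have "U x = U p" using d e by auto
    then have "U y = U p" if "y \<in> pos (C + R')" for y using const_onD[OF c that, of x] x by (auto simp: R)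
    then show ?thesis using pq d e by (intro const_onI[of _ _ "U p"]) (auto simp: R)
  qed
qed

text \<open>A daimon is a node of a tree: once its outputs are divided into \<open>fs\<close> and
  \<open>gs\<close>, the two halves of the tree can be coloured differently. When the divided daimon
  is fused with another one, the latter goes along with the half that contains the cut.\<close>

lemma flat_split:
  assumes "win N" "flat N" "N = add_mset (AD (fs + gs)) C"
  shows "\<exists>U. (\<forall>x\<in>#fs. U x) \<and> (\<forall>x\<in>#gs. \<not> U x) \<and> (\<forall>l\<in>#C. const_on U (set_alink l))"
  using assms
proof (induction arbitrary: fs gs C rule: win.induct)
  case win_base then show ?case by auto
next
  case (win_step R R' B)
  have "flat (B + R)" using win_step.prems by simp
  then have "flat R" by simp
  then obtain p q ds es where R: "R = {#AC {#p, q#}, AD (add_mset p ds), AD (add_mset q es)#}" "R' = {#AD (ds + es)#}"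
    by (elim flat_redex[OF win_step(1), elim_format] exE conjE) iprover
  have fl: "flat (B + R')" using \<open>flat (B + R)\<close> by (simp add: R)
  have pq: "p \<notin> pos B" "q \<notin> pos B" "p \<noteq> q" "p \<notin># ds + es" "q \<notin># ds + es"
    using closed_simple[OF win_step(2)] by (auto simp: R pos_def simple_mset_add disjoint_iff)
  have ext: "const_on (U(p := b, q := b)) (set_alink l)"
    if "l \<in># B" "const_on U (set_alink l)" for U b l
  proof -
    have "set_alink l \<subseteq> pos B" using multi_member_split[OF that(1)] by (auto simp: set_alink_eq)
    then have "\<forall>x\<in>set_alink l. (U(p := b, q := b)) x = U x" using pq by auto
    with that(2) show ?thesis by (metis const_on_alt)
  qed
  \<comment> \<open>\<open>r\<close> is the end of the cut in the divided daimon, \<open>gs\<close>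
    are the other outputs on its side, \<open>as\<close> those of the second daimon and
    \<open>hs\<close> the opposite side; \<open>b\<close> is the colour of the side of
    \<open>r\<close>.\<close>
  have key: "\<exists>U. (\<forall>x\<in>#as + add_mset r gs. U x = b) \<and> (\<forall>x\<in>#hs. U x = (\<not> b)) \<and> (\<forall>l\<in>#B. const_on U (set_alink l)) \<and> U p = U q"
    if eq: "ds + es = as + gs + hs" and r: "r = p \<or> r = q" for as gs hs r and b :: bool
  proof -
    have "\<exists>U. (\<forall>x\<in>#as + gs. U x = b) \<and> (\<forall>x\<in>#hs. U x = (\<not> b)) \<and> (\<forall>l\<in>#B. const_on U (set_alink l))"
    proof (cases b)
      case True
      show ?thesis using win_step.IH[OF fl, of "as + gs" hs B] by (simp add: R eq True)
    next
      case False
      show ?thesis using win_step.IH[OF fl, of hs "as + gs" B] by (auto simp: R eq False add_ac)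
    qed
    then obtain U where U: "\<forall>x\<in>#as + gs. U x = b" "\<forall>x\<in>#hs. U x = (\<not> b)" "\<forall>l\<in>#B. const_on U (set_alink l)"
      by blast
    let ?U = "U(p := b, q := b)"
    have "\<forall>x\<in>#as + gs + hs. ?U x = U x" using pq unfolding eq by auto
    then show ?thesis using U ext r by (intro exI[of _ ?U]) (auto 0 3)
  qed
  have eq: "B + R = add_mset (AD (fs + gs)) C" by fact
  then have "AD (fs + gs) \<in># B + R" by simp
  then consider "AD (fs + gs) \<in># B" | "fs + gs = add_mset p ds" | "fs + gs = add_mset q es"
    by (auto simp: R)
  then show ?case
  proof cases
    case 1
    then obtain E where E: "B = add_mset (AD (fs + gs)) E" by (metis mset_add)
    then have C: "C = E + R" using eq by simp
    obtain U where U: "\<forall>x\<in>#fs. U x" "\<forall>x\<in>#gs. \<not> U x" "\<forall>l\<in>#E + R'. const_on U (set_alink l)"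
      using win_step.IH[OF fl, of fs gs "E + R'"] by (auto simp: E)
    from U(3) obtain b where b: "\<forall>x\<in>#ds + es. U x = b" by (auto simp: R const_on_alt)
    define V where "V = U(p := b, q := b)"
    have "\<forall>x\<in>#fs + gs. V x = U x" using pq by (auto simp: E V_def)
    moreover have "\<forall>x\<in>#ds + es. V x = b" using b by (auto simp: V_def)
    moreover have "\<forall>l\<in>#E. const_on V (set_alink l)" using U(3) ext by (auto simp: E V_def)
    moreover have "const_on V {p, q}" "const_on V (set_mset (add_mset p ds))" "const_on V (set_mset (add_mset q es))"
      by (rule const_onI[of _ _ b]; use b pq in \<open>auto simp: V_def\<close>)+
    ultimately show ?thesis using U(1,2) unfolding C by (intro exI[of _ V]) (simp add: R)
  next
    case 2
    then have C: "C = B + {#AC {#p, q#}, AD (add_mset q es)#}" using eq by (simp add: R add_mset_commute)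
    from union_eq_add_mset[OF 2] consider fs' where "fs = add_mset p fs'" "ds = fs' + gs" | gs' where "gs = add_mset p gs'" "ds = fs + gs'"
      by (elim disjE exE conjE)
    then show ?thesis
    proof cases
      case 1
      obtain U where "\<forall>x\<in>#es + add_mset p fs'. U x = True" "\<forall>x\<in>#gs. U x = (\<not> True)"
        "\<forall>l\<in>#B. const_on U (set_alink l)" "U p = U q"
        using key[of es fs' gs p True] 1 by (auto simp: add_ac)
      then show ?thesis by (intro exI[of _ U]) (simp add: 1 C const_on_insert)
    next
      case 2
      obtain U where "\<forall>x\<in>#es + add_mset p gs'. U x = False" "\<forall>x\<in>#fs. U x = (\<not> False)"
        "\<forall>l\<in>#B. const_on U (set_alink l)" "U p = U q"
        using key[of es gs' fs p False] 2 by (auto simp: add_ac)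
      then show ?thesis by (intro exI[of _ U]) (simp add: 2 C const_on_insert)
    qed
  next
    case 3
    then have C: "C = B + {#AC {#p, q#}, AD (add_mset p ds)#}" using eq by (simp add: R add_mset_commute)
    from union_eq_add_mset[OF 3] consider fs' where "fs = add_mset q fs'" "es = fs' + gs" | gs' where "gs = add_mset q gs'" "es = fs + gs'"
      by (elim disjE exE conjE)
    then show ?thesis
    proof cases
      case 1
      obtain U where "\<forall>x\<in>#ds + add_mset q fs'. U x = True" "\<forall>x\<in>#gs. U x = (\<not> True)"
        "\<forall>l\<in>#B. const_on U (set_alink l)" "U p = U q"
        using key[of ds fs' gs q True] 1 by (auto simp: add_ac)
      then show ?thesis by (intro exI[of _ U]) (simp add: 1 C const_on_insert)
    next
      case 2
      obtain U where "\<forall>x\<in>#ds + add_mset q gs'. U x = False" "\<forall>x\<in>#fs. U x = (\<not> False)"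
        "\<forall>l\<in>#B. const_on U (set_alink l)" "U p = U q"
        using key[of ds gs' fs q False] 2 by (auto simp: add_ac)
      then show ?thesis by (intro exI[of _ U]) (simp add: 2 C const_on_insert)
    qed
  qed
qed

text \<open>Splitting \<open>p\<close> off its daimon separates it from the other outputs
  \<open>ds\<close>, and the cut gives \<open>q\<close> the colour of \<open>p\<close>. Recolouring
  \<open>p\<close> like \<open>ds\<close> then makes the cut the only violated link.\<close>

lemma flat_acyclic:
  assumes w: "win N" and fl: "flat N" and N: "N = add_mset (AC {#p, q#}) C"
  shows "\<exists>U. U p \<noteq> U q \<and> (\<forall>l\<in>#C. const_on U (set_alink l))"
proof -
  have cl: "closed N" using w by (rule win_closed)
  then have "p \<in># tgt N" unfolding closed_def by (metis N asrc.simps(3) src_simps(2) union_iff union_single_eq_member)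
  then have "p \<in># tgt C" unfolding N tgt_simps atgt.simps by simp
  then obtain l where l: "l \<in># C" "p \<in># atgt l" by (auto simp: tgt_def)
  moreover have "(\<exists>ps. l = AC ps) \<or> (\<exists>ps. l = AD ps)" using l fl by (auto simp: flat_def N)
  ultimately obtain ds where "l = AD (add_mset p ds)" by (auto dest: multi_member_split)
  with l obtain D where D: "C = add_mset (AD (add_mset p ds)) D" by (metis mset_add)
  have "N = add_mset (AD ({#p#} + ds)) (add_mset (AC {#p, q#}) D)" by (simp add: N D add_mset_commute)
  from flat_split[OF w fl this] obtain U where
    U: "U p" "\<forall>x\<in>#ds. \<not> U x" "const_on U {p, q}" "\<forall>l\<in>#D. const_on U (set_alink l)" by auto
  have simp: "p \<noteq> q" "p \<notin> pos D" "p \<notin># ds" using closed_simple[OF cl] by (auto simp: N D pos_def simple_mset_add)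
  have "const_on (U(p := False)) (set_alink l)" if "l \<in># D" for l
  proof -
    have "set_alink l \<subseteq> pos D" using multi_member_split[OF that(1)] by (auto simp: set_alink_eq)
    then have "\<forall>x\<in>set_alink l. (U(p := False)) x = U x" using simp by auto
    then show ?thesis using U(4) that by (metis const_on_alt)
  qed
  moreover have "U q" using U(1,3) by (simp add: const_on_insert)
  ultimately show ?thesis using U simp by (intro exI[of _ "U(p := False)"]) (simp add: D const_on_insert)
qed

section \<open>Fusing and contracting daimons inside a winning net\<close>

lemma redex_at_daimon:
  assumes r: "redex R R'" and l: "AD fs \<in># R"
  obtains d r fs' l where "fs = add_mset d fs'" "R = {#AC {#d, r#}, AD fs, l#}" "r \<in># atgt l"
    "(\<exists>r1 r2. l = AT r1 r2 r \<and> R' = {#AC {#r1, r#}, AC {#r2, d#}, AD (add_mset r (add_mset d fs'))#}) \<or>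
     (\<exists>r1 r2 f1 f2. l = AP r1 r2 r \<and> fs' = f1 + f2 \<and>
        R' = {#AC {#r1, r#}, AC {#r2, d#}, AD (add_mset r f1), AD (add_mset d f2)#}) \<or>
     (\<exists>gs. l = AD (add_mset r gs) \<and> R' = {#AD (fs' + gs)#})"
proof -
  have "fs \<noteq> {#}" using r l by (auto simp: redex_def elim!: rstep.cases)
  then obtain d r l' where R: "R = {#AC {#d, r#}, AD fs, l'#}" and d: "d \<in># fs" "r \<in># atgt l'"
    and s: "rstep d r (AD fs) l' R' \<or> rstep r d l' (AD fs) R'"
    by (rule_tac redex_at_link[OF r l]) auto
  obtain fs' where fs: "fs = add_mset d fs'" using d by (metis mset_add)
  show thesis
  proof (rule that[OF fs R d(2)])
    from s show "(\<exists>r1 r2. l' = AT r1 r2 r \<and> R' = {#AC {#r1, r#}, AC {#r2, d#}, AD (add_mset r (add_mset d fs'))#}) \<or>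
     (\<exists>r1 r2 f1 f2. l' = AP r1 r2 r \<and> fs' = f1 + f2 \<and>
        R' = {#AC {#r1, r#}, AC {#r2, d#}, AD (add_mset r f1), AD (add_mset d f2)#}) \<or>
     (\<exists>gs. l' = AD (add_mset r gs) \<and> R' = {#AD (fs' + gs)#})"
      unfolding fs
    proof
      assume "rstep d r (AD (add_mset d fs')) l' R'"
      then show ?thesis by (auto elim!: rstep.cases)
    next
      assume "rstep r d l' (AD (add_mset d fs')) R'"
      then show ?thesis by cases (auto simp: add.commute)
    qed
  qed
qed

lemma closed_merge:
  assumes "closed (C + {#AC {#p, q#}, AD (add_mset p ds), AD (add_mset q es)#})"
  shows "closed (C + {#AD (ds + es)#})"
  by (rule redex_closed[OF redexI[OF DD] assms])

lemma win_stepI: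
  assumes "rstep p q l l' R'" "closed (C + {#AC {#p, q#}, l, l'#})" "win (C + R')"
  shows "win (C + {#AC {#p, q#}, l, l'#})"
  using win_step[OF redexI[OF assms(1)] assms(2,3)] .

lemma rn_fresh: "p \<notin> pos E \<Longrightarrow> q \<notin> pos E \<Longrightarrow> rn (\<lambda>x. if x = p then p' else if x = q then q' else x) E = E"
  by (rule rn_id) auto

lemma win_rename2:
  assumes "win (E + X)" "p \<notin> pos E" "q \<notin> pos E" "p' \<notin> pos (E + X)" "q' \<notin> pos (E + X)" "p' \<noteq> q'"
  shows "win (E + rn (\<lambda>x. if x = p then p' else if x = q then q' else x) X)"
proof -
  let ?f = "\<lambda>x. if x = p then p' else if x = q then q' else x"
  have "win (rn ?f (E + X))" by (rule win_rn[OF assms(1)]) (use assms(4-) in \<open>auto simp: inj_on_def\<close>)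
  then show ?thesis using rn_fresh[OF assms(2,3)] by simp
qed

text \<open>The redex fires at an output \<open>d\<close> of the first daimon other than
  \<open>p\<close>. In the fused net the same redex exists, with \<open>es\<close> following
  \<open>p\<close> among the outputs that stand by.\<close>

lemma merge_step:
  assumes cl: "closed (C + {#AC {#p, q#}, AD (add_mset p ds), AD (add_mset q es)#})"
    and r: "redex R R'" and w: "win (B + R')"
    and eq: "B + R = C + {#AC {#p, q#}, AD (add_mset p ds), AD (add_mset q es)#}"
    and IH: "\<And>C ds. B + R' = C + {#AC {#p, q#}, AD (add_mset p ds), AD (add_mset q es)#} \<Longrightarrow> win (C + {#AD (ds + es)#})"
    and nc: "AC {#p, q#} \<notin># R" and m: "AD (add_mset p ds) \<in># R"
  shows "win (C + {#AD (ds + es)#})"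
proof -
  have cl': "closed (B + R)" using cl eq by simp
  have simp: "simple_mset (src (B + R))" "simple_mset (tgt (B + R))" using closed_simple[OF cl'] by auto
  obtain d r fs' l where fs: "add_mset p ds = add_mset d fs'" and R: "R = {#AC {#d, r#}, AD (add_mset p ds), l#}"
    and l: "r \<in># atgt l" and
    c: "(\<exists>r1 r2. l = AT r1 r2 r \<and> R' = {#AC {#r1, r#}, AC {#r2, d#}, AD (add_mset r (add_mset d fs'))#}) \<or>
     (\<exists>r1 r2 f1 f2. l = AP r1 r2 r \<and> fs' = f1 + f2 \<and>
        R' = {#AC {#r1, r#}, AC {#r2, d#}, AD (add_mset r f1), AD (add_mset d f2)#}) \<or>
     (\<exists>gs. l = AD (add_mset r gs) \<and> R' = {#AD (fs' + gs)#})"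
    by (rule redex_at_daimon[OF r m])
  have "AC {#p, q#} \<in># B + R" using eq by simp
  moreover have "AC {#d, r#} \<in># B + R" by (simp add: R)
  ultimately have "d \<noteq> p" using unique_consumer[OF cl', of "AC {#p, q#}" "AC {#d, r#}" p] nc R by auto
  then obtain g where g: "ds = add_mset d g" "fs' = add_mset p g" using fs by (auto simp: add_eq_conv_ex)
  show ?thesis
  proof (cases "l = AD (add_mset q es)")
    case True
    with c l obtain gs where gs: "add_mset q es = add_mset r gs" "R' = {#AD (fs' + gs)#}" by auto
    have "AC {#p, q#} \<noteq> AC {#d, r#}" using nc R by auto
    then have "r \<noteq> q" using unique_consumer[OF cl', of "AC {#p, q#}" "AC {#d, r#}" q] \<open>AC {#p, q#} \<in># B + R\<close> \<open>AC {#d, r#} \<in># B + R\<close> by auto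
    then obtain h where h: "es = add_mset r h" "gs = add_mset q h" using gs by (auto simp: add_eq_conv_ex)
    have "B + {#AC {#d, r#}#} = C + {#AC {#p, q#}#}"
      using eq R True by (simp add: add_mset_commute)
    then obtain E where E: "B = E + {#AC {#p, q#}#}" "C = E + {#AC {#d, r#}#}"
      by (rule split_disjoint) (use nc R in auto)
    have w': "win (E + {#AC {#p, q#}, AD (add_mset p (add_mset q (g + h)))#})"
      using w by (simp add: E gs g h add_mset_commute)
    have fr: "p \<notin> pos E" "q \<notin> pos E" "d \<notin> pos E" "r \<notin> pos E" "p \<notin># g + h" "q \<notin># g + h" "d \<notin># g + h" "r \<notin># g + h" "p \<noteq> q" "d \<noteq> r" "d \<noteq> p" "d \<noteq> q" "r \<noteq> p" "r \<noteq> q"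
      using simp \<open>d \<noteq> p\<close> \<open>r \<noteq> q\<close> by (auto simp: E R True g h pos_def simple_mset_add disjoint_iff)
    \<comment> \<open>A second cut joins the same two daimons. Fusing along either cut leaves the
      other one as a loop on the fused daimon, so the two results differ by a renaming.\<close>
    have "win (E + rn (\<lambda>x. if x = p then d else if x = q then r else x) {#AC {#p, q#}, AD (add_mset p (add_mset q (g + h)))#})"
      by (rule win_rename2[OF w']) (use fr in auto)
    moreover have "image_mset (\<lambda>x. if x = p then d else if x = q then r else x) (g + h) = g + h"
    proof -
      have "image_mset (\<lambda>x. if x = p then d else if x = q then r else x) (g + h) = image_mset id (g + h)"
        by (rule image_mset_cong) (use fr in auto)
      then show ?thesis by simp
    qed
    ultimately show ?thesis using fr by (simp add: E g h add_mset_commute flip: image_mset_union)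
  next
    case False
    have sp: "B + {#AC {#d, r#}, l#} = C + {#AC {#p, q#}, AD (add_mset q es)#}"
      using eq R by (simp add: add_mset_commute)
    have "AC {#p, q#} \<noteq> l" using l by auto
    have "AD (add_mset q es) \<noteq> AC {#d, r#}" "AC {#p, q#} \<noteq> AC {#d, r#}" using nc R by auto
    obtain E where E: "B = E + {#AC {#p, q#}, AD (add_mset q es)#}" "C = E + {#AC {#d, r#}, l#}"
      by (rule split_disjoint[OF sp]) (use False \<open>AC {#p, q#} \<noteq> l\<close> \<open>AC {#p, q#} \<noteq> AC {#d, r#}\<close> in auto)
    have cl2: "closed (E + {#AC {#d, r#}, AD (add_mset d (g + es)), l#})"
      using closed_merge[OF cl] by (simp add: E g add_mset_commute)
    from c show ?thesis
    proof (elim disjE exE conjE)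
      fix r1 r2 assume l: "l = AT r1 r2 r" and R': "R' = {#AC {#r1, r#}, AC {#r2, d#}, AD (add_mset r (add_mset d fs'))#}"
      have "win ((E + {#AC {#r1, r#}, AC {#r2, d#}#}) + {#AD (add_mset r (add_mset d g) + es)#})"
        by (rule IH) (simp add: E R' g add_mset_commute)
      then have "win (E + {#AC {#r, d#}, AT r1 r2 r, AD (add_mset d (g + es))#})"
        by (intro win_stepI[OF TD]) (use cl2 in \<open>simp_all add: l add_mset_commute\<close>)
      then show ?thesis by (simp add: E g l add_mset_commute)
    next
      fix r1 r2 f1 f2 assume l: "l = AP r1 r2 r" and f: "fs' = f1 + f2"
        and R': "R' = {#AC {#r1, r#}, AC {#r2, d#}, AD (add_mset r f1), AD (add_mset d f2)#}"
      have fin: ?thesis if "win (E + {#AC {#r1, r#}, AC {#r2, d#}, AD (add_mset r h1), AD (add_mset d h2)#})"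
        and h: "h1 + h2 = g + es" for h1 h2
      proof -
        have "win (E + {#AC {#r, d#}, AP r1 r2 r, AD (add_mset d (h1 + h2))#})"
          by (intro win_stepI[OF PD]) (use cl2 that(1) in \<open>simp_all add: l add_mset_commute h\<close>)
        then show ?thesis by (simp add: E g l h add_mset_commute)
      qed
      \<comment> \<open>In the fused net, \<open>es\<close> has to go into the half of the split
        that received \<open>p\<close>.\<close>
      have "f1 + f2 = add_mset p g" using f g by simp
      then have "p \<in># f1 + f2" by simp
      then consider "p \<in># f1" | "p \<in># f2" by auto
      then show ?thesis
      proof cases
        case 1
        then obtain h1 where h1: "f1 = add_mset p h1" by (metis mset_add)
        have "win ((E + {#AC {#r1, r#}, AC {#r2, d#}, AD (add_mset d f2)#}) + {#AD (add_mset r h1 + es)#})"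
          by (rule IH) (simp add: E R' h1 add_mset_commute)
        then show ?thesis by (intro fin[of "h1 + es" f2]) (use g f h1 in \<open>simp_all add: add_mset_commute add_ac\<close>)
      next
        case 2
        then obtain h2 where h2: "f2 = add_mset p h2" by (metis mset_add)
        have "win ((E + {#AC {#r1, r#}, AC {#r2, d#}, AD (add_mset r f1)#}) + {#AD (add_mset d h2 + es)#})"
          by (rule IH) (simp add: E R' h2 add_mset_commute)
        then show ?thesis by (intro fin[of f1 "h2 + es"]) (use g f h2 in \<open>simp_all add: add_mset_commute add_ac\<close>)
      qed
    next
      fix gs assume l: "l = AD (add_mset r gs)" and R': "R' = {#AD (fs' + gs)#}"
      have "win (E + {#AD (g + gs + es)#})"
        by (rule IH) (simp add: E R' g add_mset_commute)
      then have "win (E + {#AC {#d, r#}, AD (add_mset d (g + es)), AD (add_mset r gs)#})"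
        by (intro win_stepI[OF DD]) (use cl2 in \<open>simp_all add: l add_ac\<close>)
      then show ?thesis by (simp add: E g l add_mset_commute)
    qed
  qed
qed

text \<open>Fusion is a step without choice, so performing it first never spoils a winning
  play.\<close>

lemma win_merge:
  assumes "win (C + {#AC {#p, q#}, AD (add_mset p ds), AD (add_mset q es)#})"
  shows "win (C + {#AD (ds + es)#})"
proof -
  have "win N \<Longrightarrow> N = C + {#AC {#p, q#}, AD (add_mset p ds), AD (add_mset q es)#} \<Longrightarrow> win (C + {#AD (ds + es)#})" for N
  proof (induction N arbitrary: C p q ds es rule: win.induct)
    case win_base then show ?case by (simp add: add_eq_conv_ex)
  next
    case (win_step R R' B)
    let ?X = "{#AC {#p, q#}, AD (add_mset p ds), AD (add_mset q es)#}"
    have cl: "closed (C + ?X)" using win_step by simp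
    show ?case
    proof (cases "AC {#p, q#} \<in># R")
      case True
      from redex_at_cut[OF win_step(2,1) True, of "AD (add_mset p ds)" "AD (add_mset q es)"]
      have "R = ?X" "R' = {#AD (ds + es)#}"
        using win_step.prems by (auto elim!: rstep.cases)
      then show ?thesis using win_step by simp
    next
      case nc: False
      consider "AD (add_mset p ds) \<in># R" | "AD (add_mset q es) \<in># R" | "AD (add_mset p ds) \<notin># R" "AD (add_mset q es) \<notin># R" by blast
      then show ?thesis
      proof cases
        case 1
        show ?thesis
          by (rule merge_step[OF cl win_step(1,3) win_step.prems _ nc 1]) (rule win_step.IH)
      next
        case 2
        have s: "?X = {#AC {#q, p#}, AD (add_mset q es), AD (add_mset p ds)#}" by (simp add: add_mset_commute)
        have "win (C + {#AD (es + ds)#})"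
        proof (rule merge_step[of C q p es ds R R' B])
          fix D hs
          assume "B + R' = D + {#AC {#q, p#}, AD (add_mset q hs), AD (add_mset p ds)#}"
          then have "B + R' = D + {#AC {#p, q#}, AD (add_mset p ds), AD (add_mset q hs)#}"
            by (simp add: add_mset_commute)
          then show "win (D + {#AD (hs + ds)#})" using win_step.IH by (simp add: add.commute)
        qed (use cl win_step(1,3) win_step.prems nc 2 s in \<open>simp_all add: add_mset_commute\<close>)
        then show ?thesis by (simp add: add.commute)
      next
        case 3
        obtain E where E: "B = E + ?X" "C = E + R"
          by (rule split_disjoint[OF win_step.prems]) (use 3 nc in auto)
        have "win ((E + R') + {#AD (ds + es)#})" by (rule win_step.IH) (simp add: E add_mset_commute)
        then have "win ((E + {#AD (ds + es)#}) + R')" by simp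
        moreover have "closed ((E + {#AD (ds + es)#}) + R)" using closed_merge[OF cl] by (simp add: E)
        ultimately have "win ((E + {#AD (ds + es)#}) + R)" by (rule win.win_step[OF win_step(1), rotated])
        then show ?thesis by (simp add: E)
      qed
    qed
  qed
  then show ?thesis using assms by blast
qed

text \<open>The inputs of the tensor come from its own daimons, so the first step meeting the
  pattern is at the cut below it. A daimon with output \<open>p\<close> answers a par by splitting
  into two one-output daimons, which is what the tensor offers; against a daimon both versions end
  in the same fusion.\<close>

lemma win_contract_tensor:
  assumes "win (C + {#AT p1 p2 p, AD {#p1#}, AD {#p2#}#})" (is "win (C + ?X)")
  shows "win (C + {#AD {#p#}#})"
  using assms
proof (induction C rule: win_pattern_induct)
  case (base C) then show ?case by (simp add: add_eq_conv_ex)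
next
  case (step R R' E)
  have "closed ((E + {#AD {#p#}#}) + R)"
    using step(2) by (auto simp: closed_def simple_mset_add add_mset_commute)
  moreover have "win ((E + {#AD {#p#}#}) + R')" using step by (simp add: add_ac)
  ultimately have "win ((E + {#AD {#p#}#}) + R)" using step win_step by blast
  then show ?case by (simp add: add_ac)
next
  case (overlap R R' C0 C x)
  have cl: "closed (C0 + R)" using overlap by simp
  have "AT p1 p2 p \<in># R"
    using overlap redex_single_overlap[OF cl refl overlap(1), of "AD {#p1#}" p1 "AT p1 p2 p"]
      redex_single_overlap[OF cl refl overlap(1), of "AD {#p2#}" p2 "AT p1 p2 p"] by auto
  then obtain q l where R: "R = {#AC {#p, q#}, AT p1 p2 p, l#}" and l: "q \<in># atgt l"
    and s: "rstep p q (AT p1 p2 p) l R' \<or> rstep q p l (AT p1 p2 p) R'"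
    by (rule_tac redex_at_link[OF overlap(1), of "AT p1 p2 p"]) auto
  have simp: "simple_mset (src (C0 + R))" "simple_mset (tgt (C0 + R))" using closed_simple[OF cl] by auto
  have eq: "C0 + {#AC {#p, q#}, l#} = C + {#AD {#p1#}, AD {#p2#}#}"
    using overlap(3) by (simp add: R add_mset_commute)
  have nl: "l \<noteq> AD {#p1#}" "l \<noteq> AD {#p2#}"
    using s simp by (auto elim!: rstep.cases simp: R simple_mset_add)
  obtain E where E: "C0 = E + {#AD {#p1#}, AD {#p2#}#}" "C = E + {#AC {#p, q#}, l#}"
    by (rule split_disjoint[OF eq]) (use nl in auto)
  have cl': "closed (E + {#AC {#p, q#}, l, AD {#p#}#})"
    using cl by (auto simp: E R closed_def simple_mset_add add_mset_commute)
  from s consider q1 q2 where "l = AP q1 q2 q" "R' = {#AC {#p1, q1#}, AC {#p2, q2#}#}"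
    | ds where "l = AD (add_mset q ds)" "R' = {#AC {#p1, p#}, AC {#p2, q#}, AD (add_mset p (add_mset q ds))#}"
    by (auto elim: rstep.cases)
  then show ?case
  proof cases
    case 1
    have fr: "p \<notin> pos E" "q \<notin> pos E" "p1 \<notin> pos E" "p2 \<notin> pos E" "p \<noteq> q" "p1 \<noteq> p2"
      "p \<noteq> p1" "p \<noteq> p2" "q \<noteq> p1" "q \<noteq> p2" "p \<noteq> q1" "p \<noteq> q2" "q \<noteq> q1" "q \<noteq> q2" "p1 \<noteq> q1" "p1 \<noteq> q2" "p2 \<noteq> q1" "p2 \<noteq> q2"
      using simp by (auto simp: E R 1 pos_def simple_mset_add disjoint_iff)
    have "win (E + {#AD {#p1#}, AD {#p2#}, AC {#p1, q1#}, AC {#p2, q2#}#})"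
      using overlap(4) by (simp add: E 1 add_mset_commute)
    \<comment> \<open>The roles of \<open>p1\<close> and \<open>p2\<close> are taken over by
      \<open>q\<close> and \<open>p\<close>, the positions that are reused when the daimon meets the
      par.\<close>
    from win_rename2[OF this fr(3,4), of q p]
    have "win (E + {#AC {#q1, q#}, AC {#q2, p#}, AD (add_mset q {#}), AD (add_mset p {#})#})"
      using fr by (auto simp: add_mset_commute)
    then have "win (E + {#AC {#q, p#}, AP q1 q2 q, AD (add_mset p ({#} + {#}))#})"
      by (intro win_stepI[OF PD]) (use cl' in \<open>simp_all add: 1 add_mset_commute\<close>)
    then show ?thesis by (simp add: E 1 add_mset_commute)
  next
    case 2
    have "win ((E + {#AC {#p2, q#}, AD {#p2#}#}) + {#AC {#p1, p#}, AD (add_mset p1 {#}), AD (add_mset p (add_mset q ds))#})"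
      using overlap(4) by (simp add: E 2 add_mset_commute)
    from win_merge[OF this]
    have "win (E + {#AC {#p2, q#}, AD (add_mset p2 {#}), AD (add_mset q ds)#})" by (simp add: add_mset_commute)
    from win_merge[OF this] have "win (E + {#AD ({#} + ds)#})" .
    then have "win (E + {#AC {#p, q#}, AD (add_mset p {#}), AD (add_mset q ds)#})"
      by (intro win_stepI[OF DD]) (use cl' in \<open>simp_all add: 2 add_mset_commute\<close>)
    then show ?thesis by (simp add: E 2 add_mset_commute)
  qed
qed

text \<open>Dual situation: against a tensor the one-output daimon gains a second output; against a
  daimon, the split caused by the par is undone by fusing both halves with the daimon above the
  par.\<close>

lemma win_contract_par:
  assumes "win (C + {#AP p1 p2 p, AD {#p1, p2#}#})" (is "win (C + ?X)")
  shows "win (C + {#AD {#p#}#})"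
  using assms
proof (induction C rule: win_pattern_induct)
  case (base C) then show ?case by (simp add: add_eq_conv_ex)
next
  case (step R R' E)
  have "closed ((E + {#AD {#p#}#}) + R)"
    using step(2) by (auto simp: closed_def simple_mset_add add_mset_commute)
  moreover have "win ((E + {#AD {#p#}#}) + R')" using step by (simp add: add_ac)
  ultimately have "win ((E + {#AD {#p#}#}) + R)" using step win_step by blast
  then show ?case by (simp add: add_ac)
next
  case (overlap R R' C0 C x)
  have cl: "closed (C0 + R)" using overlap by simp
  have nd: "AD {#p1, p2#} \<notin># R"
  proof
    assume "AD {#p1, p2#} \<in># R"
    then obtain a b l where R: "R = {#AC {#a, b#}, AD {#p1, p2#}, l#}" and a: "a \<in># {#p1, p2#}"
      by (rule_tac redex_at_link[OF overlap(1), of "AD {#p1, p2#}"]) auto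
    have "AP p1 p2 p \<in># C0 + R" using overlap(3) by simp
    then have "AC {#a, b#} = AP p1 p2 p"
      by (intro unique_consumer[OF cl, of _ _ a]) (use R a in auto)
    then show False by simp
  qed
  then have "AP p1 p2 p \<in># R" using overlap by auto
  then obtain q l where R: "R = {#AC {#p, q#}, AP p1 p2 p, l#}" and l: "q \<in># atgt l"
    and s: "rstep p q (AP p1 p2 p) l R' \<or> rstep q p l (AP p1 p2 p) R'"
    by (rule_tac redex_at_link[OF overlap(1), of "AP p1 p2 p"]) auto
  have simp: "simple_mset (src (C0 + R))" "simple_mset (tgt (C0 + R))" using closed_simple[OF cl] by auto
  have eq: "C0 + {#AC {#p, q#}, l#} = C + {#AD {#p1, p2#}#}"
    using overlap(3) by (simp add: R add_mset_commute)
  have nl: "l \<noteq> AD {#p1, p2#}" using nd R by auto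
  obtain E where E: "C0 = E + {#AD {#p1, p2#}#}" "C = E + {#AC {#p, q#}, l#}"
    by (rule split_disjoint[OF eq]) (use nl in auto)
  have cl': "closed (E + {#AC {#p, q#}, l, AD {#p#}#})"
    using cl by (auto simp: E R closed_def simple_mset_add add_mset_commute)
  from s consider q1 q2 where "l = AT q1 q2 q" "R' = {#AC {#q1, p1#}, AC {#q2, p2#}#}"
    | ds es where "l = AD (add_mset q (ds + es))" "R' = {#AC {#p1, p#}, AC {#p2, q#}, AD (add_mset p ds), AD (add_mset q es)#}"
    by (auto elim!: rstep.cases)
  then show ?case
  proof cases
    case 1
    have fr: "p \<notin> pos E" "q \<notin> pos E" "p1 \<notin> pos E" "p2 \<notin> pos E" "p \<noteq> q" "p1 \<noteq> p2"
      "p \<noteq> p1" "p \<noteq> p2" "q \<noteq> p1" "q \<noteq> p2" "p \<noteq> q1" "p \<noteq> q2" "q \<noteq> q1" "q \<noteq> q2" "p1 \<noteq> q1" "p1 \<noteq> q2" "p2 \<noteq> q1" "p2 \<noteq> q2"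
      using simp by (auto simp: E R 1 pos_def simple_mset_add disjoint_iff)
    have "win (E + {#AD {#p1, p2#}, AC {#q1, p1#}, AC {#q2, p2#}#})"
      using overlap(4) by (simp add: E 1 add_mset_commute)
    from win_rename2[OF this fr(3,4), of q p]
    have "win (E + {#AC {#q1, q#}, AC {#q2, p#}, AD (add_mset q (add_mset p {#}))#})"
      using fr by (auto simp: add_mset_commute)
    then have "win (E + {#AC {#q, p#}, AT q1 q2 q, AD (add_mset p {#})#})"
      by (intro win_stepI[OF TD]) (use cl' in \<open>simp_all add: 1 add_mset_commute\<close>)
    then show ?thesis by (simp add: E 1 add_mset_commute)
  next
    case 2
    have "win ((E + {#AC {#p2, q#}, AD (add_mset q es)#}) + {#AC {#p1, p#}, AD (add_mset p1 {#p2#}), AD (add_mset p ds)#})"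
      using overlap(4) by (simp add: E 2 add_mset_commute)
    from win_merge[OF this]
    have "win (E + {#AC {#p2, q#}, AD (add_mset p2 ds), AD (add_mset q es)#})" by (simp add: add_mset_commute)
    from win_merge[OF this] have "win (E + {#AD ({#} + (ds + es))#})" by simp
    then have "win (E + {#AC {#p, q#}, AD (add_mset p {#}), AD (add_mset q (ds + es))#})"
      by (intro win_stepI[OF DD]) (use cl' in \<open>simp_all add: 2 add_mset_commute\<close>)
    then show ?thesis by (simp add: E 2 add_mset_commute)
  qed
qed

text \<open>The two games are played one after the other: \<open>es\<close> travels along with the
  daimon of the first, and when that daimon would be empty only the second game is left.\<close>

lemma win_extend:
  assumes "win (L + {#AD ds#})" "win (C + {#AD es#})" "pos (L + {#AD ds#}) \<inter> pos (C + {#AD es#}) = {}"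
  shows "win (L + C + {#AD (ds + es)#})"
proof -
  have cl: "closed (L + C + {#AD (ds + es)#})"
    if "closed (L + {#AD ds#})" "pos (L + {#AD ds#}) \<inter> pos (C + {#AD es#}) = {}" for L ds
    using that win_closed[OF assms(2)] by (auto simp: closed_def simple_mset_add pos_def disjoint_iff)
  have "win N \<Longrightarrow> N = L + {#AD ds#} \<Longrightarrow> pos N \<inter> pos (C + {#AD es#}) = {} \<Longrightarrow> win (L + C + {#AD (ds + es)#})" for N
  proof (induction N arbitrary: L ds rule: win.induct)
    case win_base
    then show ?case using assms(2) by (simp add: add_eq_conv_ex)
  next
    case (win_step R R' B)
    have d: "pos (B + R') \<inter> pos (C + {#AD es#}) = {}"
    proof -
      have "pos (B + R') \<subseteq> pos (B + R)" using redex_pos[OF win_step(1)] by auto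
      then show ?thesis using win_step.prems(2) by blast
    qed
    have clN: "closed (L + C + {#AD (ds + es)#})"
      using cl win_step by metis
    show ?case
    proof (cases "AD ds \<in># R")
      case False
      then obtain E where E: "B = E + {#AD ds#}" "L = E + R"
        using win_step.prems(1) by (rule_tac split_disjoint[of B R L "{#AD ds#}"]) auto
      have "win ((E + R') + C + {#AD (ds + es)#})"
        by (rule win_step.IH[OF _ d]) (simp add: E)
      then have "win ((E + C + {#AD (ds + es)#}) + R')" by (simp add: add_ac)
      then have "win ((E + C + {#AD (ds + es)#}) + R)"
        by (rule win.win_step[OF win_step(1), rotated]) (use clN in \<open>simp add: E add_ac\<close>)
      then show ?thesis by (simp add: E add_ac)
    next
      case True
      obtain p r g l where ds: "ds = add_mset p g" and R: "R = {#AC {#p, r#}, AD ds, l#}"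
        and c: "(\<exists>r1 r2. l = AT r1 r2 r \<and> R' = {#AC {#r1, r#}, AC {#r2, p#}, AD (add_mset r (add_mset p g))#}) \<or>
     (\<exists>r1 r2 f1 f2. l = AP r1 r2 r \<and> g = f1 + f2 \<and>
        R' = {#AC {#r1, r#}, AC {#r2, p#}, AD (add_mset r f1), AD (add_mset p f2)#}) \<or>
     (\<exists>gs. l = AD (add_mset r gs) \<and> R' = {#AD (g + gs)#})"
        by (rule redex_at_daimon[OF win_step(1) True]) metis
      have L: "L = B + {#AC {#p, r#}, l#}" using win_step.prems(1) by (simp add: R add_mset_commute)
      have clN': "closed ((B + C) + {#AC {#r, p#}, l, AD (add_mset p (g + es))#})"
        using clN by (simp add: L ds add_mset_commute add_ac)
      from c show ?thesis
      proof (elim disjE exE conjE)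
        fix r1 r2 assume l: "l = AT r1 r2 r" and R': "R' = {#AC {#r1, r#}, AC {#r2, p#}, AD (add_mset r (add_mset p g))#}"
        have "win ((B + {#AC {#r1, r#}, AC {#r2, p#}#}) + C + {#AD (add_mset r (add_mset p g) + es)#})"
          by (rule win_step.IH[OF _ d]) (simp add: R' add_mset_commute)
        then have "win ((B + C) + {#AC {#r, p#}, AT r1 r2 r, AD (add_mset p (g + es))#})"
          by (intro win_stepI[OF TD]) (use clN' in \<open>simp_all add: l add_mset_commute\<close>)
        then show ?thesis by (simp add: L l ds add_mset_commute)
      next
        fix r1 r2 f1 f2 assume l: "l = AP r1 r2 r" and g: "g = f1 + f2"
          and R': "R' = {#AC {#r1, r#}, AC {#r2, p#}, AD (add_mset r f1), AD (add_mset p f2)#}"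
        \<comment> \<open>Either half of the split may carry \<open>es\<close>; the first is
          taken.\<close>
        have "win ((B + {#AC {#r1, r#}, AC {#r2, p#}, AD (add_mset p f2)#}) + C + {#AD (add_mset r f1 + es)#})"
          by (rule win_step.IH[OF _ d]) (simp add: R' add_mset_commute)
        then have "win ((B + C) + {#AC {#r, p#}, AP r1 r2 r, AD (add_mset p ((f1 + es) + f2))#})"
          by (intro win_stepI[OF PD]) (use clN' in \<open>simp_all add: l g add_mset_commute add_ac\<close>)
        then show ?thesis by (simp add: L l ds g add_mset_commute add_ac)
      next
        fix gs assume l: "l = AD (add_mset r gs)" and R': "R' = {#AD (g + gs)#}"
        have "win (B + C + {#AD (g + gs + es)#})"
          by (rule win_step.IH[OF _ d]) (simp add: R')
        then have "win ((B + C) + {#AC {#r, p#}, AD (add_mset r gs), AD (add_mset p (g + es))#})"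
          by (intro win_stepI[OF DD]) (use clN' in \<open>simp_all add: l add_mset_commute add_ac\<close>)
        then show ?thesis by (simp add: L l ds add_mset_commute)
      qed
    qed
  qed
  then show ?thesis using assms by blast
qed

section \<open>From ordered links to unordered ones\<close>

primrec unord :: "'p link \<Rightarrow> 'p alink" where
  "unord (Tensor p q r) = AT p q r"
| "unord (Par p q r) = AP p q r"
| "unord (Cut p q) = AC {#p, q#}"
| "unord (Daimon ps) = AD (mset ps)"

definition alinks :: "'p link multiset \<Rightarrow> 'p alink multiset" where
  "alinks L = image_mset unord L"

lemma alinks_simps [simp]: "alinks {#} = {#}" "alinks (add_mset l L) = add_mset (unord l) (alinks L)"
  "alinks (L + M) = alinks L + alinks M"
  by (simp_all add: alinks_def)

lemma asrc_unord [simp]: "asrc (unord l) = mset (source l)"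
  and atgt_unord [simp]: "atgt (unord l) = mset (target l)"
  by (cases l; simp)+

lemma pos_alinks [simp]: "pos (alinks L) = positions L"
  by (induction L) (auto simp: positions_def)

lemma unord_eq [simp]:
  "unord l = AT p q r \<longleftrightarrow> l = Tensor p q r" "unord l = AP p q r \<longleftrightarrow> l = Par p q r"
  "unord l = AD ps \<longleftrightarrow> (\<exists>xs. l = Daimon xs \<and> mset xs = ps)"
  "unord l = AC {#p, q#} \<longleftrightarrow> l \<in> {Cut p q, Cut q p}"
  by (cases l; auto simp: cut_eq_iff)+

lemma alinks_add_mset: "alinks L = add_mset a M \<Longrightarrow> \<exists>l L'. L = add_mset l L' \<and> unord l = a \<and> alinks L' = M"
  unfolding alinks_def by (metis msed_map_invR)

lemma unord_cut: "c \<in> {Cut p q, Cut q p} \<Longrightarrow> unord c = AC {#p, q#}"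
  by (auto simp: add_mset_commute)

text \<open>A concrete step takes fresh positions where the abstract one keeps those of the cut; the
  renaming \<open>f\<close> accounts for the difference, so the two steps agree up to an
  injection.\<close>

lemma red_redex:
  assumes "red S S'" "closed (alinks (links S))"
  shows "concl S' = concl S \<and> (\<exists>B R R' f. alinks (links S) = B + R \<and> redex R R' \<and>
    inj_on f (pos (B + R')) \<and> alinks (links S') = rn f (B + R'))"
  using assms
proof (induction rule: red.induct)
  case (red_par_tensor c p q C p1 p2 q1 q2 cs)
  show ?case
    by (intro conjI exI[of _ "alinks C"] exI[of _ "{#AC {#q, p#}, AT q1 q2 q, AP p1 p2 p#}"]
        exI[of _ "{#AC {#q1, p1#}, AC {#q2, p2#}#}"] exI[of _ id] redexI rstep.intros)
      (use unord_cut[OF red_par_tensor(1)] in \<open>auto simp: rn_id add_mset_commute\<close>)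
next
  case (red_daimon_daimon c p q C as bs as' bs' cs)
  show ?case
    by (intro conjI exI[of _ "alinks C"] exI[of _ "{#AC {#p, q#}, AD (add_mset p (mset (as @ bs))), AD (add_mset q (mset (as' @ bs')))#}"]
        exI[of _ "{#AD (mset (as @ bs) + mset (as' @ bs'))#}"] exI[of _ id] redexI rstep.intros)
      (use unord_cut[OF red_daimon_daimon(1)] in \<open>auto simp: rn_id add_mset_commute\<close>)
next
  case (red_tensor_daimon c p q L C p1 p2 as bs r1 r2 cs)
  let ?f = "\<lambda>x. if x = p then r1 else if x = q then r2 else x"
  let ?R = "{#AC {#p, q#}, AT p1 p2 p, AD (add_mset q (mset (as @ bs)))#}"
  let ?R' = "{#AC {#p1, p#}, AC {#p2, q#}, AD (add_mset p (add_mset q (mset (as @ bs))))#}"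
  have L: "alinks L = alinks C + ?R" using unord_cut[OF red_tensor_daimon(1)] by (simp add: red_tensor_daimon(2) add_mset_commute)
  have cl: "closed (alinks C + ?R)" unfolding L[symmetric] using red_tensor_daimon.prems by simp
  have fr: "p \<notin> pos (alinks C)" "q \<notin> pos (alinks C)" "p \<noteq> q" "p \<notin> set (as @ bs)" "q \<notin> set (as @ bs)" "p \<noteq> p1" "p \<noteq> p2" "q \<noteq> p1" "q \<noteq> p2"
    using closed_simple[OF cl] by (auto simp del: pos_alinks simp: pos_def simple_mset_add disjoint_iff)
  have "pos (alinks L) = positions L" by simp
  then have r: "r1 \<notin> pos (alinks C + ?R)" "r2 \<notin> pos (alinks C + ?R)"
    using red_tensor_daimon(3,4) L by auto
  have im: "image_mset ?f (mset (as @ bs)) = image_mset id (mset (as @ bs))"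
    by (rule image_mset_cong) (use fr in auto)
  show ?case
    by (intro conjI exI[of _ "alinks C"] exI[of _ ?R] exI[of _ ?R'] exI[of _ ?f] redexI rstep.intros)
      (use fr r L red_tensor_daimon(5) rn_fresh[OF fr(1,2), of r1 r2] im in \<open>auto simp: inj_on_def add_mset_commute\<close>)
next
  case (red_par_daimon c p q L C q1 q2 as bs r1 r2 as' as'' bs' bs'' cs)
  let ?f = "\<lambda>x. if x = q then r1 else if x = p then r2 else x"
  let ?R = "{#AC {#q, p#}, AP q1 q2 q, AD (add_mset p (mset (as' @ bs') + mset (as'' @ bs'')))#}"
  let ?R' = "{#AC {#q1, q#}, AC {#q2, p#}, AD (add_mset q (mset (as' @ bs'))), AD (add_mset p (mset (as'' @ bs'')))#}"
  have m: "mset as' + mset bs' + (mset as'' + mset bs'') = mset as + mset bs"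
    using red_par_daimon(6,7) by (metis add.assoc add.commute)
  have L: "alinks L = alinks C + ?R" using unord_cut[OF red_par_daimon(1)] m by (simp add: red_par_daimon(2) add_mset_commute)
  have cl: "closed (alinks C + ?R)" unfolding L[symmetric] using red_par_daimon.prems by simp
  have fr: "p \<notin> pos (alinks C)" "q \<notin> pos (alinks C)" "p \<noteq> q" "p \<notin># mset (as' @ bs')" "q \<notin># mset (as' @ bs')"
    "p \<notin># mset (as'' @ bs'')" "q \<notin># mset (as'' @ bs'')" "p \<noteq> q1" "p \<noteq> q2" "q \<noteq> q1" "q \<noteq> q2"
    using closed_simple[OF cl] by (auto simp del: pos_alinks simp: pos_def simple_mset_add disjoint_iff)
  have "pos (alinks L) = positions L" by simp
  then have r: "r1 \<notin> pos (alinks C + ?R)" "r2 \<notin> pos (alinks C + ?R)"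
    using red_par_daimon(3,4) L by auto
  have im: "image_mset ?f (mset (as' @ bs')) = image_mset id (mset (as' @ bs'))"
    "image_mset ?f (mset (as'' @ bs'')) = image_mset id (mset (as'' @ bs''))"
    by (rule image_mset_cong; use fr in auto)+
  show ?case
    by (intro conjI exI[of _ "alinks C"] exI[of _ ?R] exI[of _ ?R'] exI[of _ ?f] redexI rstep.intros)
      (use fr r L red_par_daimon(5) rn_fresh[OF fr(2,1), of r1 r2] im in \<open>auto simp: inj_on_def add_mset_commute\<close>)
qed

lemma reds_win:
  assumes "red\<^sup>*\<^sup>* S (daimon_net 0)" "closed (alinks (links S))"
  shows "concl S = [] \<and> win (alinks (links S))"
  using assms
proof (induction rule: converse_rtranclp_induct)
  case base then show ?case by (simp add: daimon_net_def win_base)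
next
  case (step S S')
  obtain B R R' f where s: "alinks (links S) = B + R" "redex R R'" "inj_on f (pos (B + R'))" "alinks (links S') = rn f (B + R')"
    and c: "concl S' = concl S"
    using red_redex[OF step(1,4)] by blast
  have "closed (alinks (links S'))" unfolding s(4)
    by (rule closed_rn[OF s(3)]) (use redex_closed[OF s(2)] step(4) s(1) in simp)
  then have "win (B + R')" "concl S' = []" using step.IH s(3,4) win_rn_iff by metis+
  then show ?case using win_step[OF s(2)] s(1) step(4) c by simp
qed

text \<open>The induction generalizes over the renaming \<open>f\<close>, because concrete steps
  introduce names that the play does not know.\<close>

lemma win_reds:
  assumes "win N" "inj_on f (pos N)" "alinks L = rn f N"
  shows "red\<^sup>*\<^sup>* (Net L []) (daimon_net 0)"
  using assms
proof (induction arbitrary: f L rule: win.induct)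
  case win_base
  then have "L = {#Daimon []#}" using alinks_add_mset[of L "AD {#}" "{#}"] by (auto simp: alinks_def)
  then show ?case by (simp add: daimon_net_def)
next
  case (win_step R R' C)
  have sub: "inj_on f (pos (C + R'))"
    by (rule inj_on_subset[OF win_step.prems(1)]) (use redex_pos[OF win_step(1)] in auto)
  obtain p q l l' where R: "R = {#AC {#p, q#}, l, l'#}" and s: "rstep p q l l' R'"
    using win_step(1) by (auto simp: redex_def)
  have "alinks L = add_mset (AC {#f p, f q#}) (add_mset (map_alink f l) (add_mset (map_alink f l') (rn f C)))"
    using win_step.prems(2) by (simp add: R add_mset_commute)
  then obtain c L1 where c: "L = add_mset c L1" "unord c = AC {#f p, f q#}"
    and L1: "alinks L1 = add_mset (map_alink f l) (add_mset (map_alink f l') (rn f C))"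
    by (meson alinks_add_mset)
  obtain k L2 where k: "L1 = add_mset k L2" "unord k = map_alink f l"
    and L2: "alinks L2 = add_mset (map_alink f l') (rn f C)"
    using alinks_add_mset[OF L1] by blast
  obtain k' D where k': "L2 = add_mset k' D" "unord k' = map_alink f l'" and D: "alinks D = rn f C"
    using alinks_add_mset[OF L2] by blast
  have L: "L = D + {#c, k, k'#}" using c(1) k(1) k'(1) by (simp add: add_mset_commute)
  have c: "c \<in> {Cut (f p) (f q), Cut (f q) (f p)}" using c(2) by simp
  note k = k(2) k'(2)
  have simp: "simple_mset (src (C + R))" "simple_mset (tgt (C + R))" using closed_simple[OF win_step(2)] by auto
  have pq: "p \<notin> pos C" "q \<notin> pos C" "p \<noteq> q"
    using simp rstep_producer[OF s] by (auto simp: R pos_def simple_mset_add disjoint_iff)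
  have fin: "finite (positions L)" using finite_pos[of "alinks L"] by simp
  obtain r1 where r1: "r1 \<notin> positions L" using ex_new_if_finite[OF infinite_UNIV_nat fin] by blast
  obtain r2 where "r2 \<notin> insert r1 (positions L)"
    using ex_new_if_finite[OF infinite_UNIV_nat, of "insert r1 (positions L)"] fin by blast
  then have r2: "r2 \<notin> positions L" "r1 \<noteq> r2" by auto
  define g where "g = f(p := r1, q := r2)"
  have g: "g p = r1" "g q = r2" "x \<noteq> p \<Longrightarrow> x \<noteq> q \<Longrightarrow> g x = f x" for x
    using pq by (auto simp: g_def)
  have fC: "rn g C = rn f C" by (rule rn_cong) (use pq g in metis)
  have pL: "positions L = f ` pos (C + R)" using win_step.prems(2) by (metis pos_alinks pos_rn)
  have inj: "inj_on g (pos (C + R'))"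
    using sub r1 r2 redex_pos[OF win_step(1)] unfolding pL by (auto simp: inj_on_def g_def)
  have fix_im: "image_mset g M = image_mset f M" if "p \<notin># M" "q \<notin># M" for M
    by (rule image_mset_cong) (use that g in metis)
  from s show ?case
  proof cases
    case (TP p1 p2 q1 q2)
    have "red (Net (D + {#Par (f q1) (f q2) (f q), c, Tensor (f p1) (f p2) (f p)#}) [])
      (Net (D + {#Cut (f q1) (f p1), Cut (f q2) (f p2)#}) [])"
      by (rule red_par_tensor) (use c in auto)
    moreover have "red\<^sup>*\<^sup>* (Net (D + {#Cut (f q1) (f p1), Cut (f q2) (f p2)#}) []) (daimon_net 0)"
      by (rule win_step.IH[OF sub]) (simp add: D TP add_mset_commute)
    moreover have "L = D + {#Par (f q1) (f q2) (f q), c, Tensor (f p1) (f p2) (f p)#}"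
      using k by (simp add: L TP add_mset_commute)
    ultimately show ?thesis by (simp add: converse_rtranclp_into_rtranclp)
  next
    case (DD ds es)
    obtain xs ys where xy: "k = Daimon xs" "k' = Daimon ys" "mset xs = image_mset f (add_mset p ds)" "mset ys = image_mset f (add_mset q es)"
      using k by (auto simp: DD)
    have "f p \<in> set xs" "f q \<in> set ys" using xy by (metis image_mset_add_mset set_mset_mset union_single_eq_member)+
    then obtain as bs as' bs' where s: "xs = as @ [f p] @ bs" "ys = as' @ [f q] @ bs'"
      by (metis append_Cons append_Nil split_list)
    have "red (Net (D + {#Daimon (as @ [f p] @ bs), c, Daimon (as' @ [f q] @ bs')#}) [])
       (Net (D + {#Daimon (as @ bs @ as' @ bs')#}) [])"
      by (rule red_daimon_daimon) (use c in auto)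
    moreover have "red\<^sup>*\<^sup>* (Net (D + {#Daimon (as @ bs @ as' @ bs')#}) []) (daimon_net 0)"
      by (rule win_step.IH[OF sub]) (use xy in \<open>simp add: D DD s add_ac\<close>)
    moreover have "L = D + {#Daimon (as @ [f p] @ bs), c, Daimon (as' @ [f q] @ bs')#}"
      by (simp add: L xy s add_mset_commute)
    ultimately show ?thesis by (simp add: converse_rtranclp_into_rtranclp)
  next
    case (TD p1 p2 ds)
    have fr: "p \<noteq> p1" "p \<noteq> p2" "q \<noteq> p1" "q \<noteq> p2" "p \<notin># ds" "q \<notin># ds"
      using simp by (auto simp: R TD simple_mset_add)
    obtain ys where xy: "k' = Daimon ys" "mset ys = image_mset f (add_mset q ds)"
      using k by (auto simp: TD)
    have "f q \<in> set ys" using xy by (metis image_mset_add_mset set_mset_mset union_single_eq_member)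
    then obtain as bs where s: "ys = as @ [f q] @ bs" by (metis append_Cons append_Nil split_list)
    have L': "L = D + {#Tensor (f p1) (f p2) (f p), c, Daimon (as @ [f q] @ bs)#}"
      using k by (simp add: L TD xy s add_mset_commute)
    have "red (Net L []) (Net (D + {#Cut (f p1) r1, Cut (f p2) r2, Daimon (as @ [r1, r2] @ bs)#}) [])"
      by (rule red_tensor_daimon[OF c L' r1 r2])
    moreover have "red\<^sup>*\<^sup>* (Net (D + {#Cut (f p1) r1, Cut (f p2) r2, Daimon (as @ [r1, r2] @ bs)#}) []) (daimon_net 0)"
      by (rule win_step.IH[OF inj])
        (use xy fr pq g fC fix_im[OF fr(5,6)] in \<open>simp add: D TD s add_mset_commute\<close>)
    ultimately show ?thesis by (simp add: converse_rtranclp_into_rtranclp)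
  next
    case (PD p1 p2 ds es)
    have fr: "p \<noteq> p1" "p \<noteq> p2" "q \<noteq> p1" "q \<noteq> p2" "p \<notin># ds" "q \<notin># ds" "p \<notin># es" "q \<notin># es" "set_mset ds \<inter> set_mset es = {}"
      using simp by (auto simp: R PD simple_mset_add)
    obtain ys where xy: "k' = Daimon ys" "mset ys = image_mset f (add_mset q (ds + es))"
      using k by (auto simp: PD)
    have "f q \<in> set ys" using xy by (metis image_mset_add_mset set_mset_mset union_single_eq_member)
    then obtain as bs where s: "ys = as @ [f q] @ bs" by (metis append_Cons append_Nil split_list)
    \<comment> \<open>The play splits a multiset, the rule splits the lists on both sides of the cut
      output. Selecting the images of \<open>ds\<close> turns the former into the latter, since
      \<open>f\<close> keeps \<open>ds\<close> and \<open>es\<close> apart.\<close>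
    let ?P = "\<lambda>x. x \<in> f ` set_mset ds"
    have L': "L = D + {#Par (f p1) (f p2) (f p), c, Daimon (as @ [f q] @ bs)#}"
      using k by (simp add: L PD xy s add_mset_commute)
    have c': "c \<in> {Cut (f q) (f p), Cut (f p) (f q)}" using c by auto
    have m: "mset as + mset bs = image_mset f ds + image_mset f es" using xy s by simp
    have ne: "f x \<notin> f ` set_mset ds" if "x \<in># es" for x
    proof
      assume "f x \<in> f ` set_mset ds"
      then obtain y where y: "y \<in># ds" "f x = f y" by blast
      have "x \<in> pos (C + R)" "y \<in> pos (C + R)" using that y by (simp_all add: R PD)
      with y(2) have "x = y" using inj_onD[OF win_step.prems(1)] by blast
      with y that fr(9) show False by blast
    qed
    have "filter_mset ?P (image_mset f ds) = image_mset f ds" by (simp add: filter_mset_eq_conv)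
    moreover have "filter_mset ?P (image_mset f es) = {#}" using ne by (auto simp: filter_mset_eq_conv)
    ultimately have m1: "mset (filter ?P as) + mset (filter ?P bs) = image_mset f ds"
      using arg_cong[OF m, of "filter_mset ?P"] by (simp add: mset_filter)
    have part: "mset (filter ?P xs) + mset (filter (\<lambda>x. \<not> ?P x) xs) = mset xs" for xs
      by (metis mset_filter multiset_partition)
    have "mset as + mset bs = (mset (filter ?P as) + mset (filter ?P bs)) +
        (mset (filter (\<lambda>x. \<not> ?P x) as) + mset (filter (\<lambda>x. \<not> ?P x) bs))"
      by (subst (1 2) part[symmetric]) (simp only: add_ac)
    then have m2: "mset (filter (\<lambda>x. \<not> ?P x) as) + mset (filter (\<lambda>x. \<not> ?P x) bs) = image_mset f es"
      unfolding m m1 by simp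
    have "red (Net L []) (Net (D + {#Cut (f p1) r1, Cut (f p2) r2, Daimon (filter ?P as @ [r1] @ filter ?P bs),
        Daimon (filter (\<lambda>x. \<not> ?P x) as @ [r2] @ filter (\<lambda>x. \<not> ?P x) bs)#}) [])"
      by (rule red_par_daimon[OF c' L' r1 r2]) (rule part)+
    moreover have "red\<^sup>*\<^sup>* (Net (D + {#Cut (f p1) r1, Cut (f p2) r2, Daimon (filter ?P as @ [r1] @ filter ?P bs),
        Daimon (filter (\<lambda>x. \<not> ?P x) as @ [r2] @ filter (\<lambda>x. \<not> ?P x) bs)#}) []) (daimon_net 0)"
      by (rule win_step.IH[OF inj])
        (use fr pq g fC fix_im[OF fr(5,6)] fix_im[OF fr(7,8)] m1 m2 in \<open>simp add: D PD add_mset_commute\<close>)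
    ultimately show ?thesis by (simp add: converse_rtranclp_into_rtranclp)
  qed
qed

section \<open>Interactions, and orthogonality as winning\<close>

definition wf_link :: "'p alink \<Rightarrow> bool" where
  "wf_link l \<longleftrightarrow> set_mset (asrc l) \<inter> set_mset (atgt l) = {} \<and> (\<forall>ps. l = AC ps \<longrightarrow> size ps = 2)"

text \<open>One equation replaces the conditions position by position: repetition-free targets force
  the same on sources and conclusions, and the conclusions are exactly the positions left
  unconsumed.\<close>

definition anet :: "'p alink multiset \<Rightarrow> 'p multiset \<Rightarrow> bool" where
  "anet L cs \<longleftrightarrow> cs + src L = tgt L \<and> simple_mset (tgt L) \<and> (\<forall>l\<in>#L. wf_link l)"

lemma count_source:
  "\<forall>l\<in>#L. distinct (source l) \<Longrightarrow> count (src (alinks L)) p = size {#l \<in># L. p \<in> set (source l)#}"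
  by (induction L) (auto simp: distinct_count_atmost_1)

lemma count_target:
  "\<forall>l\<in>#L. distinct (target l) \<Longrightarrow> count (tgt (alinks L)) p = size {#l \<in># L. p \<in> set (target l)#}"
  by (induction L) (auto simp: distinct_count_atmost_1)

lemma anet_simple: "anet L cs \<Longrightarrow> simple_mset (tgt L) \<and> simple_mset (src L) \<and> simple_mset cs \<and>
  set_mset cs \<inter> set_mset (src L) = {}"
  unfolding anet_def by (metis simple_mset_add)

lemma anet_pos: "anet L cs \<Longrightarrow> pos L = set_mset (tgt L)"
  unfolding anet_def pos_def by (metis Un_absorb1 Un_upper2 set_mset_union)

lemma anet_closed: "anet L {#} \<Longrightarrow> closed L"
  by (simp add: anet_def closed_def)

lemma anet_concl_subset: "anet L cs \<Longrightarrow> set_mset cs \<subseteq> pos L"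
  unfolding anet_def pos_def by (metis Un_upper1 set_mset_union sup.coboundedI2)

lemma source_subset: "l \<in># L \<Longrightarrow> mset (source l) \<subseteq># src (alinks L)"
  by (auto dest!: multi_member_split)

lemma target_subset: "l \<in># L \<Longrightarrow> mset (target l) \<subseteq># tgt (alinks L)"
  by (auto dest!: multi_member_split)

lemma is_net_anet: "is_net S \<longleftrightarrow> anet (alinks (links S)) (mset (concl S))"
proof
  assume n: "is_net S"
  let ?L = "links S"
  have d: "\<forall>l\<in>#?L. distinct (source l)" "\<forall>l\<in>#?L. distinct (target l)"
    using n by (auto simp: is_net_def)
  note cs = count_source[OF d(1)] and ct = count_target[OF d(2)]
  have c: "count (tgt (alinks ?L)) p = 1" "count (src (alinks ?L)) p \<le> 1" if "p \<in> positions ?L" for p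
    using n that by (auto simp: is_net_def cs ct)
  have nc: "count (tgt (alinks ?L)) p = 0" "count (src (alinks ?L)) p = 0" if "p \<notin> positions ?L" for p
  proof -
    have "p \<notin> pos (alinks ?L)" using that by simp
    then show "count (tgt (alinks ?L)) p = 0" "count (src (alinks ?L)) p = 0"
      by (auto simp: pos_def count_eq_zero_iff simp del: pos_alinks)
  qed
  have "count (mset (concl S)) p + count (src (alinks ?L)) p = count (tgt (alinks ?L)) p" for p
  proof (cases "p \<in> positions ?L")
    case True
    have k1: "count (mset (concl S)) p = (if p \<in> set (concl S) then 1 else 0)"
      using n by (simp add: is_net_def distinct_count_atmost_1)
    have k2: "p \<in> set (concl S) \<longleftrightarrow> count (src (alinks ?L)) p = 0"
      using n True unfolding is_net_def cs by auto
    have ar: "a + b = t" if "a = (if P then 1 else 0)" "P \<longleftrightarrow> b = 0" "t = 1" "b \<le> 1" for a b t :: nat and P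
      using that by auto
    show ?thesis by (rule ar[OF k1 k2 c[OF True]])
  next
    case False
    then have "count (mset (concl S)) p = 0" using n by (simp add: is_net_def count_eq_zero_iff)
    then show ?thesis using nc[OF False] by simp
  qed
  then have "mset (concl S) + src (alinks ?L) = tgt (alinks ?L)" by (simp add: multiset_eq_iff)
  moreover have "simple_mset (tgt (alinks ?L))"
    unfolding simple_mset_def using c nc by (metis le_refl zero_le)
  moreover have "wf_link (unord l)" if "l \<in># ?L" for l
  proof -
    have "distinct (source l @ target l)" using n that by (auto simp: is_net_def)
    then show ?thesis by (cases l) (auto simp: wf_link_def)
  qed
  ultimately show "anet (alinks ?L) (mset (concl S))" by (auto simp: anet_def alinks_def)
next
  let ?L = "links S"
  assume a: "anet (alinks ?L) (mset (concl S))"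
  note s = anet_simple[OF a]
  have l: "distinct (source l @ target l)" if "l \<in># ?L" for l
  proof -
    have "distinct (source l)" "distinct (target l)"
      using s source_subset[OF that] target_subset[OF that] simple_mset_mono simple_mset_mset by blast+
    moreover have "wf_link (unord l)" using a that by (auto simp: anet_def alinks_def)
    ultimately show ?thesis by (auto simp: wf_link_def)
  qed
  then have d: "\<forall>l\<in>#?L. distinct (source l)" "\<forall>l\<in>#?L. distinct (target l)" by auto
  note cs = count_source[OF d(1)] and ct = count_target[OF d(2)]
  have p: "positions ?L = set_mset (tgt (alinks ?L))" using anet_pos[OF a] by simp
  have eq: "mset (concl S) + src (alinks ?L) = tgt (alinks ?L)" using a by (simp add: anet_def)
  show "is_net S" unfolding is_net_def
  proof (intro conjI ballI)
    fix p assume "p \<in> positions ?L"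
    then have "count (tgt (alinks ?L)) p \<ge> 1" using p by simp
    moreover have "count (tgt (alinks ?L)) p \<le> 1" using s by (simp add: simple_mset_def)
    ultimately show "size {#l \<in># ?L. p \<in> set (target l)#} = 1" using ct by (metis le_antisym)
    show "size {#l \<in># ?L. p \<in> set (source l)#} \<le> 1" using s cs by (metis simple_mset_def)
  next
    show "distinct (concl S)" using s by simp
    have src0: "(\<forall>l\<in>#?L. p \<notin> set (source l)) \<longleftrightarrow> p \<notin># src (alinks ?L)" for p
      unfolding not_in_iff cs by auto
    have "set (concl S) \<union> set_mset (src (alinks ?L)) = set_mset (tgt (alinks ?L))"
      using arg_cong[OF eq, of set_mset] by simp
    then show "set (concl S) = {p \<in> positions ?L. \<forall>l\<in>#?L. p \<notin> set (source l)}"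
      using s unfolding src0 p by auto
  qed (use l in auto)
qed

definition cuts :: "'p list \<Rightarrow> 'p list \<Rightarrow> 'p alink multiset" where
  "cuts xs ys = mset (map2 (\<lambda>x y. AC {#x, y#}) xs ys)"

lemma cuts_simps [simp]: "cuts [] ys = {#}" "cuts xs [] = {#}"
  "cuts (x # xs) (y # ys) = add_mset (AC {#x, y#}) (cuts xs ys)"
  by (simp_all add: cuts_def)

lemma rn_cuts [simp]: "rn f (cuts xs ys) = cuts (map f xs) (map f ys)"
  by (induction xs ys rule: list_induct2') auto

lemma cuts_src: "length xs = length ys \<Longrightarrow> src (cuts xs ys) = mset xs + mset ys"
  by (induction xs ys rule: list_induct2) auto

lemma cuts_tgt [simp]: "tgt (cuts xs ys) = {#}"
  by (induction xs ys rule: list_induct2') auto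

lemma cuts_commute: "cuts xs ys = cuts ys xs"
  by (induction xs ys rule: list_induct2') (auto simp: add_mset_commute)

lemma cuts_wf: "l \<in># cuts xs ys \<Longrightarrow> wf_link l"
  by (induction xs ys rule: list_induct2') (auto simp: wf_link_def)

lemma anet_cuts:
  assumes "anet L (mset cs + C)" "anet M (mset ds + D)" "length cs = length ds" "pos L \<inter> pos M = {}"
  shows "anet (L + M + cuts cs ds) (C + D)"
proof -
  have "set_mset (tgt L) \<inter> set_mset (tgt M) = {}" using assms(4) by (auto simp: pos_def)
  have "C + D + (src L + src M + (mset cs + mset ds)) = (mset cs + C + src L) + (mset ds + D + src M)"
    by (simp add: add_ac)
  then have "C + D + src (L + M + cuts cs ds) = tgt (L + M + cuts cs ds)"
  proof -
    have "tgt L = mset cs + C + src L" "tgt M = mset ds + D + src M" using assms(1,2) by (simp_all add: anet_def)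
    then show ?thesis using assms(3) by (simp add: cuts_src add_ac)
  qed
  moreover have "simple_mset (tgt (L + M + cuts cs ds))"
    using assms(1,2) \<open>set_mset (tgt L) \<inter> set_mset (tgt M) = {}\<close> by (simp add: anet_def simple_mset_add)
  ultimately show ?thesis using assms(1,2) by (auto simp: anet_def dest: cuts_wf)
qed

lemma alinks_cuts: "alinks (mset (map2 Cut xs ys)) = cuts xs ys"
  by (induction xs ys rule: list_induct2') auto

lemma map2_upt: "map (\<lambda>i. f (xs ! i) (ys ! i)) [0..<min (length xs) (length ys)] = map2 f xs ys"
  by (rule nth_equalityI) auto

lemma alinks_rename: "alinks (image_mset (map_link f) L) = rn f (alinks L)"
proof -
  have "unord (map_link f l) = map_alink f (unord l)" for l by (cases l) auto
  then show ?thesis by (simp add: alinks_def rn_def multiset.map_comp comp_def)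
qed

lemma alinks_interaction: "alinks (links (interaction S T)) =
   rn (\<lambda>n. 2 * n) (alinks (links S)) + rn (\<lambda>n. 2 * n + 1) (alinks (links T)) +
   cuts (map (\<lambda>n. 2 * n) (concl S)) (map (\<lambda>n. 2 * n + 1) (concl T))"
  unfolding interaction_def Let_def net.sel left_copy_def right_copy_def rename_def alinks_simps
    alinks_cuts[symmetric] alinks_rename
  by (subst map2_upt[symmetric]) simp

lemma anet_rn: "anet L cs \<Longrightarrow> inj_on f (pos L) \<Longrightarrow> anet (rn f L) (image_mset f cs)"
proof -
  assume a: "anet L cs" and i: "inj_on f (pos L)"
  have "wf_link (map_alink f l)" if "l \<in># L" for l
  proof -
    have "wf_link l" using a that by (simp add: anet_def)
    moreover have "set_mset (asrc l) \<subseteq> pos L" "set_mset (atgt l) \<subseteq> pos L" using multi_member_split[OF that] by auto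
    ultimately show ?thesis using i unfolding wf_link_def asrc_map atgt_map
      by (cases l) (auto simp: inj_on_def)
  qed
  moreover have "simple_mset (image_mset f (tgt L))"
    using a i by (simp add: anet_def simple_mset_image pos_def inj_on_Un)
  moreover have "image_mset f cs + image_mset f (src L) = image_mset f (tgt L)"
    using a by (metis anet_def image_mset_union)
  moreover have "l \<in># rn f L \<Longrightarrow> \<exists>k\<in>#L. l = map_alink f k" for l by (auto simp: rn_def)
  ultimately show ?thesis unfolding anet_def src_rn tgt_rn by blast
qed

lemma concl_interaction: "concl (interaction S T) = [] \<longleftrightarrow> nconcl S = nconcl T"
  by (auto simp: interaction_def Let_def left_copy_def right_copy_def rename_def min_def)

lemma parity_disjoint: "(\<lambda>n::nat. 2 * n) ` A \<inter> (\<lambda>n. 2 * n + 1) ` B = {}"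
  by auto presburger

lemma anet_interaction:
  assumes "anet (alinks (links S)) (mset (concl S))" "anet (alinks (links T)) (mset (concl T))" "nconcl S = nconcl T"
  shows "closed (alinks (links (interaction S T)))"
proof -
  have "anet (rn (\<lambda>n. 2 * n) (alinks (links S)) + rn (\<lambda>n. 2 * n + 1) (alinks (links T)) +
   cuts (map (\<lambda>n. 2 * n) (concl S)) (map (\<lambda>n. 2 * n + 1) (concl T))) ({#} + {#})"
  proof (rule anet_cuts)
    show "anet (rn (\<lambda>n. 2 * n) (alinks (links S))) (mset (map (\<lambda>n. 2 * n) (concl S)) + {#})"
      using anet_rn[OF assms(1), of "\<lambda>n. 2 * n"] by (simp add: inj_on_def)
    show "anet (rn (\<lambda>n. 2 * n + 1) (alinks (links T))) (mset (map (\<lambda>n. 2 * n + 1) (concl T)) + {#})"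
      using anet_rn[OF assms(2), of "\<lambda>n. 2 * n + 1"] by (simp add: inj_on_def)
    show "pos (rn (\<lambda>n. 2 * n) (alinks (links S))) \<inter> pos (rn (\<lambda>n. 2 * n + 1) (alinks (links T))) = {}"
      unfolding pos_rn by (rule parity_disjoint)
  qed (use assms in simp)
  then show ?thesis unfolding alinks_interaction by (simp add: anet_closed)
qed

text \<open>Reduction never touches the conclusions and ends with none, so equality of their numbers
  comes out of orthogonality itself.\<close>

lemma orthogonal_win:
  assumes "is_net S" "is_net T"
  shows "orthogonal S T \<longleftrightarrow> nconcl S = nconcl T \<and> win (alinks (links (interaction S T)))"
proof
  note a = assms[unfolded is_net_anet]
  assume o: "orthogonal S T"
  have "concl S' = []" if "red\<^sup>*\<^sup>* S' (daimon_net 0)" for S'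
    using that
  proof (induction rule: converse_rtranclp_induct)
    case (step S S')
    from step(1) have "concl S' = concl S" by cases auto
    with step show ?case by simp
  qed (simp add: daimon_net_def)
  then have n: "nconcl S = nconcl T" using o concl_interaction unfolding orthogonal_def by blast
  then show "nconcl S = nconcl T \<and> win (alinks (links (interaction S T)))"
    using reds_win o anet_interaction[OF a] by (auto simp: orthogonal_def)
next
  assume w: "nconcl S = nconcl T \<and> win (alinks (links (interaction S T)))"
  then have "concl (interaction S T) = []" by (simp add: concl_interaction)
  then obtain L where L: "interaction S T = Net L []" by (metis net.collapse)
  have "red\<^sup>*\<^sup>* (Net L []) (daimon_net 0)"
    by (rule win_reds[of "alinks L" id]) (use w L in \<open>simp_all add: rn_id\<close>)
  then show "orthogonal S T" by (simp add: orthogonal_def L)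
qed

lemma pos_cuts: "pos (cuts xs ys) \<subseteq> set xs \<union> set ys"
  by (induction xs ys rule: list_induct2') auto

text \<open>The even and odd copies in \<open>interaction\<close> are one way to make nets disjoint;
  any other placement of \<open>T\<close> away from \<open>S\<close> is carried to it by an
  injection.\<close>

lemma interaction_rename:
  assumes S: "is_net S" and T: "is_net T" and f: "inj_on f (pos (alinks (links T)))"
    and d: "pos (alinks (links S)) \<inter> f ` pos (alinks (links T)) = {}"
  obtains g where "inj_on g (pos (alinks (links S) + rn f (alinks (links T)) + cuts (concl S) (map f (concl T))))"
    "rn g (alinks (links S) + rn f (alinks (links T)) + cuts (concl S) (map f (concl T))) = alinks (links (interaction S T))"
    "\<And>x. x \<in> pos (alinks (links S)) \<Longrightarrow> g x = 2 * x"
proof -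
  let ?S = "alinks (links S)" and ?T = "alinks (links T)"
  let ?N = "?S + rn f ?T + cuts (concl S) (map f (concl T))"
  define g where "g x = (if x \<in> pos ?S then 2 * x else 2 * inv_into (pos ?T) f x + 1)" for x
  note a = S[unfolded is_net_anet] and b = T[unfolded is_net_anet]
  have cs: "set (concl S) \<subseteq> pos ?S" "set (concl T) \<subseteq> pos ?T"
    using anet_concl_subset[OF a] anet_concl_subset[OF b] by (simp_all del: pos_alinks)
  have pc: "pos (cuts (concl S) (map f (concl T))) \<subseteq> pos ?S \<union> f ` pos ?T"
    using cs pos_cuts[of "concl S" "map f (concl T)"] unfolding set_map by blast
  have gS: "g x = 2 * x" if "x \<in> pos ?S" for x using that by (simp add: g_def)
  have gT: "g (f x) = 2 * x + 1" if "x \<in> pos ?T" for x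
    using that d f by (auto simp: g_def inv_into_f_f disjoint_iff simp del: pos_alinks)
  have "rn g ?S = rn (\<lambda>n. 2 * n) ?S" by (rule rn_cong) (use gS in simp)
  moreover have "rn g (rn f ?T) = rn (\<lambda>n. 2 * n + 1) ?T"
    unfolding rn_comp by (rule rn_cong) (use gT in simp)
  moreover have "map g (concl S) = map (\<lambda>n. 2 * n) (concl S)"
    by (rule map_cong) (use cs gS in \<open>auto simp del: pos_alinks\<close>)
  moreover have "map g (map f (concl T)) = map (\<lambda>n. 2 * n + 1) (concl T)"
    unfolding map_map by (rule map_cong) (use cs gT in \<open>auto simp del: pos_alinks\<close>)
  ultimately have "rn g ?N = alinks (links (interaction S T))"
    unfolding alinks_interaction by (simp only: rn_simps rn_cuts)
  moreover have "inj_on g (pos ?N)"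
  proof (rule inj_onI)
    fix x y assume xy: "x \<in> pos ?N" "y \<in> pos ?N" "g x = g y"
    have "x \<in> pos ?S \<union> f ` pos ?T" "y \<in> pos ?S \<union> f ` pos ?T" using xy pc by (auto simp del: pos_alinks)
    moreover have "2 * n \<noteq> Suc (2 * m)" "Suc (2 * m) \<noteq> 2 * n" for n m by presburger+
    ultimately show "x = y" using xy(3) gT gS
      by (elim UnE imageE) (simp_all del: pos_alinks)
  qed
  ultimately show thesis using that gS by blast
qed

lemma orthogonal_iff:
  assumes "is_net S" "is_net T" "inj_on f (pos (alinks (links T)))"
    "pos (alinks (links S)) \<inter> f ` pos (alinks (links T)) = {}"
  shows "orthogonal S T \<longleftrightarrow> nconcl S = nconcl T \<and>
    win (alinks (links S) + rn f (alinks (links T)) + cuts (concl S) (map f (concl T)))"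
  using orthogonal_win[OF assms(1,2)] by (metis interaction_rename[OF assms] win_rn_iff)

lemma orthogonal_disjoint:
  assumes "is_net S" "is_net T" "pos (alinks (links S)) \<inter> pos (alinks (links T)) = {}"
  shows "orthogonal S T \<longleftrightarrow> nconcl S = nconcl T \<and>
    win (alinks (links S) + alinks (links T) + cuts (concl S) (concl T))"
  using orthogonal_iff[of S T id] assms by (simp add: rn_id del: pos_alinks)

lemma exists_shift:
  assumes "finite A"
  obtains f :: "nat \<Rightarrow> nat" where "inj f" "\<And>x. f x \<notin> A"
proof
  show "inj (\<lambda>x. x + Suc (Max (insert 0 A)))" by (simp add: inj_on_def)
  show "x + Suc (Max (insert 0 A)) \<notin> A" for x
  proof
    assume "x + Suc (Max (insert 0 A)) \<in> A"
    then have "x + Suc (Max (insert 0 A)) \<le> Max (insert 0 A)" using assms by (intro Max_ge) auto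
    then show False by simp
  qed
qed

lemma alinks_surj: "\<forall>l\<in>#L. wf_link l \<Longrightarrow> \<exists>L0. alinks L0 = L"
proof (induction L)
  case (add l L)
  then obtain L0 where L0: "alinks L0 = L" by auto
  have "\<exists>k. unord k = l"
  proof (cases l)
    case (AC ps)
    then have "size ps = 2" using add.prems by (simp add: wf_link_def)
    then obtain a b where "ps = {#a, b#}" by (metis Suc_1 Suc_inject size_1_singleton_mset One_nat_def size_Suc_Diff1 size_eq_Suc_imp_eq_union size_add_mset)
    then show ?thesis using AC by (metis unord.simps(3))
  qed (metis unord.simps(1), metis unord.simps(2), metis unord.simps(4) ex_mset)
  then show ?case using L0 by (metis alinks_simps(2))
qed (metis alinks_simps(1))

lemma net_surj:
  assumes "anet L (mset cs)"
  obtains S where "is_net S" "alinks (links S) = L" "concl S = cs"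
proof -
  obtain L0 where "alinks L0 = L" using alinks_surj assms by (metis anet_def)
  then show ?thesis using that[of "Net L0 cs"] assms by (simp add: is_net_anet)
qed

text \<open>Orthogonals are closed under isomorphism. The opponent is first moved by
  \<open>g\<close> away from both \<open>S\<close> and its renamed copy, so that renaming
  \<open>S\<close> alone is injective on the whole interaction.\<close>

lemma orth_cong:
  assumes A: "\<And>R. R \<in> A \<Longrightarrow> is_net R" and S: "S \<in> orth A" and f: "inj_on f (pos (alinks (links S)))"
    and S': "alinks (links S') = rn f (alinks (links S))" "concl S' = map f (concl S)"
  shows "S' \<in> orth A"
proof -
  have n: "is_net S" using S by (simp add: orth_def)
  have n': "is_net S'"
    using anet_rn[OF n[unfolded is_net_anet] f] by (simp add: is_net_anet S')
  have "orthogonal S' R" if R: "R \<in> A" for R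
  proof -
    let ?S = "alinks (links S)" and ?R = "alinks (links R)"
    obtain g :: "nat \<Rightarrow> nat" where g: "inj g" "\<And>x. g x \<notin> pos ?S \<union> f ` pos ?S"
      using exists_shift[of "pos ?S \<union> f ` pos ?S"] by (metis finite_UnI finite_imageI finite_pos)
    have gi: "inj_on g (pos ?R)" using g(1) by (rule inj_on_subset) simp
    have o: "orthogonal S R" using S R by (simp add: orth_def)
    have "pos ?S \<inter> g ` pos ?R = {}" using g(2) by blast
    note w = orthogonal_iff[OF n A[OF R] gi this, THEN iffD1, OF o]
    define h where "h x = (if x \<in> pos ?S then f x else x)" for x
    let ?N = "?S + rn g ?R + cuts (concl S) (map g (concl R))"
    note b = A[OF R, unfolded is_net_anet]
    have cs: "set (concl S) \<subseteq> pos ?S" "set (concl R) \<subseteq> pos ?R"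
      using anet_concl_subset[OF n[unfolded is_net_anet]] anet_concl_subset[OF b] by (simp_all del: pos_alinks)
    have pc: "pos (cuts (concl S) (map g (concl R))) \<subseteq> pos ?S \<union> g ` pos ?R"
      using cs pos_cuts[of "concl S" "map g (concl R)"] unfolding set_map by blast
    have "inj_on h (pos ?N)"
    proof (rule inj_onI)
      fix x y assume xy: "x \<in> pos ?N" "y \<in> pos ?N" "h x = h y"
      have "x \<in> pos ?S \<union> g ` pos ?R" "y \<in> pos ?S \<union> g ` pos ?R" using xy pc by (auto simp del: pos_alinks)
      moreover have "g z \<noteq> f x" if "x \<in> pos ?S" for z x using g(2)[of z] that by (metis UnI2 imageI)
      ultimately show "x = y" using xy(3) f g(2) unfolding h_def
        by (auto simp del: pos_alinks split: if_splits simp: inj_on_def dest: sym)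
    qed
    with w have "win (rn h ?N)" using win_rn by blast
    moreover have "rn h ?S = rn f ?S" by (rule rn_cong) (simp add: h_def)
    moreover have "rn h (rn g ?R) = rn g ?R" by (rule rn_id) (use g(2) in \<open>auto simp: h_def simp del: pos_alinks\<close>)
    moreover have "map h (concl S) = map f (concl S)" by (rule map_cong) (use cs h_def in \<open>auto simp del: pos_alinks\<close>)
    moreover have "map h (map g (concl R)) = map g (concl R)" by (rule map_idI) (use g(2) in \<open>auto simp: h_def simp del: pos_alinks\<close>)
    ultimately have "win (rn f ?S + rn g ?R + cuts (map f (concl S)) (map g (concl R)))"
      by (simp only: rn_simps rn_cuts)
    moreover have "pos (alinks (links S')) \<inter> g ` pos ?R = {}"
    proof -
      have gz: "g z \<notin> f ` pos ?S" for z using g(2)[of z] by (simp del: pos_alinks)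
      have "x \<notin> f ` pos ?S" if x: "x \<in> g ` pos ?R" for x
      proof -
        obtain z where "x = g z" using x by (rule imageE)
        then show ?thesis using gz[of z] by simp
      qed
      then show ?thesis unfolding S' pos_rn by (intro equals0I) (erule IntE, simp)
    qed
    ultimately show ?thesis using orthogonal_iff[OF n' A[OF R] gi] w by (simp add: S' del: pos_alinks)
  qed
  then show ?thesis using n' by (simp add: orth_def)
qed

section \<open>Playing against families of opponents\<close>

type_synonym behaviour = "(nat alink multiset \<times> nat) set"

definition points :: "net set \<Rightarrow> behaviour" where
  "points A = {(alinks (links S), c) | S c. S \<in> A \<and> concl S = [c]}"

text \<open>Orthogonality of a net with several conclusions to all tuples of opponents, in curried
  form: an opponent once plugged becomes part of the net that faces the others. This matches the
  nesting of \<open>type_seq\<close>.\<close>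

fun passes :: "nat alink multiset \<Rightarrow> (nat \<times> behaviour) list \<Rightarrow> bool" where
  "passes L [] = win L"
| "passes L ((p, P) # G) =
     (\<forall>(M, q)\<in>P. pos M \<inter> pos L = {} \<longrightarrow> passes (L + M + {#AC {#p, q#}#}) G)"

lemma pointsI: "S \<in> A \<Longrightarrow> concl S = [c] \<Longrightarrow> (alinks (links S), c) \<in> points A"
  by (auto simp: points_def)

lemma pointsE:
  assumes "(M, q) \<in> points A"
  obtains S where "S \<in> A" "M = alinks (links S)" "concl S = [q]"
  using assms by (auto simp: points_def)

lemma passes_ConsD:
  "passes L ((p, P) # G) \<Longrightarrow> (M, q) \<in> P \<Longrightarrow> pos M \<inter> pos L = {} \<Longrightarrow> passes (L + M + {#AC {#p, q#}#}) G"
  by auto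

lemma shift_disjoint: "(\<And>x. f x \<notin> A) \<Longrightarrow> f ` B \<inter> A = {}" "(\<And>x. f x \<notin> A) \<Longrightarrow> A \<inter> f ` B = {}"
  by auto

definition behaved :: "behaviour \<Rightarrow> bool" where
  "behaved P \<longleftrightarrow> (\<forall>(M, q)\<in>P. anet M {#q#} \<and> (\<forall>f. inj_on f (pos M) \<longrightarrow> (rn f M, f q) \<in> P))"

lemma behavedD: "behaved P \<Longrightarrow> (M, q) \<in> P \<Longrightarrow> anet M {#q#}"
  "behaved P \<Longrightarrow> (M, q) \<in> P \<Longrightarrow> inj_on f (pos M) \<Longrightarrow> (rn f M, f q) \<in> P"
  by (auto simp: behaved_def)

lemma behaved_mem: "behaved P \<Longrightarrow> (M, q) \<in> P \<Longrightarrow> q \<in> pos M"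
  using anet_concl_subset[of M "{#q#}"] behavedD(1) by fastforce

lemma passes_mono: "list_all2 (\<lambda>(p, P) (q, Q). p = q \<and> Q \<subseteq> P) G H \<Longrightarrow> passes L G \<Longrightarrow> passes L H"
proof (induction G arbitrary: L H)
  case (Cons x G)
  obtain p P where x: "x = (p, P)" by fastforce
  with Cons.prems(1) obtain Q H' where H: "H = (p, Q) # H'" "Q \<subseteq> P" "list_all2 (\<lambda>(p, P) (q, Q). p = q \<and> Q \<subseteq> P) G H'"
    by (auto simp: list_all2_Cons1)
  show ?case unfolding H(1) passes.simps
  proof (intro ballI, clarify)
    fix M q assume M: "(M, q) \<in> Q" "pos M \<inter> pos L = {}"
    then have "passes (L + M + {#AC {#p, q#}#}) G" using Cons.prems(2) H(2) x by auto
    then show "passes (L + M + {#AC {#p, q#}#}) H'" by (rule Cons.IH[OF H(3)])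
  qed
qed simp

lemma passes_swap_front:
  assumes "behaved P" "behaved Q" "p \<in> pos L" "q \<in> pos L" "passes L ((p, P) # (q, Q) # G)"
  shows "passes L ((q, Q) # (p, P) # G)"
proof -
  have "passes (L + N + {#AC {#q, b#}#} + M + {#AC {#p, a#}#}) G"
    if N: "(N, b) \<in> Q" "pos N \<inter> pos L = {}" and M: "(M, a) \<in> P" "pos M \<inter> pos (L + N + {#AC {#q, b#}#}) = {}" for M N a b
  proof -
    have "passes (L + M + {#AC {#p, a#}#}) ((q, Q) # G)" using assms(5) M by auto
    moreover have "pos N \<inter> pos (L + M + {#AC {#p, a#}#}) = {}"
      using N M behaved_mem[OF assms(1) M(1)] assms(3) by auto
    ultimately have "passes (L + M + {#AC {#p, a#}#} + N + {#AC {#q, b#}#}) G" using N(1) by auto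
    then show ?thesis by (simp add: add_ac add_mset_commute)
  qed
  then show ?thesis unfolding passes.simps by blast
qed

lemma passes_swap:
  assumes "passes L (H @ (p, P) # (q, Q) # G)" "behaved P" "behaved Q" "p \<in> pos L" "q \<in> pos L"
  shows "passes L (H @ (q, Q) # (p, P) # G)"
  using assms
proof (induction H arbitrary: L)
  case Nil
  then show ?case using passes_swap_front[of P Q p L q G] by simp
next
  case (Cons x H)
  obtain r R where x: "x = (r, R)" by fastforce
  have "passes (L + M + {#AC {#r, a#}#}) (H @ (q, Q) # (p, P) # G)" if "(M, a) \<in> R" "pos M \<inter> pos L = {}" for M a
    by (rule Cons.IH) (use Cons.prems that x in auto)
  then show ?case by (auto simp: x)
qed

text \<open>A frame rule: the opponents of \<open>G\<close> are plugged first and absorbed into the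
  net, so a construction \<open>X\<close> on the last conclusions can be justified as if there were
  no others.\<close>

lemma passes_lift:
  assumes step: "\<And>L'. anet L' (mset (map fst H)) \<Longrightarrow> pos L' \<inter> pos X \<subseteq> set (map fst H) \<Longrightarrow> passes L' H \<Longrightarrow> passes (L' + X) H'"
    and "anet L (mset (map fst (G @ H)))" "pos L \<inter> pos X \<subseteq> set (map fst H)" "passes L (G @ H)"
    "\<forall>(p, P)\<in>set G. behaved P"
  shows "passes (L + X) (G @ H')"
  using assms(2-)
proof (induction G arbitrary: L)
  case Nil then show ?case using step[of L] by simp
next
  case (Cons x G)
  obtain r R where x: "x = (r, R)" by fastforce
  have "passes (L + X + M + {#AC {#r, a#}#}) (G @ H')" if M: "(M, a) \<in> R" "pos M \<inter> pos (L + X) = {}" for M a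
  proof -
    have b: "behaved R" using Cons.prems(4) x by auto
    have an: "anet M {#a#}" by (rule behavedD(1)[OF b M(1)])
    have r: "r \<in> pos L" using anet_concl_subset[OF Cons.prems(1)] by (simp add: x)
    have "anet (L + M + cuts [r] [a]) (mset (map fst (G @ H)) + {#})"
      by (rule anet_cuts) (use Cons.prems(1) an M in \<open>auto simp: x\<close>)
    moreover have "pos (L + M + {#AC {#r, a#}#}) \<inter> pos X \<subseteq> set (map fst H)"
      using M Cons.prems(2) r behaved_mem[OF b M(1)] by auto
    moreover have "passes (L + M + {#AC {#r, a#}#}) (G @ H)"
      using Cons.prems(3) M by (auto simp: x)
    ultimately have "passes (L + M + {#AC {#r, a#}#} + X) (G @ H')"
      by (intro Cons.IH) (use Cons.prems(4) in simp_all)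
    then show ?thesis by (simp add: add_ac add_mset_commute)
  qed
  then show ?case by (auto simp: x)
qed

lemma passes_rn:
  assumes "inj_on f (pos L)" "set (map fst G) \<subseteq> pos L" "\<forall>(p, P)\<in>set G. behaved P" "passes L G"
  shows "passes (rn f L) (map (\<lambda>(p, P). (f p, P)) G)"
  using assms
proof (induction G arbitrary: f L)
  case Nil then show ?case by (simp add: win_rn)
next
  case (Cons x G)
  obtain r R where x: "x = (r, R)" by fastforce
  have b: "behaved R" using Cons.prems(3) x by auto
  have r: "r \<in> pos L" using Cons.prems(2) by (simp add: x)
  have "passes (rn f L + M + {#AC {#f r, a#}#}) (map (\<lambda>(p, P). (f p, P)) G)"
    if M: "(M, a) \<in> R" "pos M \<inter> pos (rn f L) = {}" for M a
  proof -
    \<comment> \<open>An opponent disjoint from the renamed net may still meet \<open>L\<close>; it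
      is moved away by \<open>h\<close> and brought back by \<open>k\<close>, which acts as
      \<open>f\<close> on \<open>L\<close>.\<close>
    obtain h :: "nat \<Rightarrow> nat" where h: "inj h" "\<And>x. h x \<notin> pos L" using exists_shift[OF finite_pos[of L]] by metis
    have hi: "inj_on h (pos M)" using h(1) by (rule inj_on_subset) simp
    have aM: "a \<in> pos M" by (rule behaved_mem[OF b M(1)])
    let ?N = "L + rn h M + {#AC {#r, h a#}#}"
    have ps: "passes ?N G"
      by (rule passes_ConsD[OF Cons.prems(4)[unfolded x] behavedD(2)[OF b M(1) hi]])
        (unfold pos_rn, rule shift_disjoint(1), rule h(2))
    define k where "k x = (if x \<in> pos L then f x else inv h x)" for x
    have kh: "k (h y) = y" for y using h by (simp add: k_def)
    have kL: "k y = f y" if "y \<in> pos L" for y using that by (simp add: k_def)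
    have pN: "pos ?N = pos L \<union> h ` pos M" using r aM by auto
    have "inj_on k (pos ?N)" unfolding pN
    proof (rule inj_onI)
      fix y z assume yz: "y \<in> pos L \<union> h ` pos M" "z \<in> pos L \<union> h ` pos M" "k y = k z"
      then show "y = z" using inj_onD[OF Cons.prems(1)] M(2) kh kL
        by (elim UnE imageE) (auto simp: disjoint_iff)
    qed
    then have "passes (rn k ?N) (map (\<lambda>(p, P). (k p, P)) G)"
      by (rule Cons.IH) (use Cons.prems ps in \<open>auto simp: x\<close>)
    moreover have "rn k ?N = rn f L + M + {#AC {#f r, a#}#}"
    proof -
      have "rn k L = rn f L" by (rule rn_cong) (use kL in simp)
      moreover have "rn k (rn h M) = M" unfolding rn_comp by (rule rn_id) (simp add: kh)
      ultimately show ?thesis using kh kL r by simp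
    qed
    moreover have "map (\<lambda>(p, P). (k p, P)) G = map (\<lambda>(p, P). (f p, P)) G"
      using Cons.prems(2) kL by (auto simp: x)
    ultimately show ?thesis by simp
  qed
  then show ?case by (auto simp: x)
qed

lemma passes_rn_iff:
  assumes "inj_on f (pos L)" "set (map fst G) \<subseteq> pos L" "\<forall>(p, P)\<in>set G. behaved P"
  shows "passes (rn f L) (map (\<lambda>(p, P). (f p, P)) G) \<longleftrightarrow> passes L G"
proof
  assume p: "passes (rn f L) (map (\<lambda>(p, P). (f p, P)) G)"
  let ?g = "inv_into (pos L) f"
  have "passes (rn ?g (rn f L)) (map (\<lambda>(p, P). (?g p, P)) (map (\<lambda>(p, P). (f p, P)) G))"
    by (rule passes_rn[OF _ _ _ p]) (use assms in \<open>auto simp: inj_on_inv_into\<close>)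
  moreover have "rn ?g (rn f L) = L" unfolding rn_comp by (rule rn_id) (simp add: assms(1))
  moreover have "map (\<lambda>(p, P). (?g p, P)) (map (\<lambda>(p, P). (f p, P)) G) = G"
    unfolding map_map by (rule map_idI) (use assms(1,2) in auto)
  ultimately show "passes L G" by simp
qed (rule passes_rn[OF assms])

lemma is_net_orth: "S \<in> orth A \<Longrightarrow> is_net S"
  by (simp add: orth_def)

lemma behaved_orth:
  assumes "\<And>R. R \<in> A \<Longrightarrow> is_net R"
  shows "behaved (points (orth A))"
proof -
  have "anet M {#q#} \<and> (\<forall>f. inj_on f (pos M) \<longrightarrow> (rn f M, f q) \<in> points (orth A))"
    if "(M, q) \<in> points (orth A)" for M q
  proof -
    obtain S where S: "S \<in> orth A" "M = alinks (links S)" "concl S = [q]"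
      using \<open>(M, q) \<in> points (orth A)\<close> by (auto simp: points_def)
    have an: "anet M (mset [q])" using is_net_orth[OF S(1)] S by (simp add: is_net_anet)
    moreover have "(rn f M, f q) \<in> points (orth A)" if f: "inj_on f (pos M)" for f
    proof -
      have "anet (rn f M) (mset [f q])" using anet_rn[OF an f] by simp
      then obtain S' where S': "is_net S'" "alinks (links S') = rn f M" "concl S' = [f q]" by (rule net_surj)
      have "S' \<in> orth A" by (rule orth_cong[OF assms S(1), of f]) (use S S' f in simp_all)
      then show ?thesis using S' unfolding points_def by force
    qed
    ultimately show ?thesis by simp
  qed
  then show ?thesis unfolding behaved_def by blast
qed

lemma points_orthI:
  assumes A: "\<And>R. R \<in> A \<Longrightarrow> is_net R \<and> nconcl R = 1" and L: "anet L {#p#}"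
    and b: "behaved (points A)" and p: "passes L [(p, points A)]"
  shows "(L, p) \<in> points (orth A)"
proof -
  obtain S where S: "is_net S" "alinks (links S) = L" "concl S = [p]"
    using L net_surj[of L "[p]"] by auto
  have "orthogonal S R" if R: "R \<in> A" for R
  proof -
    obtain f :: "nat \<Rightarrow> nat" where f: "inj f" "\<And>x. f x \<notin> pos L" using exists_shift[OF finite_pos[of L]] by metis
    have fi: "inj_on f (pos (alinks (links R)))" using f(1) by (rule inj_on_subset) simp
    obtain c where c: "concl R = [c]" using A[OF R] by (auto simp: length_Suc_conv)
    then have "(alinks (links R), c) \<in> points A" using R by (auto simp: points_def)
    from passes_ConsD[OF p behavedD(2)[OF b this fi]]
    have "win (L + rn f (alinks (links R)) + {#AC {#p, f c#}#})"
      unfolding passes.simps pos_rn using shift_disjoint(1)[of f, OF f(2)] by blast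
    moreover have "pos L \<inter> f ` pos (alinks (links R)) = {}" using f(2) by blast
    ultimately show ?thesis using orthogonal_iff[of S R f] S A[OF R] c fi by simp
  qed
  then have "S \<in> orth A" using S by (simp add: orth_def)
  then show ?thesis using S unfolding points_def by force
qed

lemma points_orthD:
  assumes A: "\<And>R. R \<in> A \<Longrightarrow> is_net R" and "(L, p) \<in> points (orth A)"
  shows "anet L {#p#} \<and> passes L [(p, points A)]"
proof -
  obtain S where S: "S \<in> orth A" "L = alinks (links S)" "concl S = [p]"
    using assms(2) by (auto simp: points_def)
  have n: "is_net S" by (rule is_net_orth[OF S(1)])
  have "win (L + M + {#AC {#p, q#}#})" if M: "(M, q) \<in> points A" "pos M \<inter> pos L = {}" for M q
  proof -
    obtain R where R: "R \<in> A" "M = alinks (links R)" "concl R = [q]" using M(1) by (rule pointsE)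
    have "orthogonal S R" using S R by (simp add: orth_def)
    moreover have "pos (alinks (links S)) \<inter> pos (alinks (links R)) = {}" using M S R by blast
    ultimately show ?thesis using orthogonal_disjoint[OF n A[OF R(1)]] S R by simp
  qed
  then show ?thesis using n S by (auto simp: is_net_anet)
qed

text \<open>Exchanging each even number with its odd successor turns one interaction into the
  other.\<close>

lemma orthogonal_sym:
  assumes "is_net S" "is_net T" "orthogonal S T"
  shows "orthogonal T S"
proof -
  let ?s = "\<lambda>n::nat. if even n then n + 1 else n - 1"
  let ?N = "alinks (links (interaction S T))"
  have inj: "inj ?s"
  proof (rule injI)
    fix x y assume "?s x = ?s y" then show "x = y" by (auto split: if_splits elim!: oddE) presburger+
  qed
  have w: "nconcl S = nconcl T" "win ?N" using orthogonal_win[OF assms(1,2)] assms(3) by auto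
  have "win (rn ?s ?N)" by (rule win_rn[OF w(2)]) (rule inj_on_subset[OF inj], simp)
  moreover have "rn ?s ?N = alinks (links (interaction T S))"
  proof -
    have "?s \<circ> (\<lambda>n. 2 * n) = (\<lambda>n. 2 * n + 1)" "?s \<circ> (\<lambda>n. 2 * n + 1) = (\<lambda>n. 2 * n)" by auto
    then show ?thesis unfolding alinks_interaction rn_simps rn_cuts rn_comp map_map
      by (simp only: add_ac cuts_commute)
  qed
  ultimately show ?thesis using orthogonal_win[OF assms(2,1)] w by simp
qed

lemma orth_antimono: "A \<subseteq> B \<Longrightarrow> orth B \<subseteq> orth A"
  by (auto simp: orth_def)

lemma orth_orth_incl: "(\<And>R. R \<in> A \<Longrightarrow> is_net R) \<Longrightarrow> A \<subseteq> orth (orth A)"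
  by (auto simp: orth_def intro: orthogonal_sym)

lemma orth_orth_orth: "(\<And>R. R \<in> A \<Longrightarrow> is_net R) \<Longrightarrow> orth (orth (orth A)) = orth A"
  by (metis orth_antimono orth_orth_incl is_net_orth subset_antisym)

lemma alinks_daimon_net [simp]: "alinks (links (daimon_net n)) = {#AD (mset [0..<n])#}" "concl (daimon_net n) = [0..<n]"
  by (simp_all add: daimon_net_def)

lemma anet_daimon: "simple_mset ps \<Longrightarrow> anet {#AD ps#} ps"
  by (simp add: anet_def wf_link_def)

lemma is_net_daimon_net: "is_net (daimon_net n)"
  unfolding is_net_anet alinks_daimon_net by (rule anet_daimon) (simp only: simple_mset_mset distinct_upt)

section \<open>Types with the daimon on both sides, and sequents as lists of opponents\<close>

text \<open>The invariant satisfied by every formula over an approximable basis. Holding the daimon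
  on both sides makes the type and its orthogonal nonempty and forces one conclusion on every net in
  them.\<close>

definition unary :: "net set \<Rightarrow> bool" where
  "unary A \<longleftrightarrow> orth (orth A) = A \<and> daimon_net 1 \<in> A \<and> daimon_net 1 \<in> orth A"

lemma unary_orth: "unary A \<Longrightarrow> unary (orth A)"
  by (simp add: unary_def)

lemma unary_net:
  assumes "unary A" "S \<in> A"
  shows "is_net S \<and> nconcl S = 1"
proof -
  have n: "is_net S" using assms is_net_orth unfolding unary_def by metis
  have "orthogonal (daimon_net 1) S" using assms by (simp add: unary_def orth_def)
  then have "nconcl (daimon_net 1) = nconcl S" using orthogonal_win[OF is_net_daimon_net n] by simp
  then show ?thesis using n by simp
qed

lemma unary_behaved: "unary A \<Longrightarrow> behaved (points A)"
  using behaved_orth[of "orth A"] is_net_orth by (metis unary_def)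

lemma unary_points_orth: "unary A \<Longrightarrow> (L, p) \<in> points (orth A) \<longleftrightarrow> anet L {#p#} \<and> passes L [(p, points A)]"
  using points_orthD[of A L p] points_orthI[of A L p] unary_net unary_behaved by blast

lemma unary_points: "unary A \<Longrightarrow> (L, p) \<in> points A \<longleftrightarrow> anet L {#p#} \<and> passes L [(p, points (orth A))]"
  using unary_points_orth[OF unary_orth] by (simp add: unary_def)

lemma unary_daimon: assumes "unary A" shows "({#AD {#p#}#}, p) \<in> points A"
proof -
  have "(alinks (links (daimon_net 1)), 0) \<in> points A"
    using assms unfolding points_def unary_def by (intro CollectI exI[of _ "daimon_net 1"] exI[of _ 0]) simp
  from behavedD(2)[OF unary_behaved[OF assms] this, of "\<lambda>_. p"] show ?thesis by simp
qed

definition passing_net :: "behaviour list \<Rightarrow> net \<Rightarrow> bool" where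
  "passing_net Ps S \<longleftrightarrow> is_net S \<and> nconcl S = length Ps \<and> passes (alinks (links S)) (zip (concl S) Ps)"

lemma concl_interaction1: "concl S = c # cs \<Longrightarrow> concl T = [t] \<Longrightarrow> concl (interaction S T) = map (\<lambda>n. 2 * n) cs"
  by (simp add: interaction_def Let_def left_copy_def right_copy_def rename_def)

lemma is_net_interaction1:
  assumes "is_net S" "is_net T" "concl S = c # cs" "concl T = [t]"
  shows "is_net (interaction S T)"
proof -
  note a = assms(1,2)[unfolded is_net_anet]
  have "anet (rn (\<lambda>n. 2 * n) (alinks (links S)) + rn (\<lambda>n. 2 * n + 1) (alinks (links T)) +
   cuts [2 * c] [2 * t + 1]) (mset (map (\<lambda>n. 2 * n) cs) + {#})"
  proof (rule anet_cuts)
    show "anet (rn (\<lambda>n. 2 * n) (alinks (links S))) (mset [2 * c] + mset (map (\<lambda>n. 2 * n) cs))"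
      using anet_rn[OF a(1), of "\<lambda>n. 2 * n"] by (simp add: inj_on_def assms)
    show "anet (rn (\<lambda>n. 2 * n + 1) (alinks (links T))) (mset [2 * t + 1] + {#})"
      using anet_rn[OF a(2), of "\<lambda>n. 2 * n + 1"] by (simp add: inj_on_def assms)
    show "pos (rn (\<lambda>n. 2 * n) (alinks (links S))) \<inter> pos (rn (\<lambda>n. 2 * n + 1) (alinks (links T))) = {}"
      unfolding pos_rn by (rule parity_disjoint)
  qed simp
  then show ?thesis unfolding is_net_anet alinks_interaction using concl_interaction1[OF assms(3,4)] by (simp add: assms)
qed

lemma passes_interaction:
  assumes S: "is_net S" and T: "is_net T" and c: "concl S = c # cs" "concl T = [t]"
    and f: "inj_on f (pos (alinks (links T)))" and d: "pos (alinks (links S)) \<inter> f ` pos (alinks (links T)) = {}"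
    and P: "\<forall>P\<in>set Ps. behaved P"
  shows "passes (alinks (links (interaction S T))) (zip (concl (interaction S T)) Ps) \<longleftrightarrow>
    passes (alinks (links S) + rn f (alinks (links T)) + {#AC {#c, f t#}#}) (zip cs Ps)"
proof -
  let ?N = "alinks (links S) + rn f (alinks (links T)) + cuts (concl S) (map f (concl T))"
  obtain g where g: "inj_on g (pos ?N)" "rn g ?N = alinks (links (interaction S T))"
    "\<And>x. x \<in> pos (alinks (links S)) \<Longrightarrow> g x = 2 * x"
    using interaction_rename[OF S T f d] by metis
  have cs: "set cs \<subseteq> pos (alinks (links S))"
    using anet_concl_subset[OF S[unfolded is_net_anet]] by (simp add: c)
  have m: "map (\<lambda>n. 2 * n) cs = map g cs" using cs g(3) by auto
  have z: "zip (concl (interaction S T)) Ps = map (\<lambda>(p, P). (g p, P)) (zip cs Ps)"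
    unfolding concl_interaction1[OF c] m by (rule zip_map1)
  have "passes (rn g ?N) (map (\<lambda>(p, P). (g p, P)) (zip cs Ps)) \<longleftrightarrow> passes ?N (zip cs Ps)"
  proof (rule passes_rn_iff[OF g(1)])
    show "set (map fst (zip cs Ps)) \<subseteq> pos ?N" using cs by (auto dest: set_zip_leftD)
    show "\<forall>(p, P)\<in>set (zip cs Ps). behaved P" using P by (auto dest: set_zip_rightD)
  qed
  then show ?thesis unfolding z g(2) by (simp add: c)
qed

lemma type_nconcl_unary: "unary A \<Longrightarrow> type_nconcl A = 1"
  unfolding type_nconcl_def
proof (rule the_equality)
  assume A: "unary A"
  show "\<forall>S\<in>A \<union> orth A. nconcl S = 1" using unary_net[OF A] unary_net[OF unary_orth[OF A]] by blast
  have d: "daimon_net 1 \<in> A" using A by (simp add: unary_def)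
  show "n = 1" if "\<forall>S\<in>A \<union> orth A. nconcl S = n" for n
    using that[rule_format, of "daimon_net 1"] d by simp
qed

text \<open>Plugging an element of \<open>orth A\<close> on the first conclusion is one unfolding of
  \<open>passes\<close>, so nested types become lists of opponents.\<close>

lemma type_seq_passing_net:
  assumes A: "unary A" and C: "\<And>S. S \<in> C \<longleftrightarrow> passing_net Ps S" and P: "\<forall>P\<in>set Ps. behaved P"
  shows "S \<in> type_seq A C \<longleftrightarrow> passing_net (points (orth A) # Ps) S"
proof
  assume s: "S \<in> type_seq A C"
  then have n: "is_net S" by (simp add: type_seq_def)
  have "A \<noteq> {}" "orth A \<noteq> {}" using A by (auto simp: unary_def)
  \<comment> \<open>The side condition guarantees a conclusion to plug into; interaction with the
    daimon of \<open>orth A\<close> then gives the exact number.\<close>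
  then have "nconcl S \<ge> 1" using s type_nconcl_unary[OF A] by (simp add: type_seq_def)
  then obtain c cs where c: "concl S = c # cs" by (cases "concl S") auto
  have len: "length cs = length Ps"
  proof -
    have "daimon_net 1 \<in> orth A" using A by (simp add: unary_def)
    then have "passing_net Ps (interaction S (daimon_net 1))" using s C by (simp add: type_seq_def)
    then show ?thesis using concl_interaction1[OF c, of "daimon_net 1" 0] by (simp add: passing_net_def)
  qed
  have "passes (alinks (links S) + M + {#AC {#c, q#}#}) (zip cs Ps)"
    if M: "(M, q) \<in> points (orth A)" "pos M \<inter> pos (alinks (links S)) = {}" for M q
  proof -
    obtain T where T: "T \<in> orth A" "M = alinks (links T)" "concl T = [q]" using M(1) by (rule pointsE)
    have "passes (alinks (links (interaction S T))) (zip (concl (interaction S T)) Ps)"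
      using s T C by (simp add: type_seq_def passing_net_def)
    then have "passes (alinks (links S) + rn id (alinks (links T)) + {#AC {#c, id q#}#}) (zip cs Ps)"
      by (subst (asm) passes_interaction[OF n is_net_orth[OF T(1)] c T(3) _ _ P, of id])
        (use M T in \<open>auto simp del: pos_alinks\<close>)
    then show ?thesis using T by (simp add: rn_id)
  qed
  then show "passing_net (points (orth A) # Ps) S" using n len c by (auto simp: passing_net_def simp del: pos_alinks)
next
  assume p: "passing_net (points (orth A) # Ps) S"
  then have n: "is_net S" by (simp add: passing_net_def)
  obtain c cs where c: "concl S = c # cs" "length cs = length Ps"
    using p by (cases "concl S") (auto simp: passing_net_def)
  have "interaction S T \<in> C" if T: "T \<in> orth A" for T
  proof -
    have nT: "is_net T" "nconcl T = 1" using unary_net[OF unary_orth[OF A] T] by auto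
    then obtain t where t: "concl T = [t]" by (auto simp: length_Suc_conv)
    obtain f :: "nat \<Rightarrow> nat" where f: "inj f" "\<And>x. f x \<notin> pos (alinks (links S))"
      using exists_shift[OF finite_pos] by metis
    have fi: "inj_on f (pos (alinks (links T)))" using f(1) by (rule inj_on_subset) simp
    have "(alinks (links T), t) \<in> points (orth A)" using T t by (intro pointsI)
    from behavedD(2)[OF unary_behaved[OF unary_orth[OF A]] this fi]
    have m: "(rn f (alinks (links T)), f t) \<in> points (orth A)" .
    have d: "pos (alinks (links S)) \<inter> f ` pos (alinks (links T)) = {}" using f(2) by blast
    have "passes (alinks (links S)) ((c, points (orth A)) # zip cs Ps)"
      using p by (simp add: passing_net_def c)
    from passes_ConsD[OF this m]
    have "passes (alinks (links S) + rn f (alinks (links T)) + {#AC {#c, f t#}#}) (zip cs Ps)"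
      unfolding pos_rn using d by blast
    then have "passes (alinks (links (interaction S T))) (zip (concl (interaction S T)) Ps)"
      using passes_interaction[OF n nT(1) c(1) t fi d P] by blast
    then show ?thesis
      using C is_net_interaction1[OF n nT(1) c(1) t] concl_interaction1[OF c(1) t] c(2) by (simp add: passing_net_def)
  qed
  then show "S \<in> type_seq A C" using n c type_nconcl_unary[OF A] by (simp add: type_seq_def)
qed

lemma passing_net_single: "unary A \<Longrightarrow> S \<in> A \<longleftrightarrow> passing_net [points (orth A)] S"
proof
  assume A: "unary A" and S: "S \<in> A"
  then obtain c where c: "concl S = [c]" using unary_net[OF A S] by (auto simp: length_Suc_conv)
  then have "(alinks (links S), c) \<in> points A" using S by (intro pointsI)
  then show "passing_net [points (orth A)] S" using unary_points[OF A] unary_net[OF A S] c by (simp add: passing_net_def)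
next
  assume A: "unary A" and S: "passing_net [points (orth A)] S"
  then obtain c where c: "concl S = [c]" by (auto simp: passing_net_def length_Suc_conv)
  then have "(alinks (links S), c) \<in> points A" using S unary_points[OF A] by (simp add: passing_net_def is_net_anet)
  then obtain T where T: "T \<in> A" "alinks (links T) = alinks (links S)" "concl T = concl S"
    using c unfolding points_def by force
  have "S \<in> orth (orth A)"
    by (rule orth_cong[of _ T id]) (use T A is_net_orth in \<open>auto simp: unary_def rn_id\<close>)
  then show "S \<in> A" using A by (simp add: unary_def)
qed

lemma passing_net_empty: "S \<in> orth (orth {daimon_net 0}) \<longleftrightarrow> passing_net [] S"
proof -
  have o: "T \<in> orth {daimon_net 0} \<longleftrightarrow> links T = {#} \<and> concl T = []" for T
  proof
    assume T: "T \<in> orth {daimon_net 0}"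
    then have n: "is_net T" "orthogonal T (daimon_net 0)" by (auto simp: orth_def)
    then have "concl T = []" "win (alinks (links T) + {#AD {#}#})"
      using orthogonal_disjoint[OF n(1) is_net_daimon_net[of 0]] by auto
    moreover from this have "alinks (links T) = {#}" using win_empty_daimon[of "alinks (links T)"] by simp
    ultimately show "links T = {#} \<and> concl T = []" by (simp add: alinks_def)
  next
    assume T: "links T = {#} \<and> concl T = []"
    then have n: "is_net T" by (simp add: is_net_anet anet_def)
    then show "T \<in> orth {daimon_net 0}"
      using orthogonal_disjoint[OF n is_net_daimon_net[of 0]] T win_base by (simp add: orth_def)
  qed
  have e: "is_net (Net {#} [])" by (simp add: is_net_anet anet_def)
  have "orth {daimon_net 0} = {Net {#} []}"
  proof (rule set_eqI)
    show "T \<in> orth {daimon_net 0} \<longleftrightarrow> T \<in> {Net {#} []}" for T unfolding o by (cases T) auto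
  qed
  then have "S \<in> orth (orth {daimon_net 0}) \<longleftrightarrow> is_net S \<and> orthogonal S (Net {#} [])" by (simp add: orth_def)
  also have "\<dots> \<longleftrightarrow> passing_net [] S"
    using orthogonal_disjoint[OF _ e, of S] by (auto simp: passing_net_def)
  finally show ?thesis .
qed

lemma interp_sequent_passing_net:
  assumes "\<forall>A. unary (interp \<B> A)"
  shows "S \<in> interp_sequent \<B> \<Gamma> \<longleftrightarrow> passing_net (map (\<lambda>A. points (orth (interp \<B> A))) \<Gamma>) S"
  using assms
proof (induction \<B> \<Gamma> arbitrary: S rule: interp_sequent.induct)
  case (1 \<B>) then show ?case using passing_net_empty by simp
next
  case (2 \<B> A) then show ?case using passing_net_single by simp
next
  case (3 \<B> A B \<Gamma>)
  have "S \<in> type_seq (interp \<B> A) (interp_sequent \<B> (B # \<Gamma>)) \<longleftrightarrow>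
      passing_net (points (orth (interp \<B> A)) # map (\<lambda>A. points (orth (interp \<B> A))) (B # \<Gamma>)) S"
    by (rule type_seq_passing_net)
      (use 3 unary_behaved unary_orth in auto)
  then show ?case by simp
qed

lemma passes2:
  assumes "passes L [(p, P), (q, Q)]" "(M, a) \<in> P" "(N, b) \<in> Q" "p \<in> pos L" "a \<in> pos M"
    "pos M \<inter> pos L = {}" "pos N \<inter> pos L = {}" "pos N \<inter> pos M = {}"
  shows "win (L + M + N + {#AC {#p, a#}, AC {#q, b#}#})"
proof -
  have "passes (L + M + {#AC {#p, a#}#}) [(q, Q)]" by (rule passes_ConsD[OF assms(1,2,6)])
  moreover have "pos N \<inter> pos (L + M + {#AC {#p, a#}#}) = {}" using assms(4-) by auto
  ultimately have "passes (L + M + {#AC {#p, a#}#} + N + {#AC {#q, b#}#}) []" by (rule passes_ConsD[OF _ assms(3)])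
  then show ?thesis by (simp add: add_ac add_mset_commute)
qed

lemma passes2I:
  assumes "\<And>M a N b. (M, a) \<in> P \<Longrightarrow> (N, b) \<in> Q \<Longrightarrow> pos M \<inter> pos L = {} \<Longrightarrow> pos N \<inter> pos L = {} \<Longrightarrow>
    pos N \<inter> pos M = {} \<Longrightarrow> win (L + M + N + {#AC {#p, a#}, AC {#q, b#}#})"
  shows "passes L [(p, P), (q, Q)]"
proof -
  have "win (L + M + {#AC {#p, a#}#} + N + {#AC {#q, b#}#})"
    if "(M, a) \<in> P" "pos M \<inter> pos L = {}" "(N, b) \<in> Q" "pos N \<inter> pos (L + M + {#AC {#p, a#}#}) = {}" for M a N b
  proof -
    have "pos N \<inter> pos L = {}" "pos N \<inter> pos M = {}" using that(4) by auto
    from assms[OF that(1,3,2) this] show ?thesis by (simp add: add_ac add_mset_commute)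
  qed
  then show ?thesis unfolding passes.simps by blast
qed

lemma passes1I:
  assumes "\<And>M a. (M, a) \<in> P \<Longrightarrow> pos M \<inter> pos L = {} \<Longrightarrow> win (L + M + {#AC {#p, a#}#})"
  shows "passes L [(p, P)]"
  using assms unfolding passes.simps by blast

lemma passes1D: "passes L [(p, P)] \<Longrightarrow> (M, a) \<in> P \<Longrightarrow> pos M \<inter> pos L = {} \<Longrightarrow> win (L + M + {#AC {#p, a#}#})"
  using passes_ConsD by (metis passes.simps(1))

lemma anet_plus: "anet L C \<Longrightarrow> anet M D \<Longrightarrow> pos L \<inter> pos M = {} \<Longrightarrow> anet (L + M) (C + D)"
  using anet_cuts[of L "[]" C M "[]" D] by simp

lemma anet_AP: "anet L (add_mset p (add_mset q C)) \<Longrightarrow> r \<notin> pos L \<Longrightarrow> anet (L + {#AP p q r#}) (add_mset r C)"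
  and anet_AT: "anet L (add_mset p (add_mset q C)) \<Longrightarrow> r \<notin> pos L \<Longrightarrow> anet (L + {#AT p q r#}) (add_mset r C)"
proof -
  assume a: "anet L (add_mset p (add_mset q C))" and r: "r \<notin> pos L"
  have "p \<in> pos L" "q \<in> pos L" using anet_concl_subset[OF a] by auto
  then have "p \<noteq> r" "q \<noteq> r" using r by auto
  then show "anet (L + {#AP p q r#}) (add_mset r C)" "anet (L + {#AT p q r#}) (add_mset r C)"
    using a r by (auto simp: anet_def wf_link_def pos_def add_mset_commute)
qed

lemma closed_cut1:
  assumes "anet L {#p#}" "anet M {#q#}" "pos L \<inter> pos M = {}"
  shows "closed (L + M + {#AC {#p, q#}#})"
  using anet_cuts[of L "[p]" "{#}" M "[q]" "{#}"] assms by (simp add: anet_closed)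

text \<open>Opponents that close successfully with a bare daimon. When the daimon is on both sides,
  a type and its orthogonal both consist of such nets.\<close>

definition tame :: "behaviour \<Rightarrow> bool" where
  "tame P \<longleftrightarrow> behaved P \<and> (\<forall>(M, q)\<in>P. \<forall>x. x \<notin> pos M \<longrightarrow> win (M + {#AD {#x#}, AC {#x, q#}#}))"

lemma unary_tame_orth: "unary A \<Longrightarrow> tame (points (orth A))"
proof -
  assume A: "unary A"
  have "win (M + {#AD {#x#}, AC {#x, q#}#})" if "(M, q) \<in> points (orth A)" "x \<notin> pos M" for M q x
  proof -
    have "passes M [(q, points A)]" using unary_points_orth[OF A] that(1) by blast
    from passes1D[OF this unary_daimon[OF A, of x]] show ?thesis using that(2) by (simp add: add_mset_commute)
  qed
  then show ?thesis using unary_behaved[OF unary_orth[OF A]] unfolding tame_def by blast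
qed

lemma unary_tame: "unary A \<Longrightarrow> tame (points A)"
  using unary_tame_orth[OF unary_orth] by (simp add: unary_def)

text \<open>A tame opponent cut against a one-output daimon is a winning net of its own, so
  \<open>win_extend\<close> attaches it to the large daimon; the opponents are absorbed one by
  one.\<close>

lemma passes_daimon_aux:
  assumes "win (C + {#AD ds#})" "\<forall>(p, P)\<in>set G. tame P" "distinct (map fst G)"
    "pos (C + {#AD ds#}) \<inter> set (map fst G) = {}"
  shows "passes (C + {#AD (ds + mset (map fst G))#}) G"
  using assms
proof (induction G arbitrary: C ds)
  case (Cons x G)
  obtain p P where x: "x = (p, P)" by fastforce
  have "passes (C + {#AD (ds + mset (map fst (x # G)))#} + M + {#AC {#p, q#}#}) G"
    if M: "(M, q) \<in> P" "pos M \<inter> pos (C + {#AD (ds + mset (map fst (x # G)))#}) = {}" for M q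
  proof -
    have t: "tame P" using Cons.prems(2) x by auto
    have pM: "p \<notin> pos M" using M(2) by (auto simp: x)
    then have "win (M + {#AD {#p#}, AC {#p, q#}#})" using t M(1) by (auto simp: tame_def)
    then have w: "win ((M + {#AC {#p, q#}#}) + {#AD {#p#}#})" by (simp add: add_mset_commute)
    have q: "q \<in> pos M" using t M(1) behaved_mem by (auto simp: tame_def)
    have "win (C + (M + {#AC {#p, q#}#}) + {#AD (ds + {#p#})#})"
      by (rule win_extend[OF Cons.prems(1) w]) (use M(2) q Cons.prems(4) in \<open>auto simp: x\<close>)
    then have "passes ((C + (M + {#AC {#p, q#}#})) + {#AD (ds + {#p#} + mset (map fst G))#}) G"
      by (rule Cons.IH) (use Cons.prems M(2) q in \<open>auto simp: x\<close>)
    then show ?thesis by (simp add: x add_ac add_mset_commute)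
  qed
  then show ?case unfolding x passes.simps by blast
qed simp

lemma passes_daimon:
  "\<forall>(p, P)\<in>set G. tame P \<Longrightarrow> distinct (map fst G) \<Longrightarrow> passes {#AD (mset (map fst G))#} G"
  using passes_daimon_aux[of "{#}" "{#}" G] win_base by simp

section \<open>Par and tensor of types\<close>

text \<open>Naming the generators before closure lets orthogonality to the type be checked on them
  alone.\<close>

definition par_gen :: "net set \<Rightarrow> net set \<Rightarrow> net set" where
  "par_gen A B = {Net (links S + {#Par s1 s2 p#}) (p # ss) | S s1 s2 ss p.
     S \<in> type_seq A B \<and> concl S = s1 # s2 # ss \<and> p \<notin> positions (links S)}"

definition parallel_gen :: "net set \<Rightarrow> net set \<Rightarrow> net set" where
  "parallel_gen A B = {parallel S T | S T. S \<in> A \<and> T \<in> B}"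

definition tens_gen :: "net set \<Rightarrow> net set \<Rightarrow> net set" where
  "tens_gen A B = {Net (links S + {#Tensor s1 s2 p#}) (p # ss) | S s1 s2 ss p.
     S \<in> type_parallel A B \<and> concl S = s1 # s2 # ss \<and> p \<notin> positions (links S)}"

lemma type_par_gen: "type_par A B = orth (orth (par_gen A B))"
  by (simp add: type_par_def par_gen_def)

lemma type_tensor_gen: "type_tensor A B = orth (orth (tens_gen A B))"
  by (simp add: type_tensor_def tens_gen_def)

lemma type_parallel_gen: "type_parallel A B = orth (orth (parallel_gen A B))"
  by (simp add: type_parallel_def parallel_gen_def)

lemma type_seq_two:
  assumes "unary A" "unary B"
  shows "S \<in> type_seq A B \<longleftrightarrow> passing_net [points (orth A), points (orth B)] S"
  by (rule type_seq_passing_net) (use assms passing_net_single unary_behaved unary_orth in auto)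

lemma passing_net2:
  "passing_net [P, Q] S \<longleftrightarrow> (\<exists>s1 s2. concl S = [s1, s2] \<and> anet (alinks (links S)) {#s1, s2#} \<and>
     passes (alinks (links S)) [(s1, P), (s2, Q)])"
  unfolding passing_net_def is_net_anet
  by (cases "concl S"; cases "tl (concl S)") auto

lemma points_mem:
  assumes "\<And>R. R \<in> A \<Longrightarrow> is_net R" "(alinks (links S), c) \<in> points (orth A)" "concl S = [c]"
  shows "S \<in> orth A"
proof -
  obtain T where T: "T \<in> orth A" "alinks (links S) = alinks (links T)" "concl T = [c]"
    using assms(2) by (rule pointsE)
  show ?thesis by (rule orth_cong[OF assms(1) T(1), of id]) (use T assms in \<open>simp_all add: rn_id\<close>)
qed

lemma fresh_pair: "finite (X :: nat set) \<Longrightarrow> \<exists>p q. p \<notin> X \<and> q \<notin> X \<and> p \<noteq> q"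
  by (metis ex_new_if_finite finite_insert infinite_UNIV_nat insertCI)

context
  fixes A B :: "net set"
  assumes A: "unary A" and B: "unary B"
begin

lemma par_genD:
  assumes "U \<in> par_gen A B"
  obtains L s1 s2 p where "alinks (links U) = L + {#AP s1 s2 p#}" "concl U = [p]" "anet L {#s1, s2#}"
    "p \<notin> pos L" "passes L [(s1, points (orth A)), (s2, points (orth B))]"
proof -
  obtain S s1 s2 ss p where U: "U = Net (links S + {#Par s1 s2 p#}) (p # ss)"
    and S: "S \<in> type_seq A B" "concl S = s1 # s2 # ss" "p \<notin> positions (links S)"
    using assms by (auto simp: par_gen_def)
  show thesis
    by (rule that[of "alinks (links S)" s1 s2 p])
      (use S type_seq_two[OF A B] in \<open>auto simp: U passing_net2\<close>)
qed

lemma par_genI: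
  assumes "anet L {#s1, s2#}" "p \<notin> pos L" "passes L [(s1, points (orth A)), (s2, points (orth B))]"
  shows "(L + {#AP s1 s2 p#}, p) \<in> points (par_gen A B)"
proof -
  obtain S where S: "is_net S" "alinks (links S) = L" "concl S = [s1, s2]"
    using net_surj[of L "[s1, s2]"] assms(1) by auto
  have "S \<in> type_seq A B" unfolding type_seq_two[OF A B] passing_net2 using S assms by auto
  then have "Net (links S + {#Par s1 s2 p#}) [p] \<in> par_gen A B"
    unfolding par_gen_def using S assms(2) pos_alinks[of "links S"] by blast
  from pointsI[OF this, of p] show ?thesis using S by simp
qed

lemma par_gen_net: "U \<in> par_gen A B \<Longrightarrow> is_net U \<and> nconcl U = 1"
  by (erule par_genD) (use anet_AP in \<open>simp add: is_net_anet\<close>)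

lemma par_gen_behaved: "behaved (points (par_gen A B))"
proof -
  have "anet M {#q#} \<and> (\<forall>f. inj_on f (pos M) \<longrightarrow> (rn f M, f q) \<in> points (par_gen A B))"
    if m: "(M, q) \<in> points (par_gen A B)" for M q
  proof -
    obtain U where U: "U \<in> par_gen A B" "M = alinks (links U)" "concl U = [q]" using m by (rule pointsE)
    obtain L s1 s2 where L: "alinks (links U) = L + {#AP s1 s2 q#}" "anet L {#s1, s2#}"
      "q \<notin> pos L" "passes L [(s1, points (orth A)), (s2, points (orth B))]"
      using par_genD[OF U(1)] U(3) by (metis list.inject)
    have s: "s1 \<in> pos L" "s2 \<in> pos L" using anet_concl_subset[OF L(2)] by auto
    have "(rn f M, f q) \<in> points (par_gen A B)" if f: "inj_on f (pos M)" for f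
    proof -
      have fL: "inj_on f (pos L)" by (rule inj_on_subset[OF f]) (auto simp: U L simp del: pos_alinks)
      have "passes (rn f L) [(f s1, points (orth A)), (f s2, points (orth B))]"
        using passes_rn[OF fL _ _ L(4)] s A B unary_behaved unary_orth by auto
      moreover have "f q \<notin> pos (rn f L)" using f L(3) by (auto simp: U L(1) inj_on_def simp del: pos_alinks)
      moreover have "anet (rn f L) {#f s1, f s2#}" using anet_rn[OF L(2) fL] by simp
      ultimately have "(rn f L + {#AP (f s1) (f s2) (f q)#}, f q) \<in> points (par_gen A B)" by (intro par_genI)
      then show ?thesis by (simp add: U L)
    qed
    moreover have "anet M {#q#}" using anet_AP[OF L(2,3)] U L by simp
    ultimately show ?thesis by blast
  qed
  then show ?thesis unfolding behaved_def by blast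
qed

lemma points_par_genE:
  assumes "(M, p) \<in> points (par_gen A B)"
  obtains L s1 s2 where "M = L + {#AP s1 s2 p#}" "anet L {#s1, s2#}"
    "p \<notin> pos L" "passes L [(s1, points (orth A)), (s2, points (orth B))]" "anet M {#p#}"
proof -
  obtain U where U: "U \<in> par_gen A B" "M = alinks (links U)" "concl U = [p]" using assms by (rule pointsE)
  obtain L s1 s2 where L: "alinks (links U) = L + {#AP s1 s2 p#}" "anet L {#s1, s2#}"
      "p \<notin> pos L" "passes L [(s1, points (orth A)), (s2, points (orth B))]"
    using par_genD[OF U(1)] U(3) by (metis list.inject)
  show thesis using that[of L s1 s2] L U anet_AP[OF L(2,3)] by simp
qed

lemma orth_type_par: "orth (type_par A B) = orth (par_gen A B)"
  unfolding type_par_gen using orth_orth_orth par_gen_net by blast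

text \<open>The daimon meets a par by splitting into two one-output daimons, and these are
  legitimate opponents for the two premises because \<open>unary\<close> also puts the daimon into
  the orthogonals.\<close>

lemma daimon_orth_par: "daimon_net 1 \<in> orth (par_gen A B)"
proof (rule points_mem)
  have "passes {#AD {#0#}#} [(0, points (par_gen A B))]"
  proof (rule passes1I)
    fix M p assume "(M, p) \<in> points (par_gen A B)" and d: "pos M \<inter> pos {#AD {#0::nat#}#} = {}"
    then obtain L s1 s2 where M: "M = L + {#AP s1 s2 p#}" "anet L {#s1, s2#}"
      "p \<notin> pos L" "passes L [(s1, points (orth A)), (s2, points (orth B))]" "anet M {#p#}"
      by (elim points_par_genE)
    have s: "s1 \<in> pos L" "s2 \<in> pos L" using anet_concl_subset[OF M(2)] by auto
    have 0: "0 \<noteq> p" "0 \<notin> pos L" using d by (auto simp: M)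
    have "win (L + {#AD {#p#}#} + {#AD {#0#}#} + {#AC {#s1, p#}, AC {#s2, 0#}#})"
      by (rule passes2[OF M(4) unary_daimon[OF unary_orth[OF A]] unary_daimon[OF unary_orth[OF B]]])
        (use s 0 M(3) in auto)
    then have "win (L + {#AC {#p, 0#}, AP s1 s2 p, AD (add_mset 0 ({#} + {#}))#})"
      using closed_cut1[of "{#AD {#0#}#}" 0 M p] anet_daimon[of "{#0::nat#}"] M(5) d
      by (intro win_stepI[OF PD]) (simp_all add: M add_mset_commute Int_commute)
    then show "win ({#AD {#0#}#} + M + {#AC {#0, p#}#})" by (simp add: M add_mset_commute)
  qed
  then show "(alinks (links (daimon_net 1)), 0) \<in> points (orth (par_gen A B))"
    using points_orthI[OF par_gen_net _ par_gen_behaved, of "{#AD {#0#}#}" 0] anet_daimon[of "{#0::nat#}"] by simp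
qed (use par_gen_net in simp_all)

lemma par_gen_daimon:
  assumes "p \<noteq> q" "p \<noteq> r" "q \<noteq> r"
  shows "({#AD {#p, q#}#} + {#AP p q r#}, r) \<in> points (par_gen A B)"
proof -
  have "passes {#AD (mset (map fst [(p, points (orth A)), (q, points (orth B))]))#} [(p, points (orth A)), (q, points (orth B))]"
    by (rule passes_daimon) (use assms unary_tame_orth A B in auto)
  then show ?thesis by (intro par_genI) (use assms anet_daimon[of "{#p, q#}"] in auto)
qed

lemma orth_par_gen_net: "S \<in> orth (par_gen A B) \<Longrightarrow> is_net S \<and> nconcl S = 1"
proof -
  assume S: "S \<in> orth (par_gen A B)"
  obtain U where U: "U \<in> par_gen A B" using par_gen_daimon[of 0 1 2] by (auto elim: pointsE)
  then have "orthogonal S U" using S by (simp add: orth_def)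
  then show ?thesis using orthogonal_win is_net_orth[OF S] par_gen_net[OF U] by auto
qed

text \<open>A net orthogonal to all generators wins in particular against a par with a two-output
  daimon above it, and contracting that pair leaves the one-output daimon.\<close>

lemma daimon_type_par: "daimon_net 1 \<in> type_par A B"
  unfolding type_par_gen
proof (rule points_mem)
  have "passes {#AD {#0#}#} [(0, points (orth (par_gen A B)))]"
  proof (rule passes1I)
    fix M t assume M: "(M, t) \<in> points (orth (par_gen A B))" and d: "pos M \<inter> pos {#AD {#0::nat#}#} = {}"
    obtain p q where pq: "p \<notin> insert 0 (pos M)" "q \<notin> insert 0 (pos M)" "p \<noteq> q"
      using fresh_pair[of "insert 0 (pos M)"] by auto
    have a: "({#AD {#p, q#}#} + {#AP p q 0#}, 0) \<in> points (par_gen A B)" by (rule par_gen_daimon) (use pq in auto)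
    have b: "passes M [(t, points (par_gen A B))]" using points_orthD[OF _ M] par_gen_net by blast
    have "win (M + ({#AD {#p, q#}#} + {#AP p q 0#}) + {#AC {#t, 0#}#})"
      by (rule passes1D[OF b a]) (use pq d in auto)
    then have "win ((M + {#AC {#t, 0#}#}) + {#AP p q 0, AD {#p, q#}#})" by (simp add: add_mset_commute)
    from win_contract_par[OF this] show "win ({#AD {#0#}#} + M + {#AC {#0, t#}#})" by (simp add: add_mset_commute)
  qed
  then show "(alinks (links (daimon_net 1)), 0) \<in> points (orth (orth (par_gen A B)))"
    using points_orthI[of "orth (par_gen A B)" "{#AD {#0#}#}" 0] anet_daimon[of "{#0::nat#}"]
      behaved_orth[of "par_gen A B"] par_gen_net orth_par_gen_net by simp
qed (use is_net_orth in auto)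

end

context
  fixes A B :: "net set"
  assumes A: "unary A" and B: "unary B"
begin

lemma alinks_parallel: "alinks (links (parallel S T)) =
    rn (\<lambda>n. 2 * n) (alinks (links S)) + rn (\<lambda>n. 2 * n + 1) (alinks (links T))"
  "concl (parallel S T) = map (\<lambda>n. 2 * n) (concl S) @ map (\<lambda>n. 2 * n + 1) (concl T)"
  by (simp_all add: parallel_def left_copy_def right_copy_def rename_def alinks_rename)

lemma parallel_gen_net: "U \<in> parallel_gen A B \<Longrightarrow> is_net U \<and> nconcl U = 2"
proof -
  assume "U \<in> parallel_gen A B"
  then obtain S T where U: "U = parallel S T" "S \<in> A" "T \<in> B" by (auto simp: parallel_gen_def)
  note n = unary_net[OF A U(2)] unary_net[OF B U(3)]
  have "anet (rn (\<lambda>n. 2 * n) (alinks (links S)) + rn (\<lambda>n. 2 * n + 1) (alinks (links T)))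
      (image_mset (\<lambda>n. 2 * n) (mset (concl S)) + image_mset (\<lambda>n. 2 * n + 1) (mset (concl T)))"
    by (rule anet_plus, (rule anet_rn, use n in \<open>simp add: is_net_anet\<close>, simp add: inj_on_def)+)
      (unfold pos_rn, rule parity_disjoint)
  then show ?thesis using n by (simp add: U is_net_anet alinks_parallel del: pos_alinks)
qed

text \<open>Two opponents chosen separately amount to the single opponent
  \<open>parallel U V\<close>; the daimons on both sides fix the number of conclusions.\<close>

lemma orth_parallel_gen: "S \<in> orth (parallel_gen A B) \<longleftrightarrow> passing_net [points A, points B] S"
proof
  assume S: "S \<in> orth (parallel_gen A B)"
  have n: "is_net S" by (rule is_net_orth[OF S])
  have d: "daimon_net 1 \<in> A" "daimon_net 1 \<in> B" using A B by (auto simp: unary_def)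
  then have "parallel (daimon_net 1) (daimon_net 1) \<in> parallel_gen A B" unfolding parallel_gen_def by blast
  then have "orthogonal S (parallel (daimon_net 1) (daimon_net 1))" using S by (simp add: orth_def)
  then have "nconcl S = 2" using orthogonal_win[OF n] parallel_gen_net \<open>parallel _ _ \<in> _\<close> by auto
  then obtain s1 s2 where c: "concl S = [s1, s2]" by (auto simp: length_Suc_conv numeral_2_eq_2)
  have "passes (alinks (links S)) [(s1, points A), (s2, points B)]"
  proof (rule passes2I)
    fix M a N b assume M: "(M, a) \<in> points A" and N: "(N, b) \<in> points B"
      and d: "pos M \<inter> pos (alinks (links S)) = {}" "pos N \<inter> pos (alinks (links S)) = {}" "pos N \<inter> pos M = {}"
    obtain U where U: "U \<in> A" "M = alinks (links U)" "concl U = [a]" using M by (rule pointsE)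
    obtain V where V: "V \<in> B" "N = alinks (links V)" "concl V = [b]" using N by (rule pointsE)
    have P: "parallel U V \<in> parallel_gen A B" using U V by (auto simp: parallel_gen_def)
    \<comment> \<open>Halving undoes the even and the odd copy at once, and is injective because
      \<open>M\<close> and \<open>N\<close> are already disjoint.\<close>
    let ?f = "\<lambda>x::nat. x div 2"
    let ?P = "alinks (links (parallel U V))"
    have P': "?P = rn (\<lambda>n. 2 * n) M + rn (\<lambda>n. 2 * n + 1) N" by (simp add: alinks_parallel U V)
    have pP: "pos ?P = (\<lambda>n. 2 * n) ` pos M \<union> (\<lambda>n. 2 * n + 1) ` pos N" unfolding P' by simp
    have inj: "inj_on ?f (pos ?P)" unfolding pP
      by (rule inj_onI) (use d(3) in \<open>auto simp: disjoint_iff\<close>)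
    have "rn ?f ?P = rn (\<lambda>x. x) M + rn (\<lambda>x. x) N" unfolding P' rn_simps rn_comp by (simp add: comp_def)
    then have f: "rn ?f ?P = M + N" by (simp add: rn_id)
    have "?f ` pos ?P = pos M \<union> pos N" unfolding pos_rn[symmetric] f by simp
    then have "pos (alinks (links S)) \<inter> ?f ` pos ?P = {}" using d by auto
    from orthogonal_iff[OF n _ inj this] have "win (alinks (links S) + (M + N) + cuts [s1, s2] [a, b])"
      using S P parallel_gen_net[OF P] unfolding f by (simp add: orth_def c alinks_parallel U V)
    then show "win (alinks (links S) + M + N + {#AC {#s1, a#}, AC {#s2, b#}#})" by (simp add: add_ac add_mset_commute)
  qed
  then show "passing_net [points A, points B] S" using n c by (auto simp: passing_net2 is_net_anet)
next
  assume p: "passing_net [points A, points B] S"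
  then obtain s1 s2 where c: "concl S = [s1, s2]" "passes (alinks (links S)) [(s1, points A), (s2, points B)]"
    unfolding passing_net2 by blast
  have n: "is_net S" using p by (simp add: passing_net_def)
  have s: "s1 \<in> pos (alinks (links S))" using anet_concl_subset[OF n[unfolded is_net_anet]] c(1) by auto
  have "orthogonal S R" if R: "R \<in> parallel_gen A B" for R
  proof -
    obtain U V where UV: "R = parallel U V" "U \<in> A" "V \<in> B" using R by (auto simp: parallel_gen_def)
    obtain u where u: "concl U = [u]" using unary_net[OF A UV(2)] by (auto simp: length_Suc_conv)
    obtain v where v: "concl V = [v]" using unary_net[OF B UV(3)] by (auto simp: length_Suc_conv)
    obtain f :: "nat \<Rightarrow> nat" where f: "inj f" "\<And>x. f x \<notin> pos (alinks (links S))"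
      using exists_shift[OF finite_pos] by metis
    let ?g = "\<lambda>n. f (2 * n)" and ?h = "\<lambda>n. f (2 * n + 1)"
    have gh: "inj ?g" "inj ?h" by (auto intro!: injI dest!: injD[OF f(1)])
    have ghd: "?g x \<noteq> ?h y" for x y
    proof
      assume "?g x = ?h y"
      then have "2 * x = 2 * y + 1" using f(1) by (simp add: inj_eq)
      then show False by presburger
    qed
    have m1: "(rn ?g (alinks (links U)), ?g u) \<in> points A"
      using behavedD(2)[OF unary_behaved[OF A] pointsI[OF UV(2) u] inj_on_subset[OF gh(1)]] by simp
    have m2: "(rn ?h (alinks (links V)), ?h v) \<in> points B"
      using behavedD(2)[OF unary_behaved[OF B] pointsI[OF UV(3) v] inj_on_subset[OF gh(2)]] by simp
    have "win (alinks (links S) + rn ?g (alinks (links U)) + rn ?h (alinks (links V)) + {#AC {#s1, ?g u#}, AC {#s2, ?h v#}#})"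
    proof (rule passes2[OF c(2) m1 m2 s])
      show "?g u \<in> pos (rn ?g (alinks (links U)))" by (rule behaved_mem[OF unary_behaved[OF A] m1])
      show "pos (rn ?g (alinks (links U))) \<inter> pos (alinks (links S)) = {}" unfolding pos_rn
        by (rule shift_disjoint) (rule f(2))
      show "pos (rn ?h (alinks (links V))) \<inter> pos (alinks (links S)) = {}" unfolding pos_rn
        by (rule shift_disjoint) (rule f(2))
      show "pos (rn ?h (alinks (links V))) \<inter> pos (rn ?g (alinks (links U))) = {}" unfolding pos_rn
        using ghd by (intro equals0I) (elim IntE imageE, metis)
    qed
    moreover have "rn f (alinks (links R)) = rn ?g (alinks (links U)) + rn ?h (alinks (links V))"
      by (simp add: UV alinks_parallel rn_comp comp_def)
    moreover have "map f (concl R) = [?g u, ?h v]" by (simp add: UV alinks_parallel u v)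
    ultimately have "win (alinks (links S) + rn f (alinks (links R)) + cuts (concl S) (map f (concl R)))"
      by (simp add: c add_ac add_mset_commute)
    moreover have "pos (alinks (links S)) \<inter> f ` pos (alinks (links R)) = {}" by (rule shift_disjoint) (rule f(2))
    moreover have "inj_on f (pos (alinks (links R)))" by (rule inj_on_subset[OF f(1)]) simp
    ultimately show ?thesis using orthogonal_iff[OF n] parallel_gen_net[OF R] c by simp
  qed
  then show "S \<in> orth (parallel_gen A B)" using n by (simp add: orth_def)
qed

text \<open>The two-output daimon is orthogonal to the type and so fixes the number of conclusions
  of its members.\<close>

lemma parallel_net:
  assumes S: "S \<in> type_parallel A B"
  shows "is_net S \<and> nconcl S = 2"
proof -
  have n: "is_net S" using S by (simp add: type_parallel_gen is_net_orth)
  have "passes {#AD (mset (map fst [(0::nat, points A), (1, points B)]))#} [(0, points A), (1, points B)]"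
    by (rule passes_daimon) (use unary_tame A B in auto)
  then have "passing_net [points A, points B] (daimon_net 2)"
    unfolding passing_net2 using anet_daimon[of "{#0::nat, 1#}"] by (intro exI[of _ 0] exI[of _ 1]) (simp add: upt_rec)
  then have "daimon_net 2 \<in> orth (parallel_gen A B)" using orth_parallel_gen by blast
  then have "orthogonal S (daimon_net 2)" using S by (simp add: type_parallel_gen orth_def)
  then show ?thesis using orthogonal_win[OF n is_net_daimon_net[of 2]] n by simp
qed

lemma type_parallelD:
  assumes S: "S \<in> type_parallel A B" and c: "concl S = [s1, s2]"
    and K: "anet K {#k1, k2#}" "passes K [(k1, points A), (k2, points B)]" "pos K \<inter> pos (alinks (links S)) = {}"
  shows "win (alinks (links S) + K + {#AC {#s1, k1#}, AC {#s2, k2#}#})"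
proof -
  obtain W where W: "is_net W" "alinks (links W) = K" "concl W = [k1, k2]"
    using net_surj[of K "[k1, k2]"] K(1) by auto
  have "W \<in> orth (parallel_gen A B)" unfolding orth_parallel_gen passing_net2 using W K by auto
  then have "orthogonal S W" using S by (simp add: type_parallel_gen orth_def)
  then have "win (alinks (links S) + alinks (links W) + cuts (concl S) (concl W))"
    using orthogonal_disjoint[of S W] W(1) parallel_net[OF S] K(3) W(2) by (simp add: Int_commute del: pos_alinks)
  then show ?thesis by (simp add: W c add_mset_commute)
qed

lemma type_parallelI:
  assumes L: "(L, a) \<in> points A" and M: "(M, b) \<in> points B" and d: "pos L \<inter> pos M = {}"
  obtains S where "S \<in> type_parallel A B" "alinks (links S) = L + M" "concl S = [a, b]"
proof -
  have an: "anet (L + M) ({#a#} + {#b#})"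
    by (rule anet_plus[OF behavedD(1)[OF unary_behaved[OF A] L] behavedD(1)[OF unary_behaved[OF B] M] d])
  then obtain S where S: "is_net S" "alinks (links S) = L + M" "concl S = [a, b]"
    using net_surj[of "L + M" "[a, b]"] by (auto simp: add_mset_commute)
  have "orthogonal S W" if W: "W \<in> orth (parallel_gen A B)" for W
  proof -
    have n: "is_net W" by (rule is_net_orth[OF W])
    obtain w1 w2 where w: "concl W = [w1, w2]" "passes (alinks (links W)) [(w1, points A), (w2, points B)]"
      using W unfolding orth_parallel_gen passing_net2 by blast
    obtain f :: "nat \<Rightarrow> nat" where f: "inj f" "\<And>x. f x \<notin> pos (L + M)"
      using exists_shift[OF finite_pos] by metis
    have fi: "inj_on f (pos (alinks (links W)))" by (rule inj_on_subset[OF f(1)]) simp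
    have ws: "w1 \<in> pos (alinks (links W))" "w2 \<in> pos (alinks (links W))"
      using anet_concl_subset[OF n[unfolded is_net_anet]] w(1) by auto
    have fd: "f ` pos (alinks (links W)) \<inter> pos (L + M) = {}" by (rule shift_disjoint) (rule f(2))
    have "passes (rn f (alinks (links W))) [(f w1, points A), (f w2, points B)]"
      using passes_rn[OF fi _ _ w(2)] ws unary_behaved A B by auto
    then have "win (rn f (alinks (links W)) + L + M + {#AC {#f w1, a#}, AC {#f w2, b#}#})"
      by (rule passes2[OF _ L M])
        (use fd d ws behaved_mem[OF unary_behaved[OF A] L] in \<open>auto simp del: pos_alinks\<close>)
    then have "win (L + M + rn f (alinks (links W)) + cuts [a, b] [f w1, f w2])" by (simp add: add_ac add_mset_commute)
    then show ?thesis using orthogonal_iff[OF S(1) n fi] fd unfolding S(2,3) w(1) by (simp add: Int_commute del: pos_alinks)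
  qed
  then have "S \<in> type_parallel A B" using S by (simp add: type_parallel_gen orth_def)
  then show thesis using that S by blast
qed

text \<open>A member of a biorthogonal closure need not be a juxtaposition of two nets. What is
  known about it is success against every \<open>K\<close> that passes both families, and this is
  what is extracted.\<close>

lemma tens_genD:
  assumes "(M, p) \<in> points (tens_gen A B)"
  obtains L s1 s2 where "M = L + {#AT s1 s2 p#}" "anet L {#s1, s2#}" "p \<notin> pos L" "anet M {#p#}"
    "\<And>K k1 k2. anet K {#k1, k2#} \<Longrightarrow> passes K [(k1, points A), (k2, points B)] \<Longrightarrow> pos K \<inter> pos L = {} \<Longrightarrow>
       win (L + K + {#AC {#s1, k1#}, AC {#s2, k2#}#})"
proof -
  obtain U where U: "U \<in> tens_gen A B" "M = alinks (links U)" "concl U = [p]" using assms by (rule pointsE)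
  then obtain S s1 s2 where S: "U = Net (links S + {#Tensor s1 s2 p#}) [p]"
    "S \<in> type_parallel A B" "concl S = [s1, s2]" "p \<notin> positions (links S)"
    by (auto simp: tens_gen_def)
  have an: "anet (alinks (links S)) {#s1, s2#}" using parallel_net[OF S(2)] by (simp add: is_net_anet S(3))
  have pp: "p \<notin> pos (alinks (links S))" using S by simp
  show thesis
    by (rule that[OF _ an pp _ type_parallelD[OF S(2,3)]]) (use S U anet_AT[OF an pp] in simp_all)
qed

lemma tens_genI:
  assumes S: "S \<in> type_parallel A B" "concl S = [s1, s2]" "alinks (links S) = L" "p \<notin> pos L"
  shows "(L + {#AT s1 s2 p#}, p) \<in> points (tens_gen A B)"
proof -
  have "Net (links S + {#Tensor s1 s2 p#}) [p] \<in> tens_gen A B"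
    unfolding tens_gen_def using S pos_alinks[of "links S"] by blast
  from pointsI[OF this, of p] show ?thesis using S by simp
qed

lemma tens_gen_net: "U \<in> tens_gen A B \<Longrightarrow> is_net U \<and> nconcl U = 1"
proof -
  assume U: "U \<in> tens_gen A B"
  then obtain S s1 s2 ss p where S: "U = Net (links S + {#Tensor s1 s2 p#}) (p # ss)"
    "S \<in> type_parallel A B" "concl S = s1 # s2 # ss" "p \<notin> positions (links S)"
    by (auto simp: tens_gen_def)
  then have c: "concl U = [p]" using parallel_net[OF S(2)] by simp
  have "anet (alinks (links U)) {#p#}" by (rule tens_genD[OF pointsI[OF U c]])
  then show ?thesis using c by (simp add: is_net_anet)
qed

lemma tens_gen_behaved: "behaved (points (tens_gen A B))"
proof -
  have "(rn f M, f q) \<in> points (tens_gen A B)"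
    if m: "(M, q) \<in> points (tens_gen A B)" and f: "inj_on f (pos M)" for M q f
  proof -
    obtain U where U: "U \<in> tens_gen A B" "M = alinks (links U)" "concl U = [q]" using m by (rule pointsE)
    then obtain S s1 s2 where S: "U = Net (links S + {#Tensor s1 s2 q#}) [q]"
      "S \<in> type_parallel A B" "concl S = [s1, s2]" "q \<notin> positions (links S)"
      by (auto simp: tens_gen_def)
    let ?L = "alinks (links S)"
    have fL: "inj_on f (pos ?L)" by (rule inj_on_subset[OF f]) (use U S in auto)
    have "anet (rn f ?L) (mset [f s1, f s2])"
      using anet_rn[OF _ fL, of "mset (concl S)"] parallel_net[OF S(2)] by (simp add: is_net_anet S(3))
    then obtain S' where S': "is_net S'" "alinks (links S') = rn f ?L" "concl S' = [f s1, f s2]" by (rule net_surj)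
    have "S' \<in> type_parallel A B" unfolding type_parallel_gen
      by (rule orth_cong[of _ S f]) (use S S' fL is_net_orth in \<open>simp_all add: type_parallel_gen\<close>)
    moreover have "f q \<notin> pos (rn f ?L)"
      using f S(4) by (auto simp: U S(1) inj_on_def)
    ultimately have "(rn f ?L + {#AT (f s1) (f s2) (f q)#}, f q) \<in> points (tens_gen A B)"
      using S' by (intro tens_genI)
    then show ?thesis by (simp add: U S)
  qed
  moreover have "anet M {#q#}" if "(M, q) \<in> points (tens_gen A B)" for M q using that by (rule tens_genD)
  ultimately show ?thesis unfolding behaved_def by blast
qed

lemma orth_type_tensor: "orth (type_tensor A B) = orth (tens_gen A B)"
  unfolding type_tensor_gen using orth_orth_orth tens_gen_net by blast

text \<open>Against a tensor the daimon gains a second output, and a two-output daimon passes all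
  opponents in \<open>A\<close> and \<open>B\<close>.\<close>

lemma daimon_orth_tensor: "daimon_net 1 \<in> orth (tens_gen A B)"
proof (rule points_mem)
  have "passes {#AD {#0#}#} [(0, points (tens_gen A B))]"
  proof (rule passes1I)
    fix M p assume "(M, p) \<in> points (tens_gen A B)" and d: "pos M \<inter> pos {#AD {#0::nat#}#} = {}"
    then obtain L s1 s2 where M: "M = L + {#AT s1 s2 p#}" "anet L {#s1, s2#}" "p \<notin> pos L" "anet M {#p#}"
      and w: "\<And>K k1 k2. anet K {#k1, k2#} \<Longrightarrow> passes K [(k1, points A), (k2, points B)] \<Longrightarrow> pos K \<inter> pos L = {} \<Longrightarrow>
       win (L + K + {#AC {#s1, k1#}, AC {#s2, k2#}#})"
      by (elim tens_genD) blast
    have 0: "0 \<noteq> p" "0 \<notin> pos L" using d by (auto simp: M)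
    have "passes {#AD (mset (map fst [(p, points A), (0, points B)]))#} [(p, points A), (0, points B)]"
      by (rule passes_daimon) (use 0 unary_tame A B in auto)
    then have "win (L + {#AD {#p, 0#}#} + {#AC {#s1, p#}, AC {#s2, 0#}#})"
      by (intro w) (use 0 M(3) anet_daimon[of "{#p, 0#}"] in auto)
    then have "win (L + {#AC {#p, 0#}, AT s1 s2 p, AD (add_mset 0 {#})#})"
      using closed_cut1[of "{#AD {#0#}#}" 0 M p] anet_daimon[of "{#0::nat#}"] M(4) d
      by (intro win_stepI[OF TD]) (simp_all add: M add_mset_commute Int_commute)
    then show "win ({#AD {#0#}#} + M + {#AC {#0, p#}#})" by (simp add: M add_mset_commute)
  qed
  then show "(alinks (links (daimon_net 1)), 0) \<in> points (orth (tens_gen A B))"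
    using points_orthI[OF tens_gen_net _ tens_gen_behaved, of "{#AD {#0#}#}" 0] anet_daimon[of "{#0::nat#}"] by simp
qed (use tens_gen_net in simp_all)

lemma tens_gen_daimons:
  assumes "p \<noteq> q" "p \<noteq> r" "q \<noteq> r"
  shows "({#AD {#p#}, AD {#q#}#} + {#AT p q r#}, r) \<in> points (tens_gen A B)"
proof -
  obtain S where S: "S \<in> type_parallel A B" "alinks (links S) = {#AD {#p#}#} + {#AD {#q#}#}" "concl S = [p, q]"
    by (rule type_parallelI[OF unary_daimon[OF A] unary_daimon[OF B], of p q]) (use assms in auto)
  show ?thesis by (rule tens_genI[OF S(1,3)]) (use S assms in \<open>auto simp: add_mset_commute\<close>)
qed

lemma orth_tens_gen_net: "S \<in> orth (tens_gen A B) \<Longrightarrow> is_net S \<and> nconcl S = 1"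
proof -
  assume S: "S \<in> orth (tens_gen A B)"
  obtain U where U: "U \<in> tens_gen A B" using tens_gen_daimons[of 0 1 2] by (auto elim: pointsE)
  then have "orthogonal S U" using S by (simp add: orth_def)
  then show ?thesis using orthogonal_win is_net_orth[OF S] tens_gen_net[OF U] by auto
qed

text \<open>Same scheme as for par: the generator to be contracted is the tensor of two one-output
  daimons.\<close>

lemma daimon_type_tensor: "daimon_net 1 \<in> type_tensor A B"
  unfolding type_tensor_gen
proof (rule points_mem)
  have "passes {#AD {#0#}#} [(0, points (orth (tens_gen A B)))]"
  proof (rule passes1I)
    fix M t assume M: "(M, t) \<in> points (orth (tens_gen A B))" and d: "pos M \<inter> pos {#AD {#0::nat#}#} = {}"
    obtain p q where pq: "p \<notin> insert 0 (pos M)" "q \<notin> insert 0 (pos M)" "p \<noteq> q"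
      using fresh_pair[of "insert 0 (pos M)"] by auto
    have a: "({#AD {#p#}, AD {#q#}#} + {#AT p q 0#}, 0) \<in> points (tens_gen A B)" by (rule tens_gen_daimons) (use pq in auto)
    have b: "passes M [(t, points (tens_gen A B))]" using points_orthD[OF _ M] tens_gen_net by blast
    have "win (M + ({#AD {#p#}, AD {#q#}#} + {#AT p q 0#}) + {#AC {#t, 0#}#})"
      by (rule passes1D[OF b a]) (use pq d in auto)
    then have "win ((M + {#AC {#t, 0#}#}) + {#AT p q 0, AD {#p#}, AD {#q#}#})" by (simp add: add_mset_commute)
    from win_contract_tensor[OF this] show "win ({#AD {#0#}#} + M + {#AC {#0, t#}#})" by (simp add: add_mset_commute)
  qed
  then show "(alinks (links (daimon_net 1)), 0) \<in> points (orth (orth (tens_gen A B)))"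
    using points_orthI[of "orth (tens_gen A B)" "{#AD {#0#}#}" 0] anet_daimon[of "{#0::nat#}"]
      behaved_orth[of "tens_gen A B"] tens_gen_net orth_tens_gen_net by simp
qed (use is_net_orth in auto)

text \<open>One tensor-par step reduces the interaction to that between \<open>L\<close> and the net
  above the tensor, where the property extracted by \<open>tens_genD\<close> applies.\<close>

lemma par_tests_tensor:
  assumes L: "anet L {#p, q#}" "passes L [(p, points A), (q, points B)]" "r \<notin> pos L"
  shows "(L + {#AP p q r#}, r) \<in> points (orth (tens_gen A B))"
proof (rule points_orthI[OF tens_gen_net _ tens_gen_behaved])
  show an: "anet (L + {#AP p q r#}) {#r#}" by (rule anet_AP[OF L(1,3)])
  show "passes (L + {#AP p q r#}) [(r, points (tens_gen A B))]"
  proof (rule passes1I)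
    fix M s assume "(M, s) \<in> points (tens_gen A B)" and d: "pos M \<inter> pos (L + {#AP p q r#}) = {}"
    then obtain K s1 s2 where M: "M = K + {#AT s1 s2 s#}" "anet M {#s#}"
      and w: "\<And>K' k1 k2. anet K' {#k1, k2#} \<Longrightarrow> passes K' [(k1, points A), (k2, points B)] \<Longrightarrow> pos K' \<inter> pos K = {} \<Longrightarrow>
       win (K + K' + {#AC {#s1, k1#}, AC {#s2, k2#}#})"
      by (elim tens_genD) blast
    have "win (K + L + {#AC {#s1, p#}, AC {#s2, q#}#})" by (rule w[OF L(1,2)]) (use d in \<open>auto simp: M\<close>)
    then have "win ((K + L) + {#AC {#s, r#}, AT s1 s2 s, AP p q r#})"
      by (intro win_stepI[OF TP])
        (use closed_cut1[OF an M(2)] d in \<open>simp_all add: M add_ac add_mset_commute Int_commute\<close>)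
    then show "win (L + {#AP p q r#} + M + {#AC {#r, s#}#})" by (simp add: M add_ac add_mset_commute)
  qed
qed

text \<open>On the tensor side a juxtaposition suffices, since the net above the par of a generator
  passes opponents chosen separately.\<close>

lemma tensor_tests_par:
  assumes L: "(L, p) \<in> points (orth A)" and N: "(N, q) \<in> points (orth B)" and d: "pos L \<inter> pos N = {}"
    and r: "r \<notin> pos L \<union> pos N"
  shows "(L + N + {#AT p q r#}, r) \<in> points (orth (par_gen A B))"
proof (rule points_orthI[OF par_gen_net[OF A B] _ par_gen_behaved[OF A B]])
  note bA = unary_behaved[OF unary_orth[OF A]] and bB = unary_behaved[OF unary_orth[OF B]]
  have "anet (L + N) ({#p#} + {#q#})" by (rule anet_plus[OF behavedD(1)[OF bA L] behavedD(1)[OF bB N] d])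
  then show an: "anet (L + N + {#AT p q r#}) {#r#}" by (intro anet_AT) (use r in \<open>auto simp: add_mset_commute\<close>)
  show "passes (L + N + {#AT p q r#}) [(r, points (par_gen A B))]"
  proof (rule passes1I)
    fix M s assume "(M, s) \<in> points (par_gen A B)" and dM: "pos M \<inter> pos (L + N + {#AT p q r#}) = {}"
    then obtain K s1 s2 where M: "M = K + {#AP s1 s2 s#}" "anet K {#s1, s2#}" "anet M {#s#}"
      and w: "passes K [(s1, points (orth A)), (s2, points (orth B))]"
      by (elim points_par_genE[OF A B]) blast
    have s1: "s1 \<in> pos K" using anet_concl_subset[OF M(2)] by auto
    have "win (K + L + N + {#AC {#s1, p#}, AC {#s2, q#}#})"
      by (rule passes2[OF w L N s1 behaved_mem[OF bA L]]) (use d dM in \<open>auto simp: M\<close>)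
    then have "win ((K + L + N) + {#AC {#r, s#}, AT p q r, AP s1 s2 s#})"
      by (intro win_stepI[OF TP])
        (use closed_cut1[OF an M(3)] dM in \<open>simp_all add: M add_ac add_mset_commute Int_commute\<close>)
    then show "win (L + N + {#AT p q r#} + M + {#AC {#r, s#}#})" by (simp add: M add_ac add_mset_commute)
  qed
qed

lemma unary_type_par: "unary (type_par A B)"
  using daimon_type_par[OF A B] daimon_orth_par[OF A B] orth_type_par[OF A B]
  by (simp add: unary_def) (simp add: type_par_gen)

lemma unary_type_tensor: "unary (type_tensor A B)"
  using daimon_type_tensor daimon_orth_tensor orth_type_tensor
  by (simp add: unary_def) (simp add: type_tensor_gen)

end

section \<open>Soundness\<close>

lemma points_mono: "A \<subseteq> B \<Longrightarrow> points A \<subseteq> points B"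
  by (auto simp: points_def)

text \<open>The inclusions in the orthogonals shrink the families of opponents, so the net above the
  par still passes and serves as a test of the tensor.\<close>

lemma par_gen_orth_tens_gen:
  assumes "unary A" "unary B" "unary A'" "unary B'" "A' \<subseteq> orth A" "B' \<subseteq> orth B"
  shows "par_gen A B \<subseteq> orth (tens_gen A' B')"
proof
  fix U assume "U \<in> par_gen A B"
  then obtain L s1 s2 p where U: "alinks (links U) = L + {#AP s1 s2 p#}" "concl U = [p]" "anet L {#s1, s2#}"
    "p \<notin> pos L" "passes L [(s1, points (orth A)), (s2, points (orth B))]"
    by (rule par_genD[OF assms(1,2)])
  have "passes L [(s1, points A'), (s2, points B')]"
    by (rule passes_mono[OF _ U(5)]) (use assms points_mono in auto)
  from par_tests_tensor[OF assms(3,4) U(3) this U(4)]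
  show "U \<in> orth (tens_gen A' B')"
    using points_mem[of "tens_gen A' B'" U p] tens_gen_net[OF assms(3,4)] U by simp
qed

context
  fixes dual :: "'v \<Rightarrow> 'v" and \<B> :: "'v \<Rightarrow> net set"
  assumes basis: "is_basis dual \<B>" and appr: "approximable \<B>"
begin

lemma unary_interp: "unary (interp \<B> A)"
proof (induction A)
  case (Var X)
  \<comment> \<open>The daimon lies in the type of the dual variable, and a basis puts that type
    inside the orthogonal.\<close>
  have "daimon_net 1 \<in> orth (\<B> X)" using basis appr unfolding is_basis_def approximable_def by blast
  then show ?case using basis appr by (simp add: unary_def is_basis_def is_type_def approximable_def)
qed (simp_all add: unary_type_par unary_type_tensor)

text \<open>Only an inclusion is available, since a basis gives no more for variables. In the tensor
  case the induction hypotheses are first reversed by taking orthogonals.\<close>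

lemma interp_neg: "interp \<B> (neg dual A) \<subseteq> orth (interp \<B> A)"
proof (induction A)
  case (Var X) then show ?case using basis by (simp add: is_basis_def)
next
  case (ParF A B)
  let ?A = "interp \<B> A" and ?B = "interp \<B> B" and ?A' = "interp \<B> (neg dual A)" and ?B' = "interp \<B> (neg dual B)"
  have "par_gen ?A ?B \<subseteq> orth (tens_gen ?A' ?B')"
    using par_gen_orth_tens_gen unary_interp ParF by blast
  then have "orth (orth (tens_gen ?A' ?B')) \<subseteq> orth (par_gen ?A ?B)" by (rule orth_antimono)
  then show ?case by (simp add: type_tensor_gen orth_type_par unary_interp)
next
  case (TensorF A B)
  let ?A = "interp \<B> A" and ?B = "interp \<B> B" and ?A' = "interp \<B> (neg dual A)" and ?B' = "interp \<B> (neg dual B)"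
  have "?A \<subseteq> orth ?A'" "?B \<subseteq> orth ?B'"
    using TensorF orth_antimono unary_interp unfolding unary_def by metis+
  then have "par_gen ?A' ?B' \<subseteq> orth (tens_gen ?A ?B)"
    using par_gen_orth_tens_gen unary_interp by blast
  then have "orth (orth (par_gen ?A' ?B')) \<subseteq> orth (orth (orth (tens_gen ?A ?B)))" by (intro orth_antimono)
  also have "\<dots> = orth (tens_gen ?A ?B)" using orth_orth_orth tens_gen_net unary_interp by metis
  finally show ?case by (simp add: type_par_gen orth_type_tensor unary_interp)
qed

abbreviation opponents :: "'v form \<Rightarrow> behaviour" where
  "opponents A \<equiv> points (orth (interp \<B> A))"

lemma tame_opponents: "tame (opponents A)"
  using unary_tame_orth unary_interp by blast

lemma behaved_opponents: "behaved (opponents A)"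
  using tame_opponents by (simp add: tame_def)

lemma behaved_zip: "\<forall>(p, P)\<in>set (zip cs (map opponents \<Gamma>)). behaved P"
  using behaved_opponents by (auto dest!: set_zip_rightD)

lemma passes_par:
  assumes "anet L {#p, q#}" "passes L [(p, opponents A), (q, opponents B)]" "r \<notin> pos L"
  shows "passes (L + {#AP p q r#}) [(r, opponents (ParF A B))]"
proof -
  note u = unary_interp[of A] unary_interp[of B]
  have "(L + {#AP p q r#}, r) \<in> points (par_gen (interp \<B> A) (interp \<B> B))"
    by (rule par_genI[OF u assms(1,3,2)])
  moreover have "par_gen (interp \<B> A) (interp \<B> B) \<subseteq> interp \<B> (ParF A B)"
    unfolding interp.simps type_par_gen using orth_orth_incl par_gen_net[OF u] by blast
  ultimately have "(L + {#AP p q r#}, r) \<in> points (interp \<B> (ParF A B))" using points_mono by blast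
  then show ?thesis using unary_points[OF unary_interp] by blast
qed

lemma passes_tensor:
  assumes "anet L {#p#}" "passes L [(p, opponents A)]" "anet M {#q#}" "passes M [(q, opponents B)]"
    "pos L \<inter> pos M = {}" "r \<notin> pos L \<union> pos M"
  shows "passes (L + M + {#AT p q r#}) [(r, opponents (TensorF A B))]"
proof -
  note u = unary_interp[of A] unary_interp[of B]
  have "(L, p) \<in> points (interp \<B> A)" "(M, q) \<in> points (interp \<B> B)"
    using unary_points[OF unary_interp] assms by blast+
  then obtain S where S: "S \<in> type_parallel (interp \<B> A) (interp \<B> B)" "alinks (links S) = L + M" "concl S = [p, q]"
    by (rule type_parallelI[OF u _ _ assms(5)])
  have "(L + M + {#AT p q r#}, r) \<in> points (tens_gen (interp \<B> A) (interp \<B> B))"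
    by (rule tens_genI[OF u S(1,3,2)]) (use assms(6) in simp)
  moreover have "tens_gen (interp \<B> A) (interp \<B> B) \<subseteq> interp \<B> (TensorF A B)"
    unfolding interp.simps type_tensor_gen using orth_orth_incl tens_gen_net[OF u] by blast
  ultimately have "(L + M + {#AT p q r#}, r) \<in> points (interp \<B> (TensorF A B))" using points_mono by blast
  then show ?thesis using unary_points[OF unary_interp] by blast
qed

lemma passes_cut:
  assumes "anet L {#p#}" "passes L [(p, opponents A)]" "anet M {#q#}" "passes M [(q, opponents (neg dual A))]"
    "pos L \<inter> pos M = {}"
  shows "win (L + M + {#AC {#p, q#}#})"
proof -
  have "(L, p) \<in> points (interp \<B> A)" "(M, q) \<in> points (interp \<B> (neg dual A))"
    using unary_points[OF unary_interp] assms by blast+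
  then have L: "(L, p) \<in> points (interp \<B> A)" and "(M, q) \<in> opponents A"
    using points_mono[OF interp_neg] by blast+
  then have "passes M [(q, points (interp \<B> A))]" using unary_points_orth[OF unary_interp] by blast
  from passes1D[OF this L assms(5)] show ?thesis by (simp add: add_ac add_mset_commute)
qed

text \<open>The frame rule used twice, once for each premise of a binary rule: all side conclusions
  are plugged before the link in \<open>X\<close> is added.\<close>

lemma passes_lift2:
  assumes step: "\<And>L' M'. anet L' {#p#} \<Longrightarrow> anet M' {#q#} \<Longrightarrow> passes L' [(p, opponents A)] \<Longrightarrow> passes M' [(q, opponents B)] \<Longrightarrow>
      pos L' \<inter> pos M' = {} \<Longrightarrow> pos L' \<inter> pos X \<subseteq> {p} \<Longrightarrow> pos M' \<inter> pos X \<subseteq> {q} \<Longrightarrow> passes (L' + M' + X) H"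
    and L: "anet L (mset (cs @ [p]))" "passes L (zip cs (map opponents \<Gamma>) @ [(p, opponents A)])" "length cs = length \<Gamma>"
    and M: "anet M (mset (ds @ [q]))" "passes M (zip ds (map opponents \<Delta>) @ [(q, opponents B)])" "length ds = length \<Delta>"
    and d: "pos L \<inter> pos M = {}" "pos L \<inter> pos X \<subseteq> {p}" "pos M \<inter> pos X \<subseteq> {q}"
  shows "passes (L + M + X) (zip cs (map opponents \<Gamma>) @ zip ds (map opponents \<Delta>) @ H)"
proof -
  have p: "p \<in> pos L" and q: "q \<in> pos M" using anet_concl_subset[OF L(1)] anet_concl_subset[OF M(1)] by auto
  have "passes (L + (M + X)) (zip cs (map opponents \<Gamma>) @ (zip ds (map opponents \<Delta>) @ H))"
  proof (rule passes_lift[of "[(p, opponents A)]"])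
    fix L' assume L': "anet L' (mset (map fst [(p, opponents A)]))" "pos L' \<inter> pos (M + X) \<subseteq> set (map fst [(p, opponents A)])"
      "passes L' [(p, opponents A)]"
    have dL': "pos L' \<inter> pos M = {}" using L'(2) p d(1) by auto
    have "passes (M + (L' + X)) (zip ds (map opponents \<Delta>) @ H)"
    proof (rule passes_lift[of "[(q, opponents B)]"])
      fix M' assume M': "anet M' (mset (map fst [(q, opponents B)]))" "pos M' \<inter> pos (L' + X) \<subseteq> set (map fst [(q, opponents B)])"
        "passes M' [(q, opponents B)]"
      have "pos L' \<inter> pos M' = {}" using M'(2) q dL' by auto
      then have "passes (L' + M' + X) H" by (intro step) (use L' M' in auto)
      then show "passes (M' + (L' + X)) H" by (simp add: add_ac)
    qed (rule behaved_zip | (use M d dL' in \<open>fastforce\<close>))+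
    then show "passes (L' + (M + X)) (zip ds (map opponents \<Delta>) @ H)" by (simp add: add_ac)
  qed (rule behaved_zip | (use L d in \<open>fastforce\<close>))+
  then show ?thesis by (simp add: add_ac)
qed

text \<open>The logical rules and the cut act on the last conclusions of the premises, the others
  having been plugged beforehand by the frame rule; exchange is the symmetry of
  \<open>passes\<close>.\<close>

lemma soundness:
  assumes "represents S \<pi>" "proof_of dual \<pi> \<Gamma>"
  shows "passing_net (map opponents \<Gamma>) S"
  using assms
proof (induction arbitrary: \<Gamma> rule: represents.induct)
  case (1 ps \<Gamma>')
  from 1(3) have g: "\<Gamma>' = \<Gamma>" by cases simp
  have m: "map fst (zip ps (map opponents \<Gamma>)) = ps" using 1(2) g by (simp add: map_fst_zip)
  have "passes {#AD (mset (map fst (zip ps (map opponents \<Gamma>))))#} (zip ps (map opponents \<Gamma>))"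
    by (rule passes_daimon) (use 1(1) m tame_opponents in \<open>auto dest!: set_zip_rightD\<close>)
  then show ?case using 1(1,2) g anet_daimon[of "mset ps"] unfolding m by (simp add: passing_net_def is_net_anet)
next
  case (2 L cs p q \<pi> r)
  from 2(4) obtain \<Gamma>' A B where G: "\<Gamma> = \<Gamma>' @ [ParF A B]" "proof_of dual \<pi> (\<Gamma>' @ [A, B])" by cases auto
  from 2(3)[OF G(2)] have n: "anet (alinks L) (mset (cs @ [p, q]))" and len: "length cs = length \<Gamma>'"
    and ps: "passes (alinks L) (zip cs (map opponents \<Gamma>') @ [(p, opponents A), (q, opponents B)])"
    by (auto simp: passing_net_def is_net_anet)
  have pq: "p \<in> pos (alinks L)" "q \<in> pos (alinks L)" using anet_concl_subset[OF n] by auto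
  have r: "r \<notin> pos (alinks L)" using 2(2) by simp
  have "passes (alinks L + {#AP p q r#}) (zip cs (map opponents \<Gamma>') @ [(r, opponents (ParF A B))])"
  proof (rule passes_lift[OF _ _ _ ps])
    fix L' assume L': "anet L' (mset (map fst [(p, opponents A), (q, opponents B)]))"
      "pos L' \<inter> pos {#AP p q r#} \<subseteq> set (map fst [(p, opponents A), (q, opponents B)])"
      "passes L' [(p, opponents A), (q, opponents B)]"
    have "r \<notin> pos L'" using L'(2) r pq by auto
    then show "passes (L' + {#AP p q r#}) [(r, opponents (ParF A B))]" by (intro passes_par) (use L' in auto)
  qed (rule behaved_zip | (use n len r in \<open>fastforce simp del: pos_alinks\<close>))+
  moreover have "anet (alinks L + {#AP p q r#}) (add_mset r (mset cs))" by (rule anet_AP) (use n r in simp_all)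
  ultimately show ?case using len by (simp add: passing_net_def is_net_anet G)
next
  case (3 L cs p \<pi> M ds q \<rho> r)
  from 3(7) obtain \<Gamma>' A \<Delta> B where G: "\<Gamma> = \<Gamma>' @ \<Delta> @ [TensorF A B]" "proof_of dual \<pi> (\<Gamma>' @ [A])" "proof_of dual \<rho> (\<Delta> @ [B])" by cases auto
  from 3(5)[OF G(2)] have L: "anet (alinks L) (mset (cs @ [p]))" "passes (alinks L) (zip cs (map opponents \<Gamma>') @ [(p, opponents A)])" "length cs = length \<Gamma>'"
    by (auto simp: passing_net_def is_net_anet)
  from 3(6)[OF G(3)] have M: "anet (alinks M) (mset (ds @ [q]))" "passes (alinks M) (zip ds (map opponents \<Delta>) @ [(q, opponents B)])" "length ds = length \<Delta>"
    by (auto simp: passing_net_def is_net_anet)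
  have p: "p \<in> pos (alinks L)" and q: "q \<in> pos (alinks M)" using anet_concl_subset[OF L(1)] anet_concl_subset[OF M(1)] by auto
  have d: "pos (alinks L) \<inter> pos (alinks M) = {}" "r \<notin> pos (alinks L)" "r \<notin> pos (alinks M)" using 3(3,4) by auto
  have "passes (alinks L + alinks M + {#AT p q r#}) (zip cs (map opponents \<Gamma>') @ zip ds (map opponents \<Delta>) @ [(r, opponents (TensorF A B))])"
  proof (rule passes_lift2[OF _ L M d(1)])
    fix L' M' assume a: "anet L' {#p#}" "anet M' {#q#}" "passes L' [(p, opponents A)]" "passes M' [(q, opponents B)]"
      "pos L' \<inter> pos M' = {}" "pos L' \<inter> pos {#AT p q r#} \<subseteq> {p}" "pos M' \<inter> pos {#AT p q r#} \<subseteq> {q}"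
    have "r \<noteq> p" "r \<noteq> q" using p q d by auto
    then have "r \<notin> pos L' \<union> pos M'" using a by auto
    then show "passes (L' + M' + {#AT p q r#}) [(r, opponents (TensorF A B))]" by (intro passes_tensor) (use a in auto)
  qed (use p q d in \<open>auto simp del: pos_alinks\<close>)
  moreover have "anet (alinks L + alinks M + {#AT p q r#}) (add_mset r (mset cs + mset ds))"
    by (rule anet_AT) (use anet_plus[OF L(1) M(1) d(1)] d in \<open>simp_all add: add_ac add_mset_commute\<close>)
  ultimately show ?case using L(3) M(3) by (simp add: passing_net_def is_net_anet G)
next
  case (4 L cs p \<pi> M ds q \<rho> c)
  from 4(7) obtain \<Gamma>' A \<Delta> where G: "\<Gamma> = \<Gamma>' @ \<Delta>" "proof_of dual \<pi> (\<Gamma>' @ [A])" "proof_of dual \<rho> (\<Delta> @ [neg dual A])" by cases auto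
  from 4(5)[OF G(2)] have L: "anet (alinks L) (mset (cs @ [p]))" "passes (alinks L) (zip cs (map opponents \<Gamma>') @ [(p, opponents A)])" "length cs = length \<Gamma>'"
    by (auto simp: passing_net_def is_net_anet)
  from 4(6)[OF G(3)] have M: "anet (alinks M) (mset (ds @ [q]))" "passes (alinks M) (zip ds (map opponents \<Delta>) @ [(q, opponents (neg dual A))])" "length ds = length \<Delta>"
    by (auto simp: passing_net_def is_net_anet)
  have p: "p \<in> pos (alinks L)" and q: "q \<in> pos (alinks M)" using anet_concl_subset[OF L(1)] anet_concl_subset[OF M(1)] by auto
  have d: "pos (alinks L) \<inter> pos (alinks M) = {}" using 4(3) by auto
  have "passes (alinks L + alinks M + {#AC {#p, q#}#}) (zip cs (map opponents \<Gamma>') @ zip ds (map opponents \<Delta>) @ [])"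
    by (rule passes_lift2[OF _ L M d(1)]) (use p q d passes_cut in \<open>auto simp del: pos_alinks\<close>)
  moreover have "anet (alinks L + alinks M + cuts [p] [q]) (mset cs + mset ds)"
    by (rule anet_cuts) (use L M d in \<open>simp_all del: pos_alinks\<close>)
  moreover have "unord c = AC {#p, q#}" by (rule unord_cut[OF 4(4)])
  ultimately show ?case using L(3) M(3) by (simp add: passing_net_def is_net_anet G del: unord_eq)
next
  case (5 L cs p q ds \<pi>)
  from 5(3) obtain \<Gamma>' A B \<Delta> where G: "\<Gamma> = \<Gamma>' @ [B, A] @ \<Delta>" "length cs = length \<Gamma>'" "proof_of dual \<pi> (\<Gamma>' @ [A, B] @ \<Delta>)" by cases auto
  from 5(2)[OF G(3)] have n: "anet (alinks L) (mset (cs @ [p, q] @ ds))" and len: "length ds = length \<Delta>"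
    and ps: "passes (alinks L) (zip cs (map opponents \<Gamma>') @ (p, opponents A) # (q, opponents B) # zip ds (map opponents \<Delta>))"
    using G(2) by (auto simp: passing_net_def is_net_anet)
  have pq: "p \<in> pos (alinks L)" "q \<in> pos (alinks L)" using anet_concl_subset[OF n] by auto
  from passes_swap[OF ps behaved_opponents behaved_opponents this]
  show ?case using n len G(2) by (simp add: passing_net_def is_net_anet G add_mset_commute)
qed

end

section \<open>Correctness of switchings\<close>

definition prem :: "('p \<Rightarrow> bool) \<Rightarrow> 'p \<Rightarrow> 'p \<Rightarrow> 'p \<Rightarrow> 'p" where
  "prem \<sigma> p1 p2 p = (if \<sigma> p then p1 else p2)"

text \<open>
  Instead of paths we use two-colourings of positions: a switching is connected if a colouring
  that obeys all links is constant, and acyclic if each link can be violated alone.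
\<close>

primrec obeys :: "('p \<Rightarrow> bool) \<Rightarrow> ('p \<Rightarrow> bool) \<Rightarrow> 'p alink \<Rightarrow> bool" where
  "obeys \<sigma> U (AT p1 p2 p) \<longleftrightarrow> (U p1 \<longleftrightarrow> U p) \<and> (U p2 \<longleftrightarrow> U p)"
| "obeys \<sigma> U (AP p1 p2 p) \<longleftrightarrow> (U (prem \<sigma> p1 p2 p) \<longleftrightarrow> U p)"
| "obeys \<sigma> U (AC ps) \<longleftrightarrow> True"
| "obeys \<sigma> U (AD ps) \<longleftrightarrow> const_on U (set_mset ps)"

text \<open>A par contributes only its selected edge, whose removal must separate its ends. A tensor
  is a node with three edges, and its removal must separate the two premises.\<close>

definition corr :: "('p \<Rightarrow> bool) \<Rightarrow> 'p alink multiset \<Rightarrow> bool" where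
  "corr \<sigma> L \<longleftrightarrow>
     (\<forall>U. (\<forall>l\<in>#L. obeys \<sigma> U l) \<longrightarrow> const_on U (pos L)) \<and>
     (\<forall>p1 p2 p. AP p1 p2 p \<in># L \<longrightarrow>
        (\<exists>U. (\<forall>l\<in>#L. l \<noteq> AP p1 p2 p \<longrightarrow> obeys \<sigma> U l) \<and> U (prem \<sigma> p1 p2 p) \<noteq> U p)) \<and>
     (\<forall>p1 p2 p. AT p1 p2 p \<in># L \<longrightarrow>
        (\<exists>U. (\<forall>l\<in>#L. l \<noteq> AT p1 p2 p \<longrightarrow> obeys \<sigma> U l) \<and> U p1 \<noteq> U p2))"

lemma const_on_comp2:
  assumes "const_on U A" "const_on V A"
  shows "const_on (\<lambda>x. f (U x) (V x)) A"
  unfolding const_on_def[of "\<lambda>x. f (U x) (V x)"]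
proof (intro ballI)
  fix x y assume "x \<in> A" "y \<in> A"
  then have "U x = U y" "V x = V y" using const_onD[OF assms(1)] const_onD[OF assms(2)] by blast+
  then show "f (U x) (V x) = f (U y) (V y)" by simp
qed

lemma const_on_comp1: "const_on U A \<Longrightarrow> const_on (\<lambda>x. f (U x)) A"
  using const_on_comp2[of U A U "\<lambda>a _. f a"] by blast

text \<open>Pointwise Boolean combinations of obedient colourings are obedient; this does the work
  of unions and intersections of connected components.\<close>

lemma obeys_comp2: "obeys \<sigma> U l \<Longrightarrow> obeys \<sigma> V l \<Longrightarrow> obeys \<sigma> (\<lambda>x. f (U x) (V x)) l"
  by (cases l) (auto simp: const_on_comp2)

lemma obeys_comp1: "obeys \<sigma> U l \<Longrightarrow> obeys \<sigma> (\<lambda>x. f (U x)) l"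
  by (cases l) (auto simp: const_on_comp1)

lemma unique_target:
  assumes "anet L cs" "l \<in># L" "l' \<in># L" "p \<in># atgt l" "p \<in># atgt l'"
  shows "l = l'"
proof (rule ccontr)
  assume "l \<noteq> l'"
  then obtain M where "L = add_mset l (add_mset l' M)"
    using assms(2,3) by (metis insert_noteq_member mset_add)
  with assms show False by (auto simp: anet_def simple_mset_add)
qed

lemma exists_producer:
  assumes "anet L cs" "x \<in> pos L"
  obtains l where "l \<in># L" "x \<in># atgt l"
  using assms anet_pos[OF assms(1)] by (auto simp: tgt_def)

definition contractible :: "'p alink multiset \<Rightarrow> bool" where
  "contractible L \<longleftrightarrow>
     (\<exists>p1 p2 p ds es C. L = C + {#AT p1 p2 p, AD (add_mset p1 ds), AD (add_mset p2 es)#}) \<or>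
     (\<exists>p1 p2 p ds C. L = C + {#AP p1 p2 p, AD (add_mset p1 (add_mset p2 ds))#})"

context
  fixes L :: "'p alink multiset" and cs :: "'p multiset" and h :: "'p \<Rightarrow> nat"
  assumes net: "anet L cs" and rank: "ranked h L" and corr: "\<And>\<sigma>. corr \<sigma> L"
begin

lemma connectedD: "(\<And>l. l \<in># L \<Longrightarrow> obeys \<sigma> U l) \<Longrightarrow> x \<in> pos L \<Longrightarrow> y \<in> pos L \<Longrightarrow> U x = U y"
  using corr[of \<sigma>] unfolding corr_def by (meson const_onD)

lemma link_pos: "l \<in># L \<Longrightarrow> x \<in># asrc l \<or> x \<in># atgt l \<Longrightarrow> x \<in> pos L"
  by (auto dest!: multi_member_split)

lemma prem_pos: "AP p1 p2 p \<in># L \<Longrightarrow> p1 \<in> pos L \<and> p2 \<in> pos L \<and> p \<in> pos L \<and> prem \<sigma> p1 p2 p \<in> pos L"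
  using link_pos[of "AP p1 p2 p"] by (auto simp: prem_def)

text \<open>Connection through tensors and daimons only: pars are ignored, so nearness does not
  depend on the switching.\<close>

definition near :: "'p \<Rightarrow> 'p \<Rightarrow> bool" where
  "near a x \<longleftrightarrow> (\<forall>U. (\<forall>l\<in>#L. (\<forall>p1 p2 p. l \<noteq> AP p1 p2 p) \<longrightarrow> obeys (\<lambda>_. True) U l) \<longrightarrow> U x = U a)"

lemma obeys_switch: "(\<And>p1 p2 p. l \<noteq> AP p1 p2 p) \<Longrightarrow> obeys \<sigma> U l = obeys \<tau> U l"
  by (cases l) auto

lemma nearD:
  assumes "near a x" "\<And>l. l \<in># L \<Longrightarrow> (\<And>p1 p2 p. l \<noteq> AP p1 p2 p) \<Longrightarrow> obeys \<sigma> U l"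
  shows "U x = U a"
proof -
  have "obeys (\<lambda>_. True) U l" if "l \<in># L" "\<forall>p1 p2 p. l \<noteq> AP p1 p2 p" for l
    using assms(2)[of l] that obeys_switch[of l \<sigma> U "\<lambda>_. True"] by blast
  then show ?thesis using assms(1) unfolding near_def by blast
qed

text \<open>A tensor of least rank near \<open>a\<close> has its premises near \<open>a\<close> too.
  They are produced neither by a tensor, by minimality, nor by a par, by assumption, hence by
  daimons; these are distinct because correctness separates the premises of a tensor.\<close>

lemma contractible_tensor:
  assumes "AT p1 p2 p \<in># L" "near a p" "\<And>q1 q2 q. near a q \<Longrightarrow> AP q1 q2 q \<notin># L"
  shows "contractible L"
proof -
  let ?P = "\<lambda>x. near a x \<and> (\<exists>x1 x2. AT x1 x2 x \<in># L)"
  obtain x where x: "?P x" and min: "\<And>y. ?P y \<Longrightarrow> h x \<le> h y"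
    using ex_has_least_nat[of ?P p h] assms by blast
  then obtain x1 x2 where t: "AT x1 x2 x \<in># L" "near a x" by blast
  have producer: "\<exists>ds. AD (add_mset y ds) \<in># L" if y: "y = x1 \<or> y = x2" for y
  proof -
    have "near a y" unfolding near_def
    proof (intro allI impI)
      fix U assume U: "\<forall>l\<in>#L. (\<forall>p1 p2 p. l \<noteq> AP p1 p2 p) \<longrightarrow> obeys (\<lambda>_. True) U l"
      then have "obeys (\<lambda>_. True) U (AT x1 x2 x)" using t(1) by blast
      moreover have "U x = U a" using t(2) U unfolding near_def by blast
      ultimately show "U y = U a" using y by auto
    qed
    have "y \<in> pos L" using link_pos[OF t(1), of y] y by auto
    then obtain l where l: "l \<in># L" "y \<in># atgt l" by (rule exists_producer[OF net])
    have hy: "h y < h x" using rank t(1) y unfolding ranked_def by force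
    show ?thesis
    proof (cases l)
      case (AT y1 y2 y')
      then have "?P y" using l \<open>near a y\<close> by auto
      then show ?thesis using min hy by (metis leD)
    next
      case (AP y1 y2 y')
      then show ?thesis using l \<open>near a y\<close> assms(3) by auto
    next
      case (AC ps) then show ?thesis using l by simp
    next
      case (AD ps)
      then show ?thesis using l by (metis atgt.simps(4) mset_add)
    qed
  qed
  obtain ds es where d: "AD (add_mset x1 ds) \<in># L" "AD (add_mset x2 es) \<in># L" using producer by blast
  obtain U where U: "\<forall>l\<in>#L. l \<noteq> AT x1 x2 x \<longrightarrow> obeys (\<lambda>_. True) U l" "U x1 \<noteq> U x2"
    using corr[of "\<lambda>_. True"] t(1) unfolding corr_def by blast
  have "AD (add_mset x1 ds) \<noteq> AD (add_mset x2 es)"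
  proof
    assume eq: "AD (add_mset x1 ds) = AD (add_mset x2 es)"
    have "const_on U (set_mset (add_mset x1 ds))" using U(1) d(1) by auto
    moreover have "x2 \<in># add_mset x1 ds" using eq by auto
    ultimately show False using U(2) const_onD by (metis union_single_eq_member add_mset_add_single)
  qed
  then obtain M where M: "L = add_mset (AD (add_mset x1 ds)) (add_mset (AD (add_mset x2 es)) M)"
    using d by (metis insert_noteq_member mset_add)
  then have "AT x1 x2 x \<in># M" using t(1) by auto
  then obtain C where "M = add_mset (AT x1 x2 x) C" by (metis mset_add)
  then have "L = C + {#AT x1 x2 x, AD (add_mset x1 ds), AD (add_mset x2 es)#}" using M by (simp add: add_mset_commute)
  then show ?thesis unfolding contractible_def by blast
qed

text \<open>A colouring violated by the selected par edge alone, normalized so that the premise side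
  is coloured True; the size of that side is what is minimized later.\<close>

definition cutcol :: "('p \<Rightarrow> bool) \<Rightarrow> 'p \<Rightarrow> 'p \<Rightarrow> 'p \<Rightarrow> ('p \<Rightarrow> bool) \<Rightarrow> bool" where
  "cutcol \<sigma> p1 p2 p g \<longleftrightarrow> AP p1 p2 p \<in># L \<and> (\<forall>l\<in>#L. l \<noteq> AP p1 p2 p \<longrightarrow> obeys \<sigma> g l) \<and> \<not> g p \<and> g (prem \<sigma> p1 p2 p)"

lemma cutcol_exists:
  assumes "AP p1 p2 p \<in># L" "\<forall>l\<in>#L. l \<noteq> AP p1 p2 p \<longrightarrow> obeys \<sigma> U l" "U (prem \<sigma> p1 p2 p) \<noteq> U p"
  shows "cutcol \<sigma> p1 p2 p (\<lambda>x. U x \<noteq> U p)"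
  using assms obeys_comp1[of \<sigma> U _ "\<lambda>b. b \<noteq> U p"] unfolding cutcol_def by blast

lemma obeys_upd:
  assumes "AP p1 p2 p \<in># L" "l \<in># L" "l \<noteq> AP p1 p2 p"
  shows "obeys (\<sigma>(p := b)) U l = obeys \<sigma> U l"
proof (cases l)
  case (AP q1 q2 q)
  have "q \<noteq> p" using unique_target[OF net assms(1,2), of p] assms(3) AP by auto
  then show ?thesis by (simp add: AP prem_def)
qed auto

text \<open>If the premise not selected lay on the conclusion side, the colouring would obey every
  link of the switching that selects it, against connectedness. So the same colouring works for both
  positions of the switch.\<close>

lemma cutcol_both:
  assumes c: "cutcol \<sigma> p1 p2 p g"
  shows "g p1" "g p2" "cutcol (\<sigma>(p := b)) p1 p2 p g"
proof -
  have i: "AP p1 p2 p \<in># L" using c by (simp add: cutcol_def)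
  have r: "obeys (\<sigma>(p := b)) g l" if "l \<in># L" "l \<noteq> AP p1 p2 p" for l b
    using c that obeys_upd[OF i that] unfolding cutcol_def by blast
  have g: "g (prem (\<sigma>(p := b)) p1 p2 p)" for b
  proof (rule ccontr)
    assume "\<not> g (prem (\<sigma>(p := b)) p1 p2 p)"
    then have "obeys (\<sigma>(p := b)) g (AP p1 p2 p)" using c by (simp add: cutcol_def)
    then have "g (prem \<sigma> p1 p2 p) = g p"
      by (intro connectedD[of "\<sigma>(p := b)"]) (use r prem_pos[OF i] in metis)+
    then show False using c by (simp add: cutcol_def)
  qed
  show "g p1" "g p2" using g[of True] g[of False] by (simp_all add: prem_def)
  show "cutcol (\<sigma>(p := b)) p1 p2 p g" unfolding cutcol_def using i r g c by (auto simp: cutcol_def)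
qed

text \<open>
  Let \<open>g\<close> separate the premise side of one par from the rest, with a premise side as small as possible
  among all switchings and pars. A par met when going up from its premises through tensors, or an edge
  separating its two premises, would give a smaller side. Hence the premises are outputs of one daimon,
  unless some tensor above them joins two daimons.
\<close>

context
  fixes \<sigma> p1 p2 p g
  assumes c: "cutcol \<sigma> p1 p2 p g"
    and min: "\<And>\<tau> q1 q2 q k. cutcol \<tau> q1 q2 q k \<Longrightarrow> card {x \<in> pos L. g x} \<le> card {x \<in> pos L. k x}"
begin

lemma par_link: "AP p1 p2 p \<in># L" using c by (simp add: cutcol_def)

lemma minimal:
  assumes "cutcol \<tau> q1 q2 q k" "\<And>x. x \<in> pos L \<Longrightarrow> k x \<Longrightarrow> g x" "a \<in> pos L" "g a" "\<not> k a"
  shows False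
proof -
  have "{x \<in> pos L. k x} \<subset> {x \<in> pos L. g x}" using assms by blast
  then have "card {x \<in> pos L. k x} < card {x \<in> pos L. g x}" by (intro psubset_card_mono) auto
  then show False using min[OF assms(1)] by simp
qed

text \<open>By nearness, \<open>a\<close> is on the conclusion side of the edge at \<open>x\<close>.
  Colouring True what is on its premise side but outside \<open>g\<close> obeys every link and is
  False at \<open>p\<close>, hence False everywhere: the premise side at \<open>x\<close> lies
  within \<open>g\<close> and misses \<open>a\<close>.\<close>

lemma no_near_par:
  assumes a: "a = p1 \<or> a = p2" and n: "near a x" and j: "AP q1 q2 x \<in># L"
  shows False
proof -
  define \<tau> where "\<tau> = \<sigma>(p := (a = p1))"
  have ct: "cutcol \<tau> p1 p2 p g" unfolding \<tau>_def by (rule cutcol_both(3)[OF c])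
  have pa: "prem \<tau> p1 p2 p = a" using a by (auto simp: prem_def \<tau>_def)
  have gr: "obeys \<tau> g l" if "l \<in># L" "l \<noteq> AP p1 p2 p" for l using ct that by (simp add: cutcol_def)
  have ga: "g a" "\<not> g p" using cutcol_both[OF c] a c by (auto simp: cutcol_def)
  have gx: "g x" using nearD[OF n, of \<tau> g] gr ga(1) by blast
  then have xp: "x \<noteq> p" using ga by auto
  obtain U0 where U0: "\<forall>l\<in>#L. l \<noteq> AP q1 q2 x \<longrightarrow> obeys \<tau> U0 l" "U0 (prem \<tau> q1 q2 x) \<noteq> U0 x"
    using corr[of \<tau>] j unfolding corr_def by blast
  define U where "U = (\<lambda>y. U0 y \<noteq> U0 x)"
  have cU: "cutcol \<tau> q1 q2 x U" unfolding U_def by (rule cutcol_exists[OF j U0])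
  have Ur: "obeys \<tau> U l" if "l \<in># L" "l \<noteq> AP q1 q2 x" for l using cU that by (simp add: cutcol_def)
  have Ux: "\<not> U x" "U (prem \<tau> q1 q2 x)" using cU by (auto simp: cutcol_def)
  have Ua: "\<not> U a" using nearD[OF n, of \<tau> U] Ur Ux by blast
  have Up: "\<not> U p" using Ur[OF par_link] xp Ua pa by auto
  let ?k = "\<lambda>y. U y \<and> \<not> g y"
  have "obeys \<tau> ?k l" if l: "l \<in># L" for l
  proof -
    consider "l = AP p1 p2 p" | "l = AP q1 q2 x" | "l \<noteq> AP p1 p2 p" "l \<noteq> AP q1 q2 x" by blast
    then show ?thesis
    proof cases
      case 1 then show ?thesis using Ua Up pa by simp
    next
      case 2
      have "obeys \<tau> g (AP q1 q2 x)" by (rule gr[OF j]) (use xp in auto)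
      then show ?thesis using 2 gx by simp
    next
      case 3 then show ?thesis using obeys_comp2[OF Ur[OF l 3(2)] gr[OF l 3(1)], of "\<lambda>a b. a \<and> \<not> b"] by simp
    qed
  qed
  then have "?k y = ?k p" if "y \<in> pos L" for y
    using connectedD[of \<tau> ?k y p] that prem_pos[OF par_link] by blast
  then have "U y \<Longrightarrow> g y" if "y \<in> pos L" for y using that Up by blast
  then show False using minimal[OF cU, of a] ga Ua prem_pos[OF par_link] a by blast
qed

text \<open>Otherwise the part of the \<open>g\<close> side that \<open>U\<close> separates from
  \<open>q\<close> contains just one of \<open>p1\<close>, \<open>p2\<close>. With the switch at
  \<open>p\<close> set to the other one, this part is the premise side of the par at
  \<open>q\<close>, strictly smaller than that of \<open>g\<close>.\<close>

lemma not_separated: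
  assumes j: "AP q1 q2 q \<in># L" "AP q1 q2 q \<noteq> AP p1 p2 p"
    and U: "\<forall>l\<in>#L. l \<noteq> AP q1 q2 q \<longrightarrow> obeys \<sigma> U l" "U (prem \<sigma> q1 q2 q) \<noteq> U q"
  shows "U p1 = U p2"
proof (rule ccontr)
  assume ne: "U p1 \<noteq> U p2"
  then obtain a e where ae: "a = p1 \<and> e = p2 \<or> a = p2 \<and> e = p1" "U a = U q" "U e \<noteq> U q" by blast
  have p12: "p1 \<noteq> p2" using ne by auto
  define \<tau> where "\<tau> = \<sigma>(p := (a = p1))"
  have ct: "cutcol \<tau> p1 p2 p g" unfolding \<tau>_def by (rule cutcol_both(3)[OF c])
  have pa: "prem \<tau> p1 p2 p = a" using ae p12 by (auto simp: prem_def \<tau>_def)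
  have qp: "q \<noteq> p" using unique_target[OF net par_link j(1), of p] j(2) by auto
  then have pj: "prem \<tau> q1 q2 q = prem \<sigma> q1 q2 q" by (simp add: prem_def \<tau>_def)
  have gr: "obeys \<tau> g l" if "l \<in># L" "l \<noteq> AP p1 p2 p" for l using ct that by (simp add: cutcol_def)
  have Ur: "obeys \<tau> U l" if "l \<in># L" "l \<noteq> AP p1 p2 p" "l \<noteq> AP q1 q2 q" for l
    unfolding \<tau>_def using U that obeys_upd[OF par_link that(1,2)] by blast
  have g: "g a" "g e" "\<not> g p" using cutcol_both[OF c] ae c by (auto simp: cutcol_def)
  let ?V = "\<lambda>y. g y \<and> U y \<noteq> U q"
  have Vr: "obeys \<tau> ?V l" if l: "l \<in># L" "l \<noteq> AP q1 q2 q" for l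
  proof (cases "l = AP p1 p2 p")
    case True then show ?thesis using g pa ae(2) by simp
  next
    case False
    then show ?thesis using obeys_comp2[OF gr Ur, of l "\<lambda>b d. b \<and> d \<noteq> U q"] l by simp
  qed
  have "?V (prem \<tau> q1 q2 q)"
  proof (rule ccontr)
    assume "\<not> ?V (prem \<tau> q1 q2 q)"
    then have "obeys \<tau> ?V (AP q1 q2 q)" by simp
    then have "?V e = ?V p" by (intro connectedD[of \<tau> ?V]) (use Vr prem_pos[OF par_link] ae in metis)+
    then show False using g ae by simp
  qed
  then have "cutcol \<tau> q1 q2 q ?V" unfolding cutcol_def using j Vr by auto
  then show False by (rule minimal[of _ _ _ _ _ a]) (use g ae prem_pos[OF par_link] in auto)
qed

text \<open>Both premises are outputs of daimons, else a tensor can be contracted. If the daimons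
  differed, some edge leaving that of \<open>p1\<close> would have to separate it from
  \<open>p2\<close>; the preceding lemmas show that none does.\<close>

lemma minimal_contractible: "contractible L"
proof -
  have tens: "contractible L" if "a = p1 \<or> a = p2" "AT t1 t2 t \<in># L" "near a t" for a t1 t2 t
    by (rule contractible_tensor[OF that(2,3)]) (use no_near_par[OF that(1)] in blast)
  have near_refl: "near a a" for a by (simp add: near_def)
  have producer: "contractible L \<or> (\<exists>ds. AD ds \<in># L \<and> a \<in># ds)" if a: "a = p1 \<or> a = p2" for a
  proof -
    have "a \<in> pos L" using prem_pos[OF par_link] a by auto
    then obtain l where l: "l \<in># L" "a \<in># atgt l" by (rule exists_producer[OF net])
    show ?thesis
    proof (cases l)
      case (AT t1 t2 t) then show ?thesis using tens[OF a] near_refl l by auto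
    next
      case (AP t1 t2 t) then show ?thesis using no_near_par[OF a near_refl] l by auto
    qed (use l in auto)
  qed
  show ?thesis
  proof (rule ccontr)
    assume nc: "\<not> contractible L"
    obtain ds where ds: "AD ds \<in># L" "p1 \<in># ds" using producer nc by blast
    have p2: "p2 \<notin># ds"
    proof
      assume "p2 \<in># ds"
      moreover have "p1 \<noteq> p2"
      proof -
        obtain M where "L = add_mset (AP p1 p2 p) M" using par_link by (metis mset_add)
        then have "simple_mset ({#p1, p2#} + src M)" using anet_simple[OF net] by simp
        then show ?thesis by auto
      qed
      ultimately obtain es where es: "ds = add_mset p1 (add_mset p2 es)" using ds(2) by (metis insert_noteq_member mset_add)
      obtain M where M: "L = add_mset (AP p1 p2 p) M" using par_link by (metis mset_add)
      then have "AD ds \<in># M" using ds by auto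
      then obtain C where "M = add_mset (AD ds) C" by (metis mset_add)
      then have "L = C + {#AP p1 p2 p, AD (add_mset p1 (add_mset p2 es))#}" using M es by (simp add: add_mset_commute)
      then show False using nc unfolding contractible_def by blast
    qed
    have near: "near p1 x" if x: "x \<in># ds" for x unfolding near_def
    proof (intro allI impI)
      fix U assume "\<forall>l\<in>#L. (\<forall>p1 p2 p. l \<noteq> AP p1 p2 p) \<longrightarrow> obeys (\<lambda>_. True) U l"
      then have "obeys (\<lambda>_. True) U (AD ds)" using ds(1) by blast
      then show "U x = U p1" using x ds(2) by (auto dest: const_onD)
    qed
    have no_tensor: "t1 \<notin># ds \<and> t2 \<notin># ds \<and> t \<notin># ds" if t: "AT t1 t2 t \<in># L" for t1 t2 t
    proof -
      have "\<not> near p1 t" using tens t nc by blast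
      moreover have "near p1 t" if x: "near p1 x" "x = t1 \<or> x = t2 \<or> x = t" for x unfolding near_def
      proof (intro allI impI)
        fix U assume U: "\<forall>l\<in>#L. (\<forall>p1 p2 p. l \<noteq> AP p1 p2 p) \<longrightarrow> obeys (\<lambda>_. True) U l"
        then have "obeys (\<lambda>_. True) U (AT t1 t2 t)" using t by blast
        moreover have "U x = U p1" using x(1) U unfolding near_def by blast
        ultimately show "U t = U p1" using x(2) by auto
      qed
      ultimately show ?thesis using near by blast
    qed
    \<comment> \<open>With no tensor at \<open>ds\<close>, the edges leaving this daimon in the
      switching go to the pars collected in \<open>J\<close>.\<close>
    define J where "J = {(q1, q2, q). AP q1 q2 q \<in># L \<and> prem \<sigma> q1 q2 q \<in># ds}"
    have "\<forall>j\<in>J. \<exists>U. case j of (q1, q2, q) \<Rightarrow> (\<forall>l\<in>#L. l \<noteq> AP q1 q2 q \<longrightarrow> obeys \<sigma> U l) \<and> U (prem \<sigma> q1 q2 q) \<noteq> U q"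
      using corr[of \<sigma>] unfolding corr_def J_def by blast
    from bchoice[OF this] obtain F where F: "\<forall>j\<in>J. case j of (q1, q2, q) \<Rightarrow>
        (\<forall>l\<in>#L. l \<noteq> AP q1 q2 q \<longrightarrow> obeys \<sigma> (F j) l) \<and> F j (prem \<sigma> q1 q2 q) \<noteq> F j q"
      by (rule exE)
    have Fr: "obeys \<sigma> (F (q1, q2, q)) l" if "(q1, q2, q) \<in> J" "l \<in># L" "l \<noteq> AP q1 q2 q" for q1 q2 q l
      using bspec[OF F that(1)] that(2,3) by simp
    have Fn: "F (q1, q2, q) (prem \<sigma> q1 q2 q) \<noteq> F (q1, q2, q) q" if "(q1, q2, q) \<in> J" for q1 q2 q
      using bspec[OF F that] by simp
    have sep: "F j p1 = F j p2" if j: "j \<in> J" for j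
    proof -
      obtain q1 q2 q where jq: "j = (q1, q2, q)" by (metis prod_cases3)
      have A: "AP q1 q2 q \<in># L" using j jq by (simp add: J_def)
      show ?thesis
      proof (cases "AP q1 q2 q = AP p1 p2 p")
        case True
        have "cutcol \<sigma> q1 q2 q (\<lambda>x. F j x \<noteq> F j q)"
          by (rule cutcol_exists) (use A Fr Fn j jq in \<open>simp_all\<close>)
        from cutcol_both(1,2)[OF this] show ?thesis using True by auto
      next
        case False
        show ?thesis by (rule not_separated[OF A False]) (use Fr Fn j jq in \<open>simp_all\<close>)
      qed
    qed
    \<comment> \<open>\<open>H\<close> holds on the daimon's side of all these edges. In a tree that
      is the daimon itself: \<open>?k\<close> obeys every link and is False at \<open>p1\<close>,
      whereas \<open>p2\<close> satisfies \<open>H\<close> without being an output of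
      \<open>ds\<close>.\<close>
    define H where "H x \<longleftrightarrow> (\<forall>j\<in>J. F j x = F j p1)" for x
    let ?k = "\<lambda>x. H x \<and> x \<notin># ds"
    have "obeys \<sigma> ?k l" if l: "l \<in># L" for l
    proof (cases l)
      case (AT t1 t2 t)
      have "F j t1 = F j t \<and> F j t2 = F j t" if j: "j \<in> J" for j
      proof -
        obtain r1 r2 r where jr: "j = (r1, r2, r)" by (metis prod_cases3)
        have "obeys \<sigma> (F j) l" unfolding jr by (rule Fr) (use j jr l AT in auto)
        then show ?thesis by (simp add: AT)
      qed
      then have "H t1 = H t" "H t2 = H t" unfolding H_def by simp_all
      then show ?thesis using no_tensor l by (simp add: AT)
    next
      case (AP q1 q2 q)
      have q: "q \<notin># ds" using unique_target[OF net l ds(1), of q] AP by auto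
      show ?thesis
      proof (cases "prem \<sigma> q1 q2 q \<in># ds")
        case True
        then have j: "(q1, q2, q) \<in> J" using l AP by (simp add: J_def)
        have "obeys \<sigma> (F (q1, q2, q)) (AD ds)" by (rule Fr[OF j ds(1)]) simp
        then have "F (q1, q2, q) (prem \<sigma> q1 q2 q) = F (q1, q2, q) p1"
          using True ds(2) by (auto dest: const_onD)
        then have "\<not> H q" using Fn[OF j] j unfolding H_def by metis
        then show ?thesis using True by (simp add: AP)
      next
        case False
        have "F j (prem \<sigma> q1 q2 q) = F j q" if j: "j \<in> J" for j
        proof -
          obtain r1 r2 r where jr: "j = (r1, r2, r)" by (metis prod_cases3)
          have "l \<noteq> AP r1 r2 r" using False j jr AP by (auto simp: J_def)
          then have "obeys \<sigma> (F j) l" using Fr l j jr by blast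
          then show ?thesis by (simp add: AP)
        qed
        then have "H (prem \<sigma> q1 q2 q) = H q" unfolding H_def by metis
        then show ?thesis using q False by (simp add: AP)
      qed
    next
      case (AC ps) then show ?thesis by simp
    next
      case (AD es)
      show ?thesis
      proof (cases "es = ds")
        case True then show ?thesis by (simp add: AD const_on_def)
      next
        case False
        have "x \<notin># ds" if "x \<in># es" for x
          using unique_target[OF net l ds(1), of x] AD that False by auto
        moreover have "F j x = F j y" if "j \<in> J" "x \<in># es" "y \<in># es" for j x y
        proof -
          obtain r1 r2 r where jr: "j = (r1, r2, r)" by (metis prod_cases3)
          have "obeys \<sigma> (F j) l" unfolding jr by (rule Fr) (use that jr l AD in auto)
          then show ?thesis using that by (auto simp: AD dest: const_onD)
        qed
        then have "H x = H y" if "x \<in># es" "y \<in># es" for x y using that unfolding H_def by metis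
        ultimately show ?thesis unfolding AD obeys.simps const_on_def by blast
      qed
    qed
    then have "?k p1 = ?k p2" using connectedD[of \<sigma> ?k p1 p2] prem_pos[OF par_link] by blast
    moreover have "H p2" unfolding H_def using sep by metis
    ultimately show False using ds(2) p2 by simp
  qed
qed

end

text \<open>The minimum is taken over all pars, switchings and colourings at once. If there is no
  par, any tensor gives a region to which \<open>contractible_tensor\<close> applies.\<close>

lemma exists_contractible:
  assumes "(\<exists>p1 p2 p. AT p1 p2 p \<in># L) \<or> (\<exists>p1 p2 p. AP p1 p2 p \<in># L)"
  shows "contractible L"
proof (cases "\<exists>p1 p2 p. AP p1 p2 p \<in># L")
  case True
  then obtain p1 p2 p where i: "AP p1 p2 p \<in># L" by blast
  obtain U where "\<forall>l\<in>#L. l \<noteq> AP p1 p2 p \<longrightarrow> obeys (\<lambda>_. True) U l" "U (prem (\<lambda>_. True) p1 p2 p) \<noteq> U p"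
    using corr[of "\<lambda>_. True"] i unfolding corr_def by blast
  from cutcol_exists[OF i this]
  have "\<exists>g \<sigma> p1 p2 p. cutcol \<sigma> p1 p2 p g" by blast
  then obtain g where g: "\<exists>\<sigma> p1 p2 p. cutcol \<sigma> p1 p2 p g"
    and min: "\<And>k. \<exists>\<sigma> p1 p2 p. cutcol \<sigma> p1 p2 p k \<Longrightarrow> card {x \<in> pos L. g x} \<le> card {x \<in> pos L. k x}"
    using ex_has_least_nat[of "\<lambda>g. \<exists>\<sigma> p1 p2 p. cutcol \<sigma> p1 p2 p g" _ "\<lambda>g. card {x \<in> pos L. g x}"] by blast
  obtain \<sigma> p1 p2 p where "cutcol \<sigma> p1 p2 p g" using g by blast
  then show ?thesis by (rule minimal_contractible) (use min in blast)
next
  case False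
  then obtain p1 p2 p where "AT p1 p2 p \<in># L" using assms by blast
  then show ?thesis by (rule contractible_tensor[of _ _ _ p]) (use False in \<open>auto simp: near_def\<close>)
qed

end

section \<open>Sequentialization by contraction\<close>

text \<open>Cut-free derivations with formulas read off a labelling of the positions and with
  unordered conclusions; exchanges appear when they are turned into proofs.\<close>

inductive deriv :: "('p \<Rightarrow> 'v form) \<Rightarrow> 'p alink multiset \<Rightarrow> 'p multiset \<Rightarrow> bool" for \<phi> where
  deriv_daimon: "simple_mset ps \<Longrightarrow> deriv \<phi> {#AD ps#} ps"
| deriv_par: "deriv \<phi> L (add_mset p (add_mset q cs)) \<Longrightarrow> r \<notin> pos L \<Longrightarrow> \<phi> r = ParF (\<phi> p) (\<phi> q) \<Longrightarrow>
    deriv \<phi> (L + {#AP p q r#}) (add_mset r cs)"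
| deriv_tensor: "deriv \<phi> L (add_mset p cs) \<Longrightarrow> deriv \<phi> M (add_mset q ds) \<Longrightarrow> pos L \<inter> pos M = {} \<Longrightarrow>
    r \<notin> pos L \<union> pos M \<Longrightarrow> \<phi> r = TensorF (\<phi> p) (\<phi> q) \<Longrightarrow>
    deriv \<phi> (L + M + {#AT p q r#}) (add_mset r (cs + ds))"

lemma union_single_cases:
  assumes "L + {#a#} = C + {#b#}" "a \<noteq> b"
  obtains D where "L = D + {#b#}" "C = D + {#a#}"
  by (rule split_disjoint[of L "{#a#}" C "{#b#}"]) (use assms in auto)

text \<open>A daimon rule concluding \<open>ps\<close> can be replaced by any derivation of
  \<open>ps\<close> that meets the rest only there; this is how a contraction is undone.\<close>

lemma deriv_subst:
  assumes "deriv \<phi> N cs" "N = C + {#AD ps#}" "deriv \<phi> M ps" "pos M \<inter> pos C \<subseteq> set_mset ps"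
  shows "deriv \<phi> (C + M) cs"
  using assms
proof (induction arbitrary: C rule: deriv.induct)
  case (deriv_daimon ps')
  then show ?case by (auto simp: add_eq_conv_ex)
next
  case (deriv_par L p q cs r)
  obtain D where D: "L = D + {#AD ps#}" "C = D + {#AP p q r#}"
    using deriv_par.prems(1) by (rule union_single_cases) simp
  have "deriv \<phi> (D + M) (add_mset p (add_mset q cs))"
    by (rule deriv_par.IH[OF D(1) deriv_par.prems(2)]) (use deriv_par.prems(3) D in auto)
  moreover have "r \<notin> pos (D + M)" using deriv_par.hyps(2) deriv_par.prems(3) by (auto simp: D)
  ultimately have "deriv \<phi> (D + M + {#AP p q r#}) (add_mset r cs)"
    using deriv_par.hyps(3) by (rule deriv.deriv_par)
  then show ?case by (simp add: D)
next
  case (deriv_tensor L p cs L' q ds r)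
  obtain D where D: "L + L' = D + {#AD ps#}" "C = D + {#AT p q r#}"
    using deriv_tensor.prems(1) by (rule union_single_cases) simp
  have "(\<exists>E. L = E + {#AD ps#} \<and> D = E + L') \<or> (\<exists>E. L' = E + {#AD ps#} \<and> D = L + E)"
    using union_eq_add_mset[of L L' "AD ps" D] D(1) by auto
  then show ?case
  proof (elim disjE exE conjE)
    fix E assume E: "L = E + {#AD ps#}" "D = E + L'"
    have "deriv \<phi> (E + M) (add_mset p cs)"
      by (rule deriv_tensor.IH(1)[OF E(1) deriv_tensor.prems(2)]) (use deriv_tensor.prems(3) D E in auto)
    then have "deriv \<phi> (E + M + L' + {#AT p q r#}) (add_mset r (cs + ds))"
      by (rule deriv.deriv_tensor[OF _ deriv_tensor.hyps(2)])
        (use deriv_tensor.hyps deriv_tensor.prems(3) in \<open>auto simp: D E\<close>)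
    then show ?thesis by (simp add: D E add_ac)
  next
    fix E assume E: "L' = E + {#AD ps#}" "D = L + E"
    have "deriv \<phi> (E + M) (add_mset q ds)"
      by (rule deriv_tensor.IH(2)[OF E(1) deriv_tensor.prems(2)]) (use deriv_tensor.prems(3) D E in auto)
    then have "deriv \<phi> (L + (E + M) + {#AT p q r#}) (add_mset r (cs + ds))"
      by (rule deriv.deriv_tensor[OF deriv_tensor.hyps(1)])
        (use deriv_tensor.hyps deriv_tensor.prems(3) in \<open>auto simp: D E\<close>)
    then show ?thesis by (simp add: D E add_ac)
  qed
qed

lemma obeys_cong: "(\<And>x. x \<in># asrc l \<Longrightarrow> U x = V x) \<Longrightarrow> (\<And>x. x \<in># atgt l \<Longrightarrow> U x = V x) \<Longrightarrow> obeys \<sigma> U l = obeys \<sigma> V l"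
proof (cases l)
  case (AD ps)
  assume "\<And>x. x \<in># atgt l \<Longrightarrow> U x = V x"
  then have "U x = V x" if "x \<in># ps" for x using that AD by simp
  then have "(\<forall>x\<in>#ps. U x = b) = (\<forall>x\<in>#ps. V x = b)" for b by simp
  then show ?thesis by (simp add: AD const_on_alt)
qed (auto simp: prem_def)

text \<open>\<open>E\<close> holds the positions hidden inside \<open>X\<close>, and
  \<open>d\<close> is its interface. A colouring constant on the interface extends to the inside,
  and one obeying \<open>X\<close> is constant on the interface, so a daimon on \<open>d\<close>
  constrains the outside just as \<open>X\<close> does.\<close>

lemma corr_replace:
  assumes corr: "corr \<sigma> (C + X)" and E: "pos C \<inter> E = {}" "set_mset d \<inter> E = {}" "set_mset d \<subseteq> pos X"
    and ext: "\<And>U. const_on U (set_mset d) \<Longrightarrow> \<exists>V. (\<forall>x. x \<notin> E \<longrightarrow> V x = U x) \<and> (\<forall>l\<in>#X. obeys \<sigma> V l)"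
    and res: "\<And>U. (\<forall>l\<in>#X. obeys \<sigma> U l) \<Longrightarrow> const_on U (set_mset d)"
    and X: "\<And>l. l \<in># C \<Longrightarrow> atgt l \<noteq> {#} \<Longrightarrow> l \<notin># X"
  shows "corr \<sigma> (C + {#AD d#})"
proof -
  have res': "obeys \<sigma> U l" if U: "\<forall>l\<in>#C + X. l \<noteq> k \<longrightarrow> obeys \<sigma> U l" and k: "k \<in># C" "atgt k \<noteq> {#}"
    and l: "l \<in># C + {#AD d#}" "l \<noteq> k" for U l k
  proof (cases "l \<in># C")
    case True then show ?thesis using U l by simp
  next
    case False
    then have "l = AD d" using l by simp
    moreover have "\<forall>l\<in>#X. obeys \<sigma> U l" using U X[OF k] by auto
    ultimately show ?thesis using res by simp
  qed
  show ?thesis unfolding corr_def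
  proof (intro conjI allI impI)
    fix U assume U: "\<forall>l\<in>#C + {#AD d#}. obeys \<sigma> U l"
    then have "const_on U (set_mset d)" by simp
    then obtain V where V: "\<forall>x. x \<notin> E \<longrightarrow> V x = U x" "\<forall>l\<in>#X. obeys \<sigma> V l" using ext by blast
    have "obeys \<sigma> V l" if l: "l \<in># C" for l
    proof -
      have "set_mset (asrc l) \<subseteq> pos C" "set_mset (atgt l) \<subseteq> pos C" using multi_member_split[OF l] by auto
      then have "obeys \<sigma> V l = obeys \<sigma> U l" using V(1) E(1) by (intro obeys_cong) blast+
      then show ?thesis using U l by simp
    qed
    then have "\<forall>l\<in>#C + X. obeys \<sigma> V l" using V(2) by auto
    then have c: "const_on V (pos (C + X))" using corr unfolding corr_def by blast
    show "const_on U (pos (C + {#AD d#}))" unfolding const_on_def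
    proof (intro ballI)
      fix x y assume "x \<in> pos (C + {#AD d#})" "y \<in> pos (C + {#AD d#})"
      then have "x \<in> pos (C + X)" "y \<in> pos (C + X)" "x \<notin> E" "y \<notin> E" using E by auto
      then show "U x = U y" using const_onD[OF c, of x y] V(1) by simp
    qed
  next
    fix p1 p2 p assume "AP p1 p2 p \<in># C + {#AD d#}"
    then have k: "AP p1 p2 p \<in># C" by simp
    then have "AP p1 p2 p \<in># C + X" by simp
    then obtain U where "\<forall>l\<in>#C + X. l \<noteq> AP p1 p2 p \<longrightarrow> obeys \<sigma> U l" "U (prem \<sigma> p1 p2 p) \<noteq> U p"
      using corr unfolding corr_def by blast
    then show "\<exists>U. (\<forall>l\<in>#C + {#AD d#}. l \<noteq> AP p1 p2 p \<longrightarrow> obeys \<sigma> U l) \<and> U (prem \<sigma> p1 p2 p) \<noteq> U p"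
      using res'[OF _ k] by (intro exI[of _ U]) simp
  next
    fix p1 p2 p assume "AT p1 p2 p \<in># C + {#AD d#}"
    then have k: "AT p1 p2 p \<in># C" by simp
    then have "AT p1 p2 p \<in># C + X" by simp
    then obtain U where "\<forall>l\<in>#C + X. l \<noteq> AT p1 p2 p \<longrightarrow> obeys \<sigma> U l" "U p1 \<noteq> U p2"
      using corr unfolding corr_def by blast
    then show "\<exists>U. (\<forall>l\<in>#C + {#AD d#}. l \<noteq> AT p1 p2 p \<longrightarrow> obeys \<sigma> U l) \<and> U p1 \<noteq> U p2"
      using res'[OF _ k] by (intro exI[of _ U]) simp
  qed
qed

definition labelled :: "('p \<Rightarrow> 'v form) \<Rightarrow> 'p alink multiset \<Rightarrow> bool" where
  "labelled \<phi> L \<longleftrightarrow> (\<forall>p q r. (AT p q r \<in># L \<longrightarrow> \<phi> r = TensorF (\<phi> p) (\<phi> q)) \<and>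
     (AP p q r \<in># L \<longrightarrow> \<phi> r = ParF (\<phi> p) (\<phi> q)))"

text \<open>Contraction decreases the number of links. A daimon without outputs has no position, so
  no colouring sees it; the last hypothesis keeps it from standing beside other links.\<close>

lemma corr_deriv:
  assumes "anet L cs" "ranked h L" "\<And>\<sigma>. corr \<sigma> L" "\<And>ps. AC ps \<notin># L" "labelled \<phi> L" "L \<noteq> {#}"
    "AD {#} \<in># L \<Longrightarrow> L = {#AD {#}#}"
  shows "deriv \<phi> L cs"
  using assms
proof (induction "size L" arbitrary: L rule: less_induct)
  case less
  note net = less.prems(1)
  note s = anet_simple[OF net]
  show ?case
  proof (cases "(\<exists>p1 p2 p. AT p1 p2 p \<in># L) \<or> (\<exists>p1 p2 p. AP p1 p2 p \<in># L)")
    case False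
    have ad: "\<exists>ps. l = AD ps" if "l \<in># L" for l using that False less.prems(4) by (cases l) auto
    obtain l where "l \<in># L" using less.prems(6) by (metis multiset_nonemptyE)
    then obtain a where "AD a \<in># L" using ad by blast
    then obtain M where M: "L = add_mset (AD a) M" by (metis mset_add)
    have "M = {#}"
    proof (rule ccontr)
      assume "M \<noteq> {#}"
      then obtain k where "k \<in># M" by (metis multiset_nonemptyE)
      then obtain b where b: "AD b \<in># M" using ad M by (metis union_single_eq_member insert_iff set_mset_add_mset_insert)
      then obtain K where K: "M = add_mset (AD b) K" by (metis mset_add)
      have "a \<noteq> {#}" "b \<noteq> {#}" using less.prems(7) b M by auto
      then obtain x y where xy: "x \<in># a" "y \<in># b" by (metis multiset_nonemptyE)
      \<comment> \<open>Colouring exactly the outputs of \<open>a\<close> obeys all links when only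
        daimons are left, so connectedness admits no second daimon.\<close>
      have "obeys (\<lambda>_. True) (\<lambda>z. z \<in># a) l" if l: "l \<in># L" for l
      proof -
        obtain e where e: "l = AD e" using ad l by blast
        show ?thesis
        proof (cases "e = a")
          case True then show ?thesis by (simp add: e const_on_def)
        next
          case False
          have "z \<notin># a" if "z \<in># e" for z
            using unique_target[OF net l, of "AD a" z] e that False M by auto
          then show ?thesis by (simp add: e const_on_def)
        qed
      qed
      then have c: "const_on (\<lambda>z. z \<in># a) (pos L)" using less.prems(3)[of "\<lambda>_. True"] unfolding corr_def by blast
      have "(x \<in># a) = (y \<in># a)" by (rule const_onD[OF c]) (use xy M K in auto)
      moreover have "y \<notin># a" using s xy by (auto simp: M K simple_mset_add)
      ultimately show False using xy by simp
    qed
    then have L: "L = {#AD a#}" "cs = a" using net M by (auto simp: anet_def)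
    then show ?thesis using s by (auto intro: deriv_daimon)
  next
    case True
    have "contractible L" by (rule exists_contractible[OF net less.prems(2,3) True])
    then show ?thesis unfolding contractible_def
    proof (elim disjE exE)
      fix p1 p2 p ds es C
      assume L: "L = C + {#AT p1 p2 p, AD (add_mset p1 ds), AD (add_mset p2 es)#}" (is "L = C + ?X")
      let ?d = "add_mset p (ds + es)"
      let ?L = "C + {#AD ?d#}"
      have fr: "p1 \<notin> pos C" "p2 \<notin> pos C" "p \<notin># tgt C" "p1 \<noteq> p" "p2 \<noteq> p" "p1 \<noteq> p2" "p1 \<notin># ds + es" "p2 \<notin># ds + es" "p \<notin># ds + es"
        "simple_mset ds" "simple_mset es" "set_mset ds \<inter> set_mset es = {}"
        using s by (auto simp: L pos_def simple_mset_add disjoint_iff)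
      have n: "anet ?L cs"
        using net by (auto simp: L anet_def wf_link_def simple_mset_add add_mset_commute)
      have c: "corr \<sigma> ?L" for \<sigma>
      proof (rule corr_replace[where X = ?X and E = "{p1, p2}"])
        show "corr \<sigma> (C + ?X)" using less.prems(3) L by simp
        show "\<exists>V. (\<forall>x. x \<notin> {p1, p2} \<longrightarrow> V x = U x) \<and> (\<forall>l\<in>#?X. obeys \<sigma> V l)" if U: "const_on U (set_mset ?d)" for U
        proof -
          define V where "V = U(p1 := U p, p2 := U p)"
          have V: "V p1 = U p" "V p2 = U p" "\<And>x. x \<noteq> p1 \<Longrightarrow> x \<noteq> p2 \<Longrightarrow> V x = U x" using fr by (auto simp: V_def)
          have Vd: "V x = U p" if "x \<in># ds + es" for x
          proof -
            have "V x = U x" by (rule V(3)) (use fr that in auto)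
            also have "\<dots> = U p" by (rule const_onD[OF U]) (use that in auto)
            finally show ?thesis .
          qed
          have "V p = U p" using V(3)[of p] fr by auto
          moreover have "const_on V (set_mset (add_mset p1 ds))" "const_on V (set_mset (add_mset p2 es))"
            by (rule const_onI[of _ _ "U p"]; use V(1,2) Vd in auto)+
          ultimately show ?thesis using V by (intro exI[of _ V]) simp
        qed
        show "const_on U (set_mset ?d)" if U: "\<forall>l\<in>#?X. obeys \<sigma> U l" for U
        proof (rule const_onI[of _ _ "U p"])
          fix x assume x: "x \<in># ?d"
          have a: "U p1 = U p" "U p2 = U p" "const_on U (set_mset (add_mset p1 ds))" "const_on U (set_mset (add_mset p2 es))"
            using U by simp_all
          from x consider "x = p" | "x \<in># ds" | "x \<in># es" by auto
          then show "U x = U p" using a const_onD[OF a(3), of x p1] const_onD[OF a(4), of x p2] by cases simp_all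
        qed
        show "l \<notin># ?X" if lC: "l \<in># C" "atgt l \<noteq> {#}" for l
        proof
          assume "l \<in># ?X"
          then obtain Y where Y: "?X = add_mset l Y" by (metis mset_add)
          obtain D where D: "C = add_mset l D" using lC(1) by (metis mset_add)
          have "L = D + Y + {#l, l#}" using L D Y by simp
          then have "simple_mset (atgt l + atgt l)" using s by (simp add: simple_mset_add)
          then show False using lC(2) by (simp add: simple_mset_add)
        qed
      qed (use fr in auto)
      have "labelled \<phi> ?L" "ranked h ?L" "\<And>ps. AC ps \<notin># ?L" "AD {#} \<in># ?L \<Longrightarrow> ?L = {#AD {#}#}"
        using less.prems(2,4,5,7) by (auto simp: L labelled_def)
      then have "deriv \<phi> ?L cs" using n c by (intro less.hyps) (auto simp: L)
      moreover have "deriv \<phi> ({#AD (add_mset p1 ds)#} + {#AD (add_mset p2 es)#} + {#AT p1 p2 p#}) ?d"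
        using fr less.prems(5) by (intro deriv_tensor deriv_daimon) (auto simp: labelled_def L)
      ultimately have "deriv \<phi> (C + ({#AD (add_mset p1 ds)#} + {#AD (add_mset p2 es)#} + {#AT p1 p2 p#})) cs"
        by (rule deriv_subst[OF _ refl]) (use fr in auto)
      then show ?thesis by (simp add: L add_mset_commute)
    next
      fix p1 p2 p ds C
      assume L: "L = C + {#AP p1 p2 p, AD (add_mset p1 (add_mset p2 ds))#}" (is "L = C + ?X")
      let ?d = "add_mset p ds"
      let ?L = "C + {#AD ?d#}"
      have fr: "p1 \<notin> pos C" "p2 \<notin> pos C" "p \<notin># tgt C" "p1 \<noteq> p" "p2 \<noteq> p" "p1 \<noteq> p2" "p1 \<notin># ds" "p2 \<notin># ds" "p \<notin># ds"
        "simple_mset ds"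
        using s by (auto simp: L pos_def simple_mset_add disjoint_iff)
      have n: "anet ?L cs"
        using net by (auto simp: L anet_def wf_link_def simple_mset_add add_mset_commute)
      have c: "corr \<sigma> ?L" for \<sigma>
      proof (rule corr_replace[where X = ?X and E = "{p1, p2}"])
        show "corr \<sigma> (C + ?X)" using less.prems(3) L by simp
        show "\<exists>V. (\<forall>x. x \<notin> {p1, p2} \<longrightarrow> V x = U x) \<and> (\<forall>l\<in>#?X. obeys \<sigma> V l)" if U: "const_on U (set_mset ?d)" for U
        proof -
          define V where "V = U(p1 := U p, p2 := U p)"
          have V: "V p1 = U p" "V p2 = U p" "\<And>x. x \<noteq> p1 \<Longrightarrow> x \<noteq> p2 \<Longrightarrow> V x = U x" using fr by (auto simp: V_def)
          have Vd: "V x = U p" if "x \<in># ds" for x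
          proof -
            have "V x = U x" by (rule V(3)) (use fr that in auto)
            also have "\<dots> = U p" by (rule const_onD[OF U]) (use that in auto)
            finally show ?thesis .
          qed
          have "V p = U p" using V(3)[of p] fr by auto
          moreover have "const_on V (set_mset (add_mset p1 (add_mset p2 ds)))"
            by (rule const_onI[of _ _ "U p"]) (use V(1,2) Vd in auto)
          ultimately show ?thesis using V by (intro exI[of _ V]) (simp add: prem_def)
        qed
        show "const_on U (set_mset ?d)" if U: "\<forall>l\<in>#?X. obeys \<sigma> U l" for U
        proof (rule const_onI[of _ _ "U p"])
          fix x assume x: "x \<in># ?d"
          have a: "U (prem \<sigma> p1 p2 p) = U p" "const_on U (set_mset (add_mset p1 (add_mset p2 ds)))"
            using U by simp_all
          have "prem \<sigma> p1 p2 p \<in># add_mset p1 (add_mset p2 ds)" by (simp add: prem_def)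
          then show "U x = U p" using x a(1) const_onD[OF a(2), of x "prem \<sigma> p1 p2 p"] by auto
        qed
        show "l \<notin># ?X" if lC: "l \<in># C" "atgt l \<noteq> {#}" for l
        proof
          assume "l \<in># ?X"
          then obtain Y where Y: "?X = add_mset l Y" by (metis mset_add)
          obtain D where D: "C = add_mset l D" using lC(1) by (metis mset_add)
          have "L = D + Y + {#l, l#}" using L D Y by simp
          then have "simple_mset (atgt l + atgt l)" using s by (simp add: simple_mset_add)
          then show False using lC(2) by (simp add: simple_mset_add)
        qed
      qed (use fr in auto)
      have "labelled \<phi> ?L" "ranked h ?L" "\<And>ps. AC ps \<notin># ?L" "AD {#} \<in># ?L \<Longrightarrow> ?L = {#AD {#}#}"
        using less.prems(2,4,5,7) by (auto simp: L labelled_def)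
      then have "deriv \<phi> ?L cs" using n c by (intro less.hyps) (auto simp: L)
      moreover have "deriv \<phi> ({#AD (add_mset p1 (add_mset p2 ds))#} + {#AP p1 p2 p#}) ?d"
        using fr less.prems(5) by (intro deriv_par deriv_daimon) (auto simp: labelled_def L)
      ultimately have "deriv \<phi> (C + ({#AD (add_mset p1 (add_mset p2 ds))#} + {#AP p1 p2 p#})) cs"
        by (rule deriv_subst[OF _ refl]) (use fr in auto)
      then show ?thesis by (simp add: L add_mset_commute)
    qed
  qed
qed

subsection \<open>Ordered derivations\<close>

text \<open>Each element of the target list in turn is carried to its place by adjacent
  exchanges.\<close>

lemma perm_induct:
  assumes swap: "\<And>xs ys x y. P (xs @ x # y # ys) \<Longrightarrow> P (xs @ y # x # ys)"
    and "P xs" "mset xs = mset ys"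
  shows "P ys"
proof -
  have move: "P (zs @ us @ y # vs) \<Longrightarrow> P (zs @ y # us @ vs)" for zs us y vs
  proof (induction us arbitrary: vs rule: rev_induct)
    case (snoc u us)
    then have "P ((zs @ us) @ u # y # vs)" by simp
    then have "P ((zs @ us) @ y # u # vs)" by (rule swap)
    then show ?case using snoc.IH[of "u # vs"] by simp
  qed simp
  have "P (zs @ xs) \<Longrightarrow> mset xs = mset ys \<Longrightarrow> P (zs @ ys)" for zs
  proof (induction ys arbitrary: zs xs)
    case (Cons y ys)
    then have "y \<in> set xs" by (metis list.set_intros(1) mset_eq_setD)
    then obtain us vs where xs: "xs = us @ y # vs" by (metis split_list)
    have "P (zs @ y # us @ vs)" using move Cons.prems(1) xs by simp
    then have "P ((zs @ [y]) @ (us @ vs))" by simp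
    moreover have "mset (us @ vs) = mset ys" using Cons.prems(2) xs by simp
    ultimately show ?case using Cons.IH[of "zs @ [y]"] by simp
  qed simp
  from this[of "[]"] assms show ?thesis by simp
qed

lemma derives_perm:
  assumes "derives dual (Net L cs) (map \<phi> cs)" "mset cs = mset ds"
  shows "derives dual (Net L ds) (map \<phi> ds)"
proof (rule perm_induct[of "\<lambda>cs. derives dual (Net L cs) (map \<phi> cs)", OF _ assms])
  fix xs ys x y assume "derives dual (Net L (xs @ x # y # ys)) (map \<phi> (xs @ x # y # ys))"
  then obtain \<pi> where p: "proof_of dual \<pi> (map \<phi> xs @ [\<phi> x, \<phi> y] @ map \<phi> ys)"
    and r: "represents (Net L (xs @ [x, y] @ ys)) \<pi>"
    unfolding derives_def by auto
  have "proof_of dual (ExR (length xs) \<pi>) (map \<phi> xs @ [\<phi> y, \<phi> x] @ map \<phi> ys)"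
    using proof_of.intros(5)[OF p] by simp
  with represents.intros(5)[OF r] show "derives dual (Net L (xs @ y # x # ys)) (map \<phi> (xs @ y # x # ys))"
    unfolding derives_def by auto
qed

text \<open>The rules want their active conclusions at the end of the list; any other order is
  reached through \<open>derives_perm\<close>.\<close>

lemma deriv_derives:
  assumes "deriv \<phi> N cs" "alinks L = N" "mset ds = cs"
  shows "derives dual (Net L ds) (map \<phi> ds)"
  using assms
proof (induction arbitrary: L ds rule: deriv.induct)
  case (deriv_daimon ps)
  obtain l L' where "L = add_mset l L'" "unord l = AD ps" "alinks L' = {#}"
    using alinks_add_mset[OF deriv_daimon(2)] by blast
  then obtain xs where xs: "L = {#Daimon xs#}" "mset xs = ps" by (auto simp: alinks_def)
  then have "distinct xs" using deriv_daimon(1) by auto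
  then have "derives dual (Net L xs) (map \<phi> xs)" unfolding derives_def xs(1)
    by (intro exI[of _ "DaimonR (map \<phi> xs)"] conjI proof_of.intros(1) represents.intros(1)) simp_all
  then show ?case by (rule derives_perm) (use xs deriv_daimon in simp)
next
  case (deriv_par N p q cs r)
  have "alinks L = add_mset (AP p q r) N" using deriv_par.prems by simp
  then obtain l L' where L: "L = add_mset l L'" "unord l = AP p q r" "alinks L' = N" using alinks_add_mset by blast
  obtain xs where xs: "mset xs = cs" using ex_mset by blast
  have "derives dual (Net L' (xs @ [p, q])) (map \<phi> (xs @ [p, q]))"
    by (rule deriv_par.IH[OF L(3)]) (simp add: xs)
  then obtain \<pi> where p: "proof_of dual \<pi> (map \<phi> xs @ [\<phi> p, \<phi> q])" and r: "represents (Net L' (xs @ [p, q])) \<pi>"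
    unfolding derives_def by auto
  have "r \<notin> positions L'" using deriv_par.hyps(2) L(3) pos_alinks by metis
  from represents.intros(2)[OF r this] proof_of.intros(2)[OF p]
  have "derives dual (Net L (xs @ [r])) (map \<phi> (xs @ [r]))"
    unfolding derives_def using L deriv_par.hyps(3) by auto
  then show ?case by (rule derives_perm) (use xs deriv_par.prems in simp)
next
  case (deriv_tensor N p cs M q ds' r)
  have "alinks L = add_mset (AT p q r) (N + M)" using deriv_tensor.prems by simp
  then obtain l L' where L: "L = add_mset l L'" "unord l = AT p q r" "alinks L' = N + M" using alinks_add_mset by blast
  then obtain L1 L2 where L12: "L' = L1 + L2" "alinks L1 = N" "alinks L2 = M"
    unfolding alinks_def by (metis image_mset_eq_plusD)
  obtain xs where xs: "mset xs = cs" using ex_mset by blast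
  obtain ys where ys: "mset ys = ds'" using ex_mset by blast
  have "derives dual (Net L1 (xs @ [p])) (map \<phi> (xs @ [p]))" "derives dual (Net L2 (ys @ [q])) (map \<phi> (ys @ [q]))"
    by (rule deriv_tensor.IH(1)[OF L12(2)], simp add: xs) (rule deriv_tensor.IH(2)[OF L12(3)], simp add: ys)
  then obtain \<pi> \<rho> where p: "proof_of dual \<pi> (map \<phi> xs @ [\<phi> p])" "proof_of dual \<rho> (map \<phi> ys @ [\<phi> q])"
    and r: "represents (Net L1 (xs @ [p])) \<pi>" "represents (Net L2 (ys @ [q])) \<rho>"
    unfolding derives_def by auto
  have "positions L1 \<inter> positions L2 = {}" "r \<notin> positions L1 \<union> positions L2"
    using deriv_tensor.hyps L12 pos_alinks by metis+
  from represents.intros(3)[OF r this] proof_of.intros(3)[OF p]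
  have "derives dual (Net L (xs @ ys @ [r])) (map \<phi> (xs @ ys @ [r]))"
    unfolding derives_def using L L12 deriv_tensor.hyps(5) by auto
  then show ?case by (rule derives_perm) (use xs ys deriv_tensor.prems in simp)
qed

section \<open>Groups of conclusions\<close>

text \<open>
  Besides its links, a net under test has one more node for each group of conclusions,
  standing for the test plugged there. The second condition cuts the edge from conclusion
  \<open>x\<close> to the node of its group.
\<close>

definition tree :: "('p \<Rightarrow> bool) \<Rightarrow> 'p alink multiset \<Rightarrow> 'p set set \<Rightarrow> bool" where
  "tree \<sigma> L \<G> \<longleftrightarrow>
     (\<forall>U. (\<forall>l\<in>#L. obeys \<sigma> U l) \<longrightarrow> (\<forall>g\<in>\<G>. const_on U g) \<longrightarrow> const_on U (pos L)) \<and>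
     (\<forall>x\<in>\<Union>\<G>. \<exists>U. (\<forall>l\<in>#L. obeys \<sigma> U l) \<and> (\<forall>g\<in>\<G>. const_on (U(x := \<not> U x)) g)) \<and>
     (\<forall>p1 p2 p. AP p1 p2 p \<in># L \<longrightarrow>
        (\<exists>U. (\<forall>l\<in>#L. l \<noteq> AP p1 p2 p \<longrightarrow> obeys \<sigma> U l) \<and> U (prem \<sigma> p1 p2 p) \<noteq> U p \<and> (\<forall>g\<in>\<G>. const_on U g))) \<and>
     (\<forall>p1 p2 p. AT p1 p2 p \<in># L \<longrightarrow>
        (\<exists>U. (\<forall>l\<in>#L. l \<noteq> AT p1 p2 p \<longrightarrow> obeys \<sigma> U l) \<and> U p1 \<noteq> U p2 \<and> (\<forall>g\<in>\<G>. const_on U g)))"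

lemma treeD1: "tree \<sigma> L \<G> \<Longrightarrow> (\<And>l. l \<in># L \<Longrightarrow> obeys \<sigma> U l) \<Longrightarrow> (\<And>g. g \<in> \<G> \<Longrightarrow> const_on U g) \<Longrightarrow> const_on U (pos L)"
  unfolding tree_def by blast

lemma treeD2: "tree \<sigma> L \<G> \<Longrightarrow> x \<in> g \<Longrightarrow> g \<in> \<G> \<Longrightarrow> \<exists>U. (\<forall>l\<in>#L. obeys \<sigma> U l) \<and> (\<forall>g\<in>\<G>. const_on (U(x := \<not> U x)) g)"
  unfolding tree_def by blast

lemma treeD3: "tree \<sigma> L \<G> \<Longrightarrow> AP p1 p2 p \<in># L \<Longrightarrow>
  \<exists>U. (\<forall>l\<in>#L. l \<noteq> AP p1 p2 p \<longrightarrow> obeys \<sigma> U l) \<and> U (prem \<sigma> p1 p2 p) \<noteq> U p \<and> (\<forall>g\<in>\<G>. const_on U g)"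
  unfolding tree_def by blast

lemma treeD4: "tree \<sigma> L \<G> \<Longrightarrow> AT p1 p2 p \<in># L \<Longrightarrow>
  \<exists>U. (\<forall>l\<in>#L. l \<noteq> AT p1 p2 p \<longrightarrow> obeys \<sigma> U l) \<and> U p1 \<noteq> U p2 \<and> (\<forall>g\<in>\<G>. const_on U g)"
  unfolding tree_def by blast

text \<open>A group of one conclusion constrains no colouring: the node added for its test is a
  leaf.\<close>

lemma tree_corr:
  assumes "tree \<sigma> L \<G>" "\<And>g. g \<in> \<G> \<Longrightarrow> \<exists>x. g = {x}"
  shows "corr \<sigma> L"
proof -
  have c: "const_on U g" if "g \<in> \<G>" for U g
    using assms(2)[OF that] by (auto simp: const_on_def)
  show ?thesis unfolding corr_def
  proof (intro conjI allI impI)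
    fix U assume U: "\<forall>l\<in>#L. obeys \<sigma> U l"
    show "const_on U (pos L)" by (rule treeD1[OF assms(1)]) (use U c in simp_all)
  next
    fix p1 p2 p assume "AP p1 p2 p \<in># L"
    from treeD3[OF assms(1) this]
    show "\<exists>U. (\<forall>l\<in>#L. l \<noteq> AP p1 p2 p \<longrightarrow> obeys \<sigma> U l) \<and> U (prem \<sigma> p1 p2 p) \<noteq> U p"
      by (elim exE conjE) (intro exI conjI)
  next
    fix p1 p2 p assume "AT p1 p2 p \<in># L"
    from treeD4[OF assms(1) this]
    show "\<exists>U. (\<forall>l\<in>#L. l \<noteq> AT p1 p2 p \<longrightarrow> obeys \<sigma> U l) \<and> U p1 \<noteq> U p2"
      by (elim exE conjE) (intro exI conjI)
  qed
qed

lemma const_on_upd: "p \<notin> A \<Longrightarrow> const_on (U(p := b)) A = const_on U A"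
proof -
  assume "p \<notin> A"
  then have "(U(p := b)) x = U x" if "x \<in> A" for x using that by auto
  then have "(\<forall>x\<in>A. (U(p := b)) x = c) = (\<forall>x\<in>A. U x = c)" for c by (intro ball_cong refl) simp
  then show ?thesis by (simp only: const_on_alt)
qed

lemma obeys_upd_fresh: "l \<in># L \<Longrightarrow> p \<notin> pos L \<Longrightarrow> obeys \<sigma> (U(p := b)) l = obeys \<sigma> U l"
  by (rule obeys_cong) (auto dest!: multi_member_split)

context
  fixes \<sigma> :: "'p \<Rightarrow> bool" and L :: "'p alink multiset" and A :: "'p set" and \<G> :: "'p set set" and p1 p2 p :: 'p
  assumes p: "p \<notin> pos L" "p \<notin> A" "p \<notin> \<Union>\<G>" "p \<noteq> p1" "p \<noteq> p2"
    and pL: "p1 \<in> pos L" "p2 \<in> pos L"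
begin

text \<open>The node of the group is divided in two: a tensor node keeping \<open>p1\<close> and
  \<open>p2\<close>, and a group node keeping \<open>A\<close>, joined through the new position
  \<open>p\<close>.\<close>

lemma tree_AT:
  assumes t: "tree \<sigma> L (insert (insert p1 (insert p2 A)) \<G>)" (is "tree \<sigma> L ?H")
    and d: "p1 \<noteq> p2" "p1 \<notin> A" "p2 \<notin> A" "p1 \<notin> \<Union>\<G>" "p2 \<notin> \<Union>\<G>"
  shows "tree \<sigma> (L + {#AT p1 p2 p#}) (insert (insert p A) \<G>)" (is "tree \<sigma> ?L ?G")
proof -
  have ob: "obeys \<sigma> (U(p := b)) l = obeys \<sigma> U l" if "l \<in># L" for U b l
    by (rule obeys_upd_fresh[OF that p(1)])
  have up1: "(U(p := b)) p1 = U p1" "(U(p := b)) p2 = U p2" for U and b :: bool using p by auto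
  have obT: "obeys \<sigma> (U(p := U p1)) l" if l: "l \<in># ?L" "\<And>k. k \<in># L \<Longrightarrow> k = l \<Longrightarrow> obeys \<sigma> U k" "U p1 = U p2" for U l
  proof (cases "l \<in># L")
    case True then show ?thesis using ob l(2) by blast
  next
    case False
    then have "l = AT p1 p2 p" using l(1) by auto
    then show ?thesis using up1[of U "U p1"] l(3) by simp
  qed
  have gr: "const_on (U(p := b)) g = const_on U g" if "g \<in> \<G>" for U b g
    by (rule const_on_upd) (use that p(3) in auto)
  have grp: "const_on (U(p := U p1)) (insert p A)" if "const_on U (insert p1 (insert p2 A))" for U
  proof (rule const_onI[of _ _ "U p1"])
    fix x assume "x \<in> insert p A"
    then show "(U(p := U p1)) x = U p1" using const_onD[OF that, of x p1] by auto
  qed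
  have flip: "(U(x := \<not> U x))(p := (U(x := \<not> U x)) p1) = (U(p := U p1))(x := \<not> (U(p := U p1)) x)"
    if "x \<noteq> p" "x \<noteq> p1" for U x using that by (intro ext) simp
  show ?thesis unfolding tree_def
  proof (intro conjI allI impI ballI)
    fix U assume U: "\<forall>l\<in>#?L. obeys \<sigma> U l" "\<forall>g\<in>?G. const_on U g"
    then have e: "U p1 = U p" "U p2 = U p" by auto
    have g: "const_on U (insert p A)" using U(2) by blast
    have "const_on U (insert p1 (insert p2 A))"
    proof (rule const_onI[of _ _ "U p"])
      fix x assume "x \<in> insert p1 (insert p2 A)"
      then show "U x = U p" using const_onD[OF g, of x p] e by auto
    qed
    then have c: "const_on U (pos L)" by (intro treeD1[OF t]) (use U in auto)
    show "const_on U (pos ?L)"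
    proof (rule const_onI[of _ _ "U p1"])
      fix x assume "x \<in> pos ?L"
      then show "U x = U p1" using const_onD[OF c _ pL(1), of x] e by auto
    qed
  next
    fix x assume x: "x \<in> \<Union>?G"
    show "\<exists>U. (\<forall>l\<in>#?L. obeys \<sigma> U l) \<and> (\<forall>g\<in>?G. const_on (U(x := \<not> U x)) g)"
    proof (cases "x = p")
      case True
      obtain U1 where U1: "\<forall>l\<in>#L. obeys \<sigma> U1 l" "\<forall>g\<in>?H. const_on (U1(p1 := \<not> U1 p1)) g"
        using treeD2[OF t, of p1 "insert p1 (insert p2 A)"] by auto
      obtain U2 where U2: "\<forall>l\<in>#L. obeys \<sigma> U2 l" "\<forall>g\<in>?H. const_on (U2(p2 := \<not> U2 p2)) g"
        using treeD2[OF t, of p2 "insert p1 (insert p2 A)"] by auto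
      \<comment> \<open>\<open>U1\<close> cuts off the part behind \<open>p1\<close>,
        \<open>U2\<close> the part behind \<open>p2\<close>; their exclusive or cuts off both
        together, as cutting the edge at \<open>p\<close> must do.\<close>
      define W where "W y = (U1 y \<noteq> U2 y)" for y
      have Wl: "obeys \<sigma> W l" if "l \<in># L" for l
        unfolding W_def using obeys_comp2[of \<sigma> U1 l U2 "(\<noteq>)"] U1(1) U2(1) that by simp
      have Wg: "const_on W g" if "g \<in> \<G>" for g
      proof -
        have "const_on U1 g" "const_on U2 g"
          using U1(2) U2(2) that const_on_upd[of p1 g U1] const_on_upd[of p2 g U2] d by auto
        from const_on_comp2[OF this, of "(\<noteq>)"] show ?thesis unfolding W_def by simp
      qed
      have c1: "const_on (U1(p1 := \<not> U1 p1)) (insert p1 (insert p2 A))" "const_on (U2(p2 := \<not> U2 p2)) (insert p1 (insert p2 A))"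
        using U1(2) U2(2) by auto
      have e1: "U1 y = (\<not> U1 p1)" if "y = p2 \<or> y \<in> A" for y
        using const_onD[OF c1(1), of y p1] that d by (auto split: if_splits)
      have e2: "U2 y = (\<not> U2 p2)" if "y = p1 \<or> y \<in> A" for y
        using const_onD[OF c1(2), of y p2] that d by (auto split: if_splits)
      have W12: "W p1 = W p2" using e1[of p2] e2[of p1] by (simp add: W_def)
      have WA: "W y = (\<not> W p1)" if "y \<in> A" for y using e1[of y] e2[of y] e2[of p1] that by (simp add: W_def)
      define V where "V = W(p := W p1)"
      have "obeys \<sigma> V l" if "l \<in># ?L" for l
        using that Wl ob[of l W "W p1"] W12 up1[of W "W p1"] by (auto simp: V_def)
      moreover have "const_on (V(p := \<not> V p)) g" if "g \<in> ?G" for g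
      proof (cases "g \<in> \<G>")
        case True
        then show ?thesis using gr[of g V] gr[of g W] Wg by (simp add: V_def)
      next
        case False
        then have g: "g = insert p A" using that by simp
        show ?thesis unfolding g
        proof (rule const_onI[of _ _ "\<not> W p1"])
          fix y assume "y \<in> insert p A"
          then show "(V(p := \<not> V p)) y = (\<not> W p1)" using WA[of y] p(2) by (auto simp: V_def)
        qed
      qed
      ultimately show ?thesis unfolding True by (intro exI[of _ V]) blast
    next
      case False
      then have x': "x \<in> A \<or> x \<in> \<Union>\<G>" using x by auto
      have "\<exists>g. x \<in> g \<and> g \<in> ?H" using x'
      proof
        assume "x \<in> A"
        then show ?thesis by (intro exI[of _ "insert p1 (insert p2 A)"]) simp
      next
        assume "x \<in> \<Union>\<G>"
        then obtain g where "g \<in> \<G>" "x \<in> g" by (rule UnionE)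
        then show ?thesis by (intro exI[of _ g]) simp
      qed
      then obtain g where "x \<in> g" "g \<in> ?H" by (elim exE conjE)
      from treeD2[OF t this]
      obtain U where U: "\<forall>l\<in>#L. obeys \<sigma> U l" "\<forall>g\<in>?H. const_on (U(x := \<not> U x)) g"
        by (elim exE conjE)
      have xp: "x \<noteq> p1" "x \<noteq> p2" using x' d by auto
      define W where "W = U(x := \<not> U x)"
      have cW: "const_on W (insert p1 (insert p2 A))" using U(2) by (simp add: W_def)
      have "W p1 = W p2" by (rule const_onD[OF cW]) auto
      then have e: "U p1 = U p2" using xp by (simp add: W_def)
      define V where "V = U(p := U p1)"
      have VW: "V(x := \<not> V x) = W(p := W p1)" unfolding V_def W_def by (rule flip[OF False xp(1), symmetric])
      have "obeys \<sigma> V l" if "l \<in># ?L" for l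
        unfolding V_def by (rule obT) (use that U(1) e in blast)+
      moreover have "const_on (V(x := \<not> V x)) g" if "g \<in> ?G" for g
        unfolding VW using that grp[OF cW] gr[of g W] U(2) by (auto simp: W_def)
      ultimately show ?thesis by blast
    qed
  next
    fix q1 q2 q assume "AP q1 q2 q \<in># ?L"
    then have k: "AP q1 q2 q \<in># L" by simp
    obtain U where U: "\<forall>l\<in>#L. l \<noteq> AP q1 q2 q \<longrightarrow> obeys \<sigma> U l" "U (prem \<sigma> q1 q2 q) \<noteq> U q" "\<forall>g\<in>?H. const_on U g"
      using treeD3[OF t k] by (elim exE conjE)
    define V where "V = U(p := U p1)"
    have c: "const_on U (insert p1 (insert p2 A))" using U(3) by simp
    have e: "U p1 = U p2" by (rule const_onD[OF c]) auto
    have q: "q \<noteq> p" "q1 \<noteq> p" "q2 \<noteq> p" using k p(1) by (auto dest!: multi_member_split)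
    have "obeys \<sigma> V l" if "l \<in># ?L" "l \<noteq> AP q1 q2 q" for l
      unfolding V_def by (rule obT) (use that U(1) e in blast)+
    moreover have "V (prem \<sigma> q1 q2 q) \<noteq> V q" using U(2) q by (auto simp: V_def prem_def)
    moreover have "const_on V g" if "g \<in> ?G" for g
      using that grp[OF c] gr[of g U] U(3) by (auto simp: V_def)
    ultimately show "\<exists>U. (\<forall>l\<in>#?L. l \<noteq> AP q1 q2 q \<longrightarrow> obeys \<sigma> U l) \<and> U (prem \<sigma> q1 q2 q) \<noteq> U q \<and> (\<forall>g\<in>?G. const_on U g)"
      by blast
  next
    fix q1 q2 q assume a: "AT q1 q2 q \<in># ?L"
    show "\<exists>U. (\<forall>l\<in>#?L. l \<noteq> AT q1 q2 q \<longrightarrow> obeys \<sigma> U l) \<and> U q1 \<noteq> U q2 \<and> (\<forall>g\<in>?G. const_on U g)"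
    proof (cases "AT q1 q2 q = AT p1 p2 p")
      case True
      obtain U where U: "\<forall>l\<in>#L. obeys \<sigma> U l" "\<forall>g\<in>?H. const_on (U(p1 := \<not> U p1)) g"
        using treeD2[OF t, of p1 "insert p1 (insert p2 A)"] by auto
      have c: "const_on (U(p1 := \<not> U p1)) (insert p1 (insert p2 A))" using U(2) by simp
      have e: "U y = (\<not> U p1)" if "y = p2 \<or> y \<in> A" for y
        using const_onD[OF c, of y p1] that d by (auto split: if_splits)
      define V where "V = U(p := U p2)"
      have "obeys \<sigma> V l" if "l \<in># ?L" "l \<noteq> AT q1 q2 q" for l
        using that True U(1) ob[of l U "U p2"] by (auto simp: V_def)
      moreover have "V q1 \<noteq> V q2" using True e[of p2] p by (auto simp: V_def)
      moreover have "const_on V g" if "g \<in> ?G" for g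
      proof (cases "g \<in> \<G>")
        case True
        have "const_on U g" using U(2) True const_on_upd[of p1 g U] d by auto
        then show ?thesis using gr[OF True] by (simp add: V_def)
      next
        case False
        then have g: "g = insert p A" using that by simp
        show ?thesis unfolding g
        proof (rule const_onI[of _ _ "\<not> U p1"])
          fix y assume "y \<in> insert p A"
          then show "V y = (\<not> U p1)" using e[of y] e[of p2] by (auto simp: V_def)
        qed
      qed
      ultimately show ?thesis by blast
    next
      case False
      then have k: "AT q1 q2 q \<in># L" using a by auto
      obtain U where U: "\<forall>l\<in>#L. l \<noteq> AT q1 q2 q \<longrightarrow> obeys \<sigma> U l" "U q1 \<noteq> U q2" "\<forall>g\<in>?H. const_on U g"
        using treeD4[OF t k] by (elim exE conjE)
      define V where "V = U(p := U p1)"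
      have c: "const_on U (insert p1 (insert p2 A))" using U(3) by simp
      have e: "U p1 = U p2" by (rule const_onD[OF c]) auto
      have q: "q1 \<noteq> p" "q2 \<noteq> p" using k p(1) by (auto dest!: multi_member_split)
      have "obeys \<sigma> V l" if "l \<in># ?L" "l \<noteq> AT q1 q2 q" for l
        unfolding V_def by (rule obT) (use that U(1) e in blast)+
      moreover have "V q1 \<noteq> V q2" using U(2) q by (auto simp: V_def)
      moreover have "const_on V g" if "g \<in> ?G" for g
        using that grp[OF c] gr[of g U] U(3) by (auto simp: V_def)
      ultimately show ?thesis by blast
    qed
  qed
qed

text \<open>The edge from \<open>s\<close> to its group is lengthened by the vertex
  \<open>p\<close>, while the other premise has a leaf of its own that constrains nothing. So both
  new edges are cut by means of the colouring that cut the old one.\<close>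

lemma tree_AP:
  assumes t: "tree \<sigma> L (insert (insert s A) (insert {o'} \<G>))" (is "tree \<sigma> L ?H")
    and s: "s = prem \<sigma> p1 p2 p" and d: "s \<notin> A" "s \<notin> \<Union>\<G>" "s \<noteq> o'"
  shows "tree \<sigma> (L + {#AP p1 p2 p#}) (insert (insert p A) \<G>)" (is "tree \<sigma> ?L ?G")
proof -
  have sp: "s \<noteq> p" and sL: "s \<in> pos L" using p pL by (auto simp: s prem_def)
  have ob: "obeys \<sigma> (U(p := b)) l = obeys \<sigma> U l" if "l \<in># L" for U b l
    by (rule obeys_upd_fresh[OF that p(1)])
  have gr: "const_on (U(p := b)) g = const_on U g" if "g \<in> \<G>" for U b g
    by (rule const_on_upd) (use that p(3) in auto)
  have grp: "const_on (U(p := U s)) (insert p A)" if "const_on U (insert s A)" for U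
  proof (rule const_onI[of _ _ "U s"])
    fix x assume "x \<in> insert p A"
    then show "(U(p := U s)) x = U s" using const_onD[OF that, of x s] by auto
  qed
  have flip: "(U(x := \<not> U x))(p := (U(x := \<not> U x)) s) = (U(p := U s))(x := \<not> (U(p := U s)) x)"
    if "x \<noteq> p" "x \<noteq> s" for U x using that by (intro ext) simp
  have obAP: "obeys \<sigma> (U(p := U s)) (AP p1 p2 p)" for U using sp by (simp add: s)
  have obL: "obeys \<sigma> (U(p := U s)) l" if "l \<in># ?L" "\<And>k. k \<in># L \<Longrightarrow> k = l \<Longrightarrow> obeys \<sigma> U k" for U l
    using that obAP ob by auto
  have sing: "const_on U {o'}" for U by (simp add: const_on_def)
  show ?thesis unfolding tree_def
  proof (intro conjI allI impI ballI)
    fix U assume U: "\<forall>l\<in>#?L. obeys \<sigma> U l" "\<forall>g\<in>?G. const_on U g"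
    then have e: "U s = U p" by (auto simp: s)
    have g: "const_on U (insert p A)" using U(2) by blast
    have "const_on U (insert s A)"
    proof (rule const_onI[of _ _ "U p"])
      fix x assume "x \<in> insert s A"
      then show "U x = U p" using const_onD[OF g, of x p] e by auto
    qed
    then have c: "const_on U (pos L)" by (intro treeD1[OF t]) (use U sing in auto)
    show "const_on U (pos ?L)"
    proof (rule const_onI[of _ _ "U s"])
      fix x assume "x \<in> pos ?L"
      then show "U x = U s" using const_onD[OF c _ sL, of x] e pL by auto
    qed
  next
    fix x assume x: "x \<in> \<Union>?G"
    show "\<exists>U. (\<forall>l\<in>#?L. obeys \<sigma> U l) \<and> (\<forall>g\<in>?G. const_on (U(x := \<not> U x)) g)"
    proof (cases "x = p")
      case True
      obtain U where U: "\<forall>l\<in>#L. obeys \<sigma> U l" "\<forall>g\<in>?H. const_on (U(s := \<not> U s)) g"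
        using treeD2[OF t, of s "insert s A"] by auto
      have c: "const_on (U(s := \<not> U s)) (insert s A)" using U(2) by simp
      have e: "U y = (\<not> U s)" if "y \<in> A" for y
        using const_onD[OF c, of y s] that d by (auto split: if_splits)
      define V where "V = U(p := U s)"
      have "obeys \<sigma> V l" if "l \<in># ?L" for l unfolding V_def using obL[of l U] that U(1) by blast
      moreover have "const_on (V(p := \<not> V p)) g" if "g \<in> ?G" for g
      proof (cases "g \<in> \<G>")
        case True
        have "const_on U g" using U(2) True const_on_upd[of s g U] d by auto
        then show ?thesis using gr[OF True, of V] gr[OF True, of U] by (simp add: V_def)
      next
        case False
        then have g: "g = insert p A" using that by simp
        show ?thesis unfolding g
        proof (rule const_onI[of _ _ "\<not> U s"])
          fix y assume "y \<in> insert p A"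
          then show "(V(p := \<not> V p)) y = (\<not> U s)" using e[of y] p(2) by (auto simp: V_def)
        qed
      qed
      ultimately show ?thesis unfolding True by blast
    next
      case False
      then have x': "x \<in> A \<or> x \<in> \<Union>\<G>" using x by auto
      have "\<exists>g. x \<in> g \<and> g \<in> ?H" using x'
      proof
        assume "x \<in> A"
        then show ?thesis by (intro exI[of _ "insert s A"]) simp
      next
        assume "x \<in> \<Union>\<G>"
        then obtain g where "g \<in> \<G>" "x \<in> g" by (rule UnionE)
        then show ?thesis by (intro exI[of _ g]) simp
      qed
      then obtain g where "x \<in> g" "g \<in> ?H" by (elim exE conjE)
      from treeD2[OF t this]
      obtain U where U: "\<forall>l\<in>#L. obeys \<sigma> U l" "\<forall>g\<in>?H. const_on (U(x := \<not> U x)) g"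
        by (elim exE conjE)
      have xp: "x \<noteq> s" using x' d by auto
      define W where "W = U(x := \<not> U x)"
      have cW: "const_on W (insert s A)" using U(2) by (simp add: W_def)
      define V where "V = U(p := U s)"
      have VW: "V(x := \<not> V x) = W(p := W s)" unfolding V_def W_def by (rule flip[OF False xp, symmetric])
      have "obeys \<sigma> V l" if "l \<in># ?L" for l unfolding V_def using obL[of l U] that U(1) by blast
      moreover have "const_on (V(x := \<not> V x)) g" if "g \<in> ?G" for g
        unfolding VW using that grp[OF cW] gr[of g W] U(2) by (auto simp: W_def)
      ultimately show ?thesis by blast
    qed
  next
    fix q1 q2 q assume a: "AP q1 q2 q \<in># ?L"
    show "\<exists>U. (\<forall>l\<in>#?L. l \<noteq> AP q1 q2 q \<longrightarrow> obeys \<sigma> U l) \<and> U (prem \<sigma> q1 q2 q) \<noteq> U q \<and> (\<forall>g\<in>?G. const_on U g)"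
    proof (cases "AP q1 q2 q = AP p1 p2 p")
      case True
      obtain U where U: "\<forall>l\<in>#L. obeys \<sigma> U l" "\<forall>g\<in>?H. const_on (U(s := \<not> U s)) g"
        using treeD2[OF t, of s "insert s A"] by auto
      have c: "const_on (U(s := \<not> U s)) (insert s A)" using U(2) by simp
      have e: "U y = (\<not> U s)" if "y \<in> A" for y
        using const_onD[OF c, of y s] that d by (auto split: if_splits)
      define V where "V = U(p := \<not> U s)"
      have "obeys \<sigma> V l" if "l \<in># ?L" "l \<noteq> AP q1 q2 q" for l
        using that True U(1) ob[of l U "\<not> U s"] by (auto simp: V_def)
      moreover have "V (prem \<sigma> q1 q2 q) \<noteq> V q" using True sp by (auto simp: V_def s)
      moreover have "const_on V g" if "g \<in> ?G" for g
      proof (cases "g \<in> \<G>")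
        case True
        have "const_on U g" using U(2) True const_on_upd[of s g U] d by auto
        then show ?thesis using gr[OF True] by (simp add: V_def)
      next
        case False
        then have g: "g = insert p A" using that by simp
        show ?thesis unfolding g
        proof (rule const_onI[of _ _ "\<not> U s"])
          fix y assume "y \<in> insert p A"
          then show "V y = (\<not> U s)" using e[of y] by (auto simp: V_def)
        qed
      qed
      ultimately show ?thesis by blast
    next
      case False
      then have k: "AP q1 q2 q \<in># L" using a by auto
      obtain U where U: "\<forall>l\<in>#L. l \<noteq> AP q1 q2 q \<longrightarrow> obeys \<sigma> U l" "U (prem \<sigma> q1 q2 q) \<noteq> U q" "\<forall>g\<in>?H. const_on U g"
        using treeD3[OF t k] by (elim exE conjE)
      define V where "V = U(p := U s)"
      have c: "const_on U (insert s A)" using U(3) by simp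
      have q: "q \<noteq> p" "q1 \<noteq> p" "q2 \<noteq> p" using k p(1) by (auto dest!: multi_member_split)
      have "obeys \<sigma> V l" if "l \<in># ?L" "l \<noteq> AP q1 q2 q" for l unfolding V_def using obL[of l U] that U(1) by blast
      moreover have "V (prem \<sigma> q1 q2 q) \<noteq> V q" using U(2) q by (auto simp: V_def prem_def)
      moreover have "const_on V g" if "g \<in> ?G" for g
        using that grp[OF c] gr[of g U] U(3) by (auto simp: V_def)
      ultimately show ?thesis by blast
    qed
  next
    fix q1 q2 q assume a: "AT q1 q2 q \<in># ?L"
    then have k: "AT q1 q2 q \<in># L" by simp
    obtain U where U: "\<forall>l\<in>#L. l \<noteq> AT q1 q2 q \<longrightarrow> obeys \<sigma> U l" "U q1 \<noteq> U q2" "\<forall>g\<in>?H. const_on U g"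
      using treeD4[OF t k] by (elim exE conjE)
    define V where "V = U(p := U s)"
    have c: "const_on U (insert s A)" using U(3) by simp
    have q: "q1 \<noteq> p" "q2 \<noteq> p" using k p(1) by (auto dest!: multi_member_split)
    have "obeys \<sigma> V l" if "l \<in># ?L" "l \<noteq> AT q1 q2 q" for l unfolding V_def using obL[of l U] that U(1) by blast
    moreover have "V q1 \<noteq> V q2" using U(2) q by (auto simp: V_def)
    moreover have "const_on V g" if "g \<in> ?G" for g
      using that grp[OF c] gr[of g U] U(3) by (auto simp: V_def)
    ultimately show "\<exists>U. (\<forall>l\<in>#?L. l \<noteq> AT q1 q2 q \<longrightarrow> obeys \<sigma> U l) \<and> U q1 \<noteq> U q2 \<and> (\<forall>g\<in>?G. const_on U g)"
      by blast
  qed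
qed

end

section \<open>Tests\<close>

text \<open>
  Interpreting every variable by the biorthogonal of the daimon is enough for completeness: this type is
  tested by tensors as well as by pars, so a conclusion of variable type must be an output of a daimon.
\<close>

definition daimon_type :: "net set" where
  "daimon_type = orth (orth {daimon_net 1})"

lemma daimon_orthogonal: "daimon_net 1 \<in> orth {daimon_net 1}"
proof -
  have "win ({#} + {#AC {#0::nat, 1#}, AD (add_mset 0 {#}), AD (add_mset 1 {#})#})"
    by (rule win_stepI[OF DD]) (simp_all add: closed_def win_base add_mset_commute)
  then have "win (alinks (links (daimon_net 1)) + rn (\<lambda>_. 1) (alinks (links (daimon_net 1))) + cuts [0] [1])"
    by (simp add: add_mset_commute)
  then show ?thesis
    using orthogonal_iff[OF is_net_daimon_net is_net_daimon_net, of "\<lambda>_. 1" 1 1] is_net_daimon_net[of 1]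
    by (simp add: orth_def)
qed

lemma orth_daimon_type: "orth daimon_type = orth {daimon_net 1}"
  unfolding daimon_type_def by (rule orth_orth_orth) (use is_net_daimon_net in auto)

lemma unary_daimon_type: "unary daimon_type"
proof -
  have "{daimon_net 1} \<subseteq> daimon_type"
    unfolding daimon_type_def by (rule orth_orth_incl) (use is_net_daimon_net in auto)
  then show ?thesis using orth_daimon_type daimon_orthogonal by (auto simp: unary_def daimon_type_def)
qed

text \<open>The daimon is orthogonal to itself, so the type lies inside its own orthogonal and can
  interpret a variable and its dual alike.\<close>

lemma is_basis_daimon_type: "is_basis dual (\<lambda>_. daimon_type)"
proof -
  have "daimon_type \<subseteq> orth {daimon_net 1}"
    unfolding daimon_type_def by (rule orth_antimono) (use daimon_orthogonal in auto)
  then show ?thesis using unary_daimon_type unary_net[OF unary_daimon_type] orth_daimon_type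
    by (simp add: is_basis_def is_type_def unary_def)
qed

lemma approximable_daimon_type: "approximable (\<lambda>_. daimon_type)"
  using unary_daimon_type by (simp add: approximable_def unary_def)

lemma unary_tests: "unary (interp (\<lambda>_. daimon_type) A)"
  by (rule unary_interp[OF is_basis_daimon_type approximable_daimon_type])

text \<open>These are the elements of the type itself: a net to be plugged onto a conclusion
  \<open>A\<close> has to win against all of them, that is, to lie in the orthogonal.\<close>

abbreviation tests :: "'v form \<Rightarrow> behaviour" where
  "tests A \<equiv> points (interp (\<lambda>_. daimon_type) A)"

text \<open>The orthogonal of the biorthogonal is that of the daimon, so one opponent stands for
  all.\<close>

lemma passes_daimon_type:
  assumes "anet K {#r#}" "x \<notin> pos K" "win (K + {#AD {#x#}, AC {#r, x#}#})"
  shows "passes K [(r, points daimon_type)]"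
proof -
  obtain S where S: "is_net S" "alinks (links S) = K" "concl S = [r]" using net_surj[of K "[r]"] assms(1) by auto
  have "orthogonal S (daimon_net 1)"
    using orthogonal_iff[OF S(1) is_net_daimon_net, of "\<lambda>_. x" 1] S assms by (simp add: add_mset_commute del: pos_alinks)
  then have "S \<in> orth daimon_type" unfolding orth_daimon_type using S(1) by (simp add: orth_def)
  from pointsI[OF this S(3)] show ?thesis using unary_points_orth[OF unary_daimon_type] S by simp
qed

text \<open>For a variable the daimon is the opponent to consider, and a par splits it in two; hence
  a par tests a variable as well as a tensor.\<close>

lemma par_test:
  assumes L: "anet L {#p, q#}" "passes L [(p, tests A), (q, tests B)]" "r \<notin> pos L"
    and C: "C = TensorF A B \<or> (\<exists>X. A = Var X \<and> B = Var X \<and> C = Var X)"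
  shows "passes (L + {#AP p q r#}) [(r, tests C)]"
  using C
proof
  note u = unary_tests[of A] unary_tests[of B]
  assume C: "C = TensorF A B"
  have "(L + {#AP p q r#}, r) \<in> points (orth (interp (\<lambda>_. daimon_type) C))"
    unfolding C interp.simps orth_type_tensor[OF u] by (rule par_tests_tensor[OF u L])
  then show ?thesis using unary_points_orth[OF unary_tests] by blast
next
  assume "\<exists>X. A = Var X \<and> B = Var X \<and> C = Var X"
  then have e: "tests A = points daimon_type" "tests B = points daimon_type" "tests C = points daimon_type" by auto
  obtain x where x: "x \<notin> pos (L + {#AP p q r#})" using ex_new_if_finite[OF infinite_UNIV_nat finite_pos] by blast
  have an: "anet (L + {#AP p q r#}) {#r#}" by (rule anet_AP[OF L(1,3)])
  have "p \<in> pos L" using anet_concl_subset[OF L(1)] by auto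
  then have "win (L + {#AD {#r#}#} + {#AD {#x#}#} + {#AC {#p, r#}, AC {#q, x#}#})"
    by (intro passes2[OF L(2)[unfolded e] unary_daimon[OF unary_daimon_type] unary_daimon[OF unary_daimon_type]])
      (use x L(3) in auto)
  then have "win (L + {#AC {#r, x#}, AP p q r, AD (add_mset x ({#} + {#}))#})"
    by (intro win_stepI[OF PD])
      (use closed_cut1[OF an anet_daimon[of "{#x#}"]] x in \<open>simp_all add: add_mset_commute\<close>)
  then have "passes (L + {#AP p q r#}) [(r, points daimon_type)]"
    by (intro passes_daimon_type[OF an x]) (simp add: add_mset_commute)
  then show ?thesis by (simp only: e)
qed

text \<open>For a variable, the two premises are closed by a daimon each, and
  \<open>win_extend\<close> joins these into the two-output daimon that arises when the tensor meets
  a daimon.\<close>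

lemma tensor_test:
  assumes L: "anet L {#p#}" "passes L [(p, tests A)]" and M: "anet M {#q#}" "passes M [(q, tests B)]"
    and d: "pos L \<inter> pos M = {}" "r \<notin> pos L \<union> pos M"
    and C: "C = ParF A B \<or> (\<exists>X. A = Var X \<and> B = Var X \<and> C = Var X)"
  shows "passes (L + M + {#AT p q r#}) [(r, tests C)]"
  using C
proof
  note u = unary_tests[of A] unary_tests[of B]
  assume C: "C = ParF A B"
  have "(L, p) \<in> points (orth (interp (\<lambda>_. daimon_type) A))" "(M, q) \<in> points (orth (interp (\<lambda>_. daimon_type) B))"
    using unary_points_orth[OF unary_tests] L M by blast+
  then have "(L + M + {#AT p q r#}, r) \<in> points (orth (interp (\<lambda>_. daimon_type) C))"
    unfolding C interp.simps orth_type_par[OF u] by (rule tensor_tests_par[OF u _ _ d])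
  then show ?thesis using unary_points_orth[OF unary_tests] by blast
next
  assume "\<exists>X. A = Var X \<and> B = Var X \<and> C = Var X"
  then have e: "tests A = points daimon_type" "tests B = points daimon_type" "tests C = points daimon_type" by auto
  obtain x where x: "x \<notin> pos (L + M + {#AT p q r#})" using ex_new_if_finite[OF infinite_UNIV_nat finite_pos] by blast
  have pq: "p \<in> pos L" "q \<in> pos M" using anet_concl_subset[OF L(1)] anet_concl_subset[OF M(1)] by auto
  have an: "anet (L + M + {#AT p q r#}) {#r#}"
    by (rule anet_AT) (use anet_plus[OF L(1) M(1) d(1)] d in \<open>simp_all add: add_mset_commute\<close>)
  have "win (L + {#AD {#r#}#} + {#AC {#p, r#}#})" "win (M + {#AD {#x#}#} + {#AC {#q, x#}#})"
    by (rule passes1D[OF L(2)[unfolded e] unary_daimon[OF unary_daimon_type]]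
        passes1D[OF M(2)[unfolded e] unary_daimon[OF unary_daimon_type]]; use x d in auto)+
  then have "win ((L + {#AC {#p, r#}#}) + {#AD {#r#}#})" "win ((M + {#AC {#q, x#}#}) + {#AD {#x#}#})"
    by (simp_all add: add_mset_commute)
  then have "win ((L + {#AC {#p, r#}#}) + (M + {#AC {#q, x#}#}) + {#AD ({#r#} + {#x#})#})"
    by (rule win_extend) (use x d pq in auto)
  then have "win (L + M + {#AC {#r, x#}, AT p q r, AD (add_mset x {#})#})"
    by (intro win_stepI[OF TD])
      (use closed_cut1[OF an anet_daimon[of "{#x#}"]] x in \<open>simp_all add: add_mset_commute\<close>)
  then have "passes (L + M + {#AT p q r#}) [(r, points daimon_type)]"
    by (intro passes_daimon_type[OF an x]) (simp add: add_mset_commute)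
  then show ?thesis by (simp only: e)
qed

text \<open>
  A test reuses the names of the conclusions that it faces; \<open>Inl\<close> and \<open>Inr\<close> tell the two sides apart below.
\<close>

definition test :: "(nat \<times> 'v form) list \<Rightarrow> nat alink multiset \<Rightarrow> bool" where
  "test g M \<longleftrightarrow> anet M (mset (map fst g)) \<and> passes M (map (\<lambda>(p, A). (p, tests A)) g)"

lemma behaved_tests: "behaved (tests A)"
  by (rule unary_behaved[OF unary_tests])

lemma behaved_map: "\<forall>(p, P)\<in>set (map (\<lambda>(p, A). (p, tests A)) g). behaved P"
  using behaved_tests by auto

lemma map_fst_tests: "map fst (map (\<lambda>(p, A). (p, tests A)) g) = map fst g"
  by (induction g) auto

lemma test_perm:
  assumes "test g M" "mset g = mset g'"
  shows "test g' M"
proof (rule perm_induct[of "\<lambda>g. test g M", OF _ assms])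
  fix xs ys x y assume t: "test (xs @ x # y # ys) M"
  obtain p A q B where xy: "x = (p, A)" "y = (q, B)" by fastforce
  have an: "anet M (mset (map fst (xs @ x # y # ys)))" using t by (simp add: test_def)
  have "p \<in> pos M" "q \<in> pos M" using anet_concl_subset[OF an] by (auto simp: xy)
  then have "passes M (map (\<lambda>(p, A). (p, tests A)) xs @ (q, tests B) # (p, tests A) # map (\<lambda>(p, A). (p, tests A)) ys)"
    by (rule passes_swap[OF _ behaved_tests behaved_tests, rotated 1]) (use t in \<open>simp_all add: test_def xy\<close>)
  then show "test (xs @ y # x # ys) M" using an by (simp add: test_def xy add_mset_commute)
qed

text \<open>The elements of every interpreted formula are tame, so one daimon is a test of any
  group, whatever its formulas.\<close>

lemma test_daimon: "distinct (map fst g) \<Longrightarrow> test g {#AD (mset (map fst g))#}"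
proof -
  assume d: "distinct (map fst g)"
  have "passes {#AD (mset (map fst (map (\<lambda>(p, A). (p, tests A)) g)))#} (map (\<lambda>(p, A). (p, tests A)) g)"
    by (rule passes_daimon) (use d unary_tame[OF unary_tests] in \<open>auto simp only: map_fst_tests set_map case_prod_beta\<close>)
  moreover have "anet {#AD (mset (map fst g))#} (mset (map fst g))"
    by (rule anet_daimon) (simp only: simple_mset_mset d)
  ultimately show ?thesis unfolding test_def map_fst_tests by blast
qed

lemma test_par:
  assumes t: "test (g @ [(p, A), (q, B)]) M" and r: "r \<notin> pos M"
    and C: "C = TensorF A B \<or> (\<exists>X. A = Var X \<and> B = Var X \<and> C = Var X)"
  shows "test (g @ [(r, C)]) (M + {#AP p q r#})"
proof -
  have an: "anet M (mset (map fst (g @ [(p, A), (q, B)])))" using t by (simp add: test_def)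
  have pq: "p \<in> pos M" "q \<in> pos M" using anet_concl_subset[OF an] by auto
  have "passes (M + {#AP p q r#}) (map (\<lambda>(p, A). (p, tests A)) g @ [(r, tests C)])"
  proof (rule passes_lift[of "[(p, tests A), (q, tests B)]"])
    fix L' assume L': "anet L' (mset (map fst [(p, tests A), (q, tests B)]))"
      "pos L' \<inter> pos {#AP p q r#} \<subseteq> set (map fst [(p, tests A), (q, tests B)])"
      "passes L' [(p, tests A), (q, tests B)]"
    have "r \<notin> pos L'" using L'(2) r pq by auto
    then show "passes (L' + {#AP p q r#}) [(r, tests C)]" by (intro par_test[OF _ _ _ C]) (use L' in auto)
  next
    show "anet M (mset (map fst (map (\<lambda>(p, A). (p, tests A)) g @ [(p, tests A), (q, tests B)])))"
      using an by (simp only: map_append map_fst_tests) simp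
    show "passes M (map (\<lambda>(p, A). (p, tests A)) g @ [(p, tests A), (q, tests B)])" using t by (simp add: test_def)
    show "\<forall>(p, P)\<in>set (map (\<lambda>(p, A). (p, tests A)) g). behaved P" by (rule behaved_map)
  qed (use pq r in auto)
  moreover have "anet (M + {#AP p q r#}) (add_mset r (mset (map fst g)))" by (rule anet_AP[OF _ r]) (use an in simp)
  ultimately show ?thesis by (simp add: test_def)
qed

text \<open>A tensor test consists of a test of the group with one premise and a separate test of
  the other; \<open>k\<close> lets either premise be the one that stays with the group.\<close>

lemma test_tensor:
  assumes t: "test (g @ [(p, A)]) M" and u: "test [(q, B)] N" and d: "pos M \<inter> pos N = {}" and r: "r \<notin> pos M \<union> pos N"
    and k: "(p1 = p \<and> p2 = q \<and> A1 = A \<and> A2 = B) \<or> (p1 = q \<and> p2 = p \<and> A1 = B \<and> A2 = A)"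
    and C: "C = ParF A1 A2 \<or> (\<exists>X. A1 = Var X \<and> A2 = Var X \<and> C = Var X)"
  shows "test (g @ [(r, C)]) (M + N + {#AT p1 p2 r#})"
proof -
  have an: "anet M (mset (map fst (g @ [(p, A)])))" using t by (simp add: test_def)
  have an': "anet N {#q#}" "passes N [(q, tests B)]" using u by (simp_all add: test_def)
  have pq: "p \<in> pos M" "q \<in> pos N" using anet_concl_subset[OF an] anet_concl_subset[OF an'(1)] by auto
  have "passes (M + (N + {#AT p1 p2 r#})) (map (\<lambda>(p, A). (p, tests A)) g @ [(r, tests C)])"
  proof (rule passes_lift[of "[(p, tests A)]"])
    fix L' assume L': "anet L' (mset (map fst [(p, tests A)]))"
      "pos L' \<inter> pos (N + {#AT p1 p2 r#}) \<subseteq> set (map fst [(p, tests A)])"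
      "passes L' [(p, tests A)]"
    have "r \<notin> pos L'" "pos L' \<inter> pos N = {}" using L'(2) r pq d by auto
    then have f: "pos L' \<inter> pos N = {}" "pos N \<inter> pos L' = {}" "r \<notin> pos L' \<union> pos N" "r \<notin> pos N \<union> pos L'" using r by auto
    have L1: "anet L' {#p#}" using L'(1) by simp
    from k show "passes (L' + (N + {#AT p1 p2 r#})) [(r, tests C)]"
    proof (elim disjE conjE)
      assume "p1 = p" "p2 = q" "A1 = A" "A2 = B"
      then show ?thesis using tensor_test[OF L1 L'(3) an' f(1,3)] C by (simp add: add_ac)
    next
      assume "p1 = q" "p2 = p" "A1 = B" "A2 = A"
      then show ?thesis using tensor_test[OF an' L1 L'(3) f(2,4)] C by (simp add: add_ac)
    qed
  next
    show "anet M (mset (map fst (map (\<lambda>(p, A). (p, tests A)) g @ [(p, tests A)])))"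
      using an by (simp only: map_append map_fst_tests) simp
    show "passes M (map (\<lambda>(p, A). (p, tests A)) g @ [(p, tests A)])" using t by (simp add: test_def)
    show "\<forall>(p, P)\<in>set (map (\<lambda>(p, A). (p, tests A)) g). behaved P" by (rule behaved_map)
  qed (use pq r k d in auto)
  moreover have "anet (M + N + {#AT p1 p2 r#}) (add_mset r (mset (map fst g)))"
    by (rule anet_AT[OF _ r[folded pos_simps(3)]]) (use anet_plus[OF an an'(1) d] k in \<open>auto simp: add_mset_commute\<close>)
  ultimately show ?thesis by (simp add: test_def add_ac)
qed

section \<open>Families of tests and the removal of terminal connectives\<close>

fun test_family :: "nat alink multiset \<Rightarrow> (nat \<times> 'v form) list list \<Rightarrow> bool" where
  "test_family N [] \<longleftrightarrow> N = {#}"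
| "test_family N (g # gs) \<longleftrightarrow> (\<exists>M N'. N = M + N' \<and> test g M \<and> test_family N' gs \<and> pos M \<inter> pos N' = {})"

lemma test_family_perm:
  assumes "test_family N gs" "mset gs = mset gs'"
  shows "test_family N gs'"
proof (rule perm_induct[of "test_family N", OF _ assms])
  fix xs ys x y
  show "test_family N (xs @ x # y # ys) \<Longrightarrow> test_family N (xs @ y # x # ys)" for N :: "nat alink multiset"
  proof (induction xs arbitrary: N)
    case Nil
    then obtain M K N' where n: "N = M + (K + N')" "test x M" "test y K" "test_family N' ys"
      "pos K \<inter> pos N' = {}" "pos M \<inter> pos (K + N') = {}" by auto
    have "N = K + (M + N')" using n(1) by (simp add: add_ac)
    moreover have "pos M \<inter> pos N' = {}" "pos K \<inter> pos (M + N') = {}" using n by auto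
    ultimately show ?case using n unfolding append_Nil test_family.simps by blast
  next
    case (Cons z xs)
    then obtain M N' where n: "N = M + N'" "test z M" "test_family N' (xs @ x # y # ys)" "pos M \<inter> pos N' = {}" by auto
    show ?case unfolding append_Cons test_family.simps using n Cons.IH[OF n(3)] by blast
  qed
qed

definition cpos :: "(nat \<times> 'v form) list list \<Rightarrow> nat multiset" where
  "cpos gs = (\<Sum>g\<in>#mset gs. mset (map fst g))"

lemma cpos_simps [simp]: "cpos [] = {#}" "cpos (g # gs) = mset (map fst g) + cpos gs"
  by (simp_all add: cpos_def)

definition bridge :: "'p multiset \<Rightarrow> ('p + 'p) alink multiset" where
  "bridge P = image_mset (\<lambda>p. AC {#Inl p, Inr p#}) P"

lemma bridge_simps [simp]: "bridge {#} = {#}" "bridge (add_mset p P) = add_mset (AC {#Inl p, Inr p#}) (bridge P)"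
  "bridge (P + Q) = bridge P + bridge Q"
  by (simp_all add: bridge_def)

text \<open>Tests are confined to the names of \<open>L\<close>, so a position removed together with
  its connective is fresh for every test considered afterwards.\<close>

definition tested :: "nat alink multiset \<Rightarrow> (nat \<times> 'v form) list list \<Rightarrow> bool" where
  "tested L gs \<longleftrightarrow> (\<forall>N. test_family N gs \<longrightarrow> pos N \<subseteq> pos L \<longrightarrow> win (rn Inl L + rn Inr N + bridge (cpos gs)))"

definition daimons :: "(nat \<times> 'v form) list list \<Rightarrow> nat alink multiset" where
  "daimons gs = image_mset (\<lambda>g. AD (mset (map fst g))) (mset gs)"

lemma daimons_simps [simp]: "daimons [] = {#}" "daimons (g # gs) = add_mset (AD (mset (map fst g))) (daimons gs)"
  by (simp_all add: daimons_def)

lemma pos_daimons [simp]: "pos (daimons gs) = set_mset (cpos gs)"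
  by (induction gs) auto

lemma test_family_daimons: "simple_mset (cpos gs) \<Longrightarrow> test_family (daimons gs) gs"
proof (induction gs)
  case (Cons g gs)
  then have c: "distinct (map fst g)" "simple_mset (cpos gs)" "set (map fst g) \<inter> set_mset (cpos gs) = {}"
    by (auto simp: simple_mset_add simple_mset_mset[of "map fst g", symmetric] simp del: simple_mset_mset)
  show ?case unfolding test_family.simps
    by (intro exI[of _ "{#AD (mset (map fst g))#}"] exI[of _ "daimons gs"]) (use c Cons.IH test_daimon in auto)
qed simp

lemma tested_focus:
  assumes t: "tested L gs" and gs: "mset gs = mset (g # gs')" and g: "mset g = mset g'"
  shows "tested L (g' # gs')" "cpos gs = cpos (g' # gs')"
proof -
  have "mset (map fst g) = mset (map fst g')" using g by simp
  then show c: "cpos gs = cpos (g' # gs')" using gs by (simp add: cpos_def)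
  have "test_family N gs" if "test_family N (g' # gs')" for N
  proof -
    have "test_family N (g # gs')" using that test_perm[of g' _ g] g by auto
    then show ?thesis by (rule test_family_perm) (use gs in simp)
  qed
  then show "tested L (g' # gs')" using t unfolding tested_def c by blast
qed

lemma ranked_rn: "ranked h (rn f L) \<longleftrightarrow> ranked (h \<circ> f) L"
  by (induction L) auto

lemma map_alink_eq [simp]:
  "AD ps = map_alink f l \<longleftrightarrow> (\<exists>qs. l = AD qs \<and> ps = image_mset f qs)"
  "AC ps = map_alink f l \<longleftrightarrow> (\<exists>qs. l = AC qs \<and> ps = image_mset f qs)"
  by (cases l; auto)+

text \<open>With daimons as tests the interaction is flat and its graph is the one described by
  \<open>tree\<close>: a test daimon is the node of its group, and a bridging cut is the edge from a
  conclusion to that node.\<close>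

lemma flat_tested:
  assumes w: "win (rn Inl L + rn Inr (daimons gs) + bridge (cpos gs))" and an: "anet L (cpos gs)"
    and fl: "\<And>l. l \<in># L \<Longrightarrow> \<exists>ps. l = AD ps"
  shows "tree \<sigma> L ((\<lambda>g. fst ` set g) ` set gs)"
proof -
  let ?N = "rn Inl L + rn Inr (daimons gs) + bridge (cpos gs)"
  have flat: "flat ?N"
    using fl by (fastforce simp: flat_def rn_def daimons_def bridge_def)
  have L: "AD (image_mset Inl ps) \<in># ?N" if "AD ps \<in># L" for ps
    using that by (force simp: rn_def)
  have G: "AD (image_mset Inr (mset (map fst g))) \<in># rn Inr (daimons gs)" if "g \<in> set gs" for g
    using that by (force simp: rn_def daimons_def)
  have cL: "set_mset (cpos gs) \<subseteq> pos L" by (rule anet_concl_subset[OF an])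
  have mem: "fst ` set g \<subseteq> set_mset (cpos gs)" if "g \<in> set gs" for g
    using that by (induction gs) auto
  show ?thesis unfolding tree_def
  proof (intro conjI allI impI ballI)
    fix U assume U: "\<forall>l\<in>#L. obeys \<sigma> U l" "\<forall>g\<in>(\<lambda>g. fst ` set g) ` set gs. const_on U g"
    define V where "V = case_sum U U"
    have "const_on V (pos ?N)"
    proof (rule flat_connected[OF w flat])
      fix ps assume "AD ps \<in># ?N"
      then consider qs where "AD qs \<in># L" "ps = image_mset Inl qs" | g where "g \<in> set gs" "ps = image_mset Inr (mset (map fst g))"
        using fl by (auto simp: rn_def daimons_def bridge_def)
      then show "const_on V (set_mset ps)"
      proof cases
        case 1
        then have "const_on U (set_mset qs)" using U(1) by force
        then show ?thesis unfolding const_on_alt 1 V_def by auto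
      next
        case 2
        then have "const_on U (fst ` set g)" using U(2) by blast
        then show ?thesis unfolding const_on_alt 2 V_def by auto
      qed
    next
      fix ps assume "AC ps \<in># ?N"
      moreover have "AC qs \<notin># L" for qs using fl[of "AC qs"] by auto
      ultimately obtain p where "ps = {#Inl p, Inr p#}" by (auto simp: rn_def daimons_def bridge_def)
      then show "const_on V (set_mset ps)" by (auto simp: V_def const_on_insert const_on_def)
    qed
    then have c: "const_on V (pos ?N)" .
    show "const_on U (pos L)" unfolding const_on_def
    proof (intro ballI)
      fix x y assume "x \<in> pos L" "y \<in> pos L"
      then have "V (Inl x) = V (Inl y)" by (intro const_onD[OF c]) auto
      then show "U x = U y" by (simp add: V_def)
    qed
  next
    fix x assume "x \<in> \<Union>((\<lambda>g. fst ` set g) ` set gs)"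
    then have x: "x \<in># cpos gs" using mem by blast
    then obtain P where P: "cpos gs = add_mset x P" by (metis mset_add)
    let ?C = "rn Inl L + rn Inr (daimons gs) + bridge P"
    have "?N = add_mset (AC {#Inl x, Inr x#}) ?C" by (simp add: P)
    from flat_acyclic[OF w flat this] obtain V where
      V: "V (Inl x) \<noteq> V (Inr x)" "\<forall>l\<in>#?C. const_on V (set_alink l)" by blast
    define U where "U y = V (Inl y)" for y
    \<comment> \<open>The two sides disagree across the removed cut and agree across all others, so
      flipping \<open>x\<close> on the side of the net gives the colours seen by the tests.\<close>
    have fl': "(U(x := \<not> U x)) y = V (Inr y)" if "y \<in># cpos gs" for y
    proof (cases "y = x")
      case True then show ?thesis using V(1) by (auto simp: U_def)
    next
      case False
      then have "AC {#Inl y, Inr y#} \<in># ?C" using that by (auto simp: P bridge_def)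
      then have "const_on V {Inl y, Inr y}" using V(2) by force
      then have "V (Inl y) = V (Inr y)" by (rule const_onD) auto
      then show ?thesis using False by (simp add: U_def)
    qed
    have "obeys \<sigma> U l" if l: "l \<in># L" for l
    proof -
      obtain ps where ps: "l = AD ps" using fl l by blast
      have "AD (image_mset Inl ps) \<in># ?C" using l unfolding ps by (force simp: rn_def)
      then have c: "const_on V (set_mset (image_mset Inl ps))" using V(2) by force
      have "U y = U z" if "y \<in># ps" "z \<in># ps" for y z
        unfolding U_def by (rule const_onD[OF c]) (use that in auto)
      then show ?thesis unfolding ps obeys.simps const_on_def by blast
    qed
    moreover have "const_on (U(x := \<not> U x)) h" if hh: "h \<in> (\<lambda>g. fst ` set g) ` set gs" for h
    proof -
      obtain g where g: "g \<in> set gs" "h = fst ` set g" using hh by blast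
      have "AD (image_mset Inr (mset (map fst g))) \<in># ?C" using G[OF g(1)] by auto
      then have c: "const_on V (set_mset (image_mset Inr (mset (map fst g))))" using V(2) by force
      have "(U(x := \<not> U x)) y = (U(x := \<not> U x)) z" if "y \<in> h" "z \<in> h" for y z
      proof -
        have "y \<in># cpos gs" "z \<in># cpos gs" using mem[OF g(1)] that g(2) by auto
        moreover have "V (Inr y) = V (Inr z)" by (rule const_onD[OF c]) (use that g(2) in auto)
        ultimately show ?thesis using fl' by metis
      qed
      then show ?thesis unfolding const_on_def by blast
    qed
    ultimately show "\<exists>U. (\<forall>l\<in>#L. obeys \<sigma> U l) \<and> (\<forall>g\<in>(\<lambda>g. fst ` set g) ` set gs. const_on (U(x := \<not> U x)) g)"
      by (intro exI[of _ U] conjI ballI)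
  next
    fix p1 p2 p assume "AP p1 p2 p \<in># L"
    then show "\<exists>U. (\<forall>l\<in>#L. l \<noteq> AP p1 p2 p \<longrightarrow> obeys \<sigma> U l) \<and> U (prem \<sigma> p1 p2 p) \<noteq> U p \<and> (\<forall>g\<in>(\<lambda>g. fst ` set g) ` set gs. const_on U g)"
      using fl by blast
  next
    fix p1 p2 p assume "AT p1 p2 p \<in># L"
    then show "\<exists>U. (\<forall>l\<in>#L. l \<noteq> AT p1 p2 p \<longrightarrow> obeys \<sigma> U l) \<and> U p1 \<noteq> U p2 \<and> (\<forall>g\<in>(\<lambda>g. fst ` set g) ` set gs. const_on U g)"
      using fl by blast
  qed
qed

text \<open>The output of a connective of greatest rank is consumed by no connective and, in the
  absence of cuts, by nothing.\<close>

lemma exists_terminal: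
  assumes an: "anet L cs" and r: "ranked h L" and c: "\<And>ps. AC ps \<notin># L"
    and e: "\<exists>p1 p2 p. AT p1 p2 p \<in># L \<or> AP p1 p2 p \<in># L"
  obtains p1 p2 p where "AT p1 p2 p \<in># L \<or> AP p1 p2 p \<in># L" "p \<in># cs"
proof -
  let ?Q = "\<lambda>p. \<exists>p1 p2. AT p1 p2 p \<in># L \<or> AP p1 p2 p \<in># L"
  have sub: "p \<in># tgt L" if "?Q p" for p using that by (auto dest!: multi_member_split)
  have "h y < Suc (Max (h ` set_mset (tgt L)))" if "?Q y" for y
    using sub[OF that] by (simp add: less_Suc_eq_le)
  then obtain p where p: "?Q p" "\<And>y. ?Q y \<Longrightarrow> h y \<le> h p"
    using ex_has_greatest_nat[of ?Q _ h "Suc (Max (h ` set_mset (tgt L)))"] e by blast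
  have "p \<notin># src L"
  proof
    assume "p \<in># src L"
    then obtain l where l: "l \<in># L" "p \<in># asrc l" by (auto simp: src_def)
    then obtain q where q: "q \<in># atgt l" "?Q q" using c by (cases l) auto
    have "h p < h q" using r l q(1) unfolding ranked_def by blast
    then show False using p(2)[OF q(2)] by simp
  qed
  moreover have "p \<in># cs + src L" using sub[OF p(1)] an by (simp add: anet_def)
  ultimately show thesis using that p(1) by auto
qed

lemma labelled_upd:
  assumes "labelled \<phi> L" "p \<notin> pos L"
  shows "labelled (\<phi>(p := F)) L"
proof -
  have "r \<noteq> p \<and> q1 \<noteq> p \<and> q2 \<noteq> p" if "AT q1 q2 r \<in># L \<or> AP q1 q2 r \<in># L" for q1 q2 r
    using that assms(2) by (auto dest!: multi_member_split)
  then have "(\<phi>(p := F)) r = \<phi> r \<and> (\<phi>(p := F)) q1 = \<phi> q1 \<and> (\<phi>(p := F)) q2 = \<phi> q2"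
    if "AT q1 q2 r \<in># L \<or> AP q1 q2 r \<in># L" for q1 q2 r using that by auto
  then show ?thesis using assms(1) unfolding labelled_def by metis
qed

definition outcome :: "(nat \<Rightarrow> bool) \<Rightarrow> nat alink multiset \<Rightarrow> (nat \<times> 'v form) list list \<Rightarrow> bool" where
  "outcome \<sigma> L gs \<longleftrightarrow> (\<exists>\<phi>. labelled \<phi> L \<and> (\<forall>g\<in>set gs. \<forall>(p, A)\<in>set g. \<phi> p = A)) \<and>
     tree \<sigma> L ((\<lambda>g. fst ` set g) ` set gs)"

lemma outcome_focus:
  assumes "outcome \<sigma> L (g' # gs')" "mset gs = mset (g # gs')" "mset g = mset g'"
  shows "outcome \<sigma> L gs"
proof -
  have "set g = set g'" "set gs = insert g (set gs')" using assms(2,3) by (metis set_mset_mset, metis list.simps(15) set_mset_mset)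
  then show ?thesis using assms(1) unfolding outcome_def by simp
qed

text \<open>What is not a tensor is a par or a variable, the shapes that admit a tensor test; this
  supplies the opponent that clashes with a tensor link.\<close>

lemma form_nottensor: "\<nexists>A B. F = TensorF A B \<Longrightarrow> \<exists>A B. F = ParF A B \<or> (\<exists>X. A = Var X \<and> B = Var X \<and> F = Var X)"
  by (cases F) auto

lemma form_notpar: "\<nexists>A B. F = ParF A B \<Longrightarrow> \<exists>A B. F = TensorF A B \<or> (\<exists>X. A = Var X \<and> B = Var X \<and> F = Var X)"
  by (cases F) auto

text \<open>A tensor test at \<open>p\<close> would clash with the tensor, so \<open>F\<close> is a
  tensor. Then every test of the group with both premises extends to a par test at \<open>p\<close>,
  and the resulting tensor-par step can be taken first.\<close>

lemma tested_tensor: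
  assumes t: "tested (L + {#AT p1 p2 p#}) ((g @ [(p, F)]) # gs)"
    and an: "anet (L + {#AT p1 p2 p#}) (cpos ((g @ [(p, F)]) # gs))"
    and IH: "\<And>A B. tested L ((g @ [(p1, A), (p2, B)]) # gs) \<Longrightarrow> anet L (cpos ((g @ [(p1, A), (p2, B)]) # gs)) \<Longrightarrow>
      outcome \<sigma> L ((g @ [(p1, A), (p2, B)]) # gs)"
  shows "outcome \<sigma> (L + {#AT p1 p2 p#}) ((g @ [(p, F)]) # gs)"
proof -
  let ?G = "mset (map fst g)"
  have s: "simple_mset (tgt L)" "simple_mset (src L)" "simple_mset ?G" "simple_mset (cpos gs)" "p1 \<noteq> p2"
    "p \<notin># tgt L" "p \<notin># src L" "p1 \<notin># src L" "p2 \<notin># src L"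
    "p1 \<notin># ?G + cpos gs" "p2 \<notin># ?G + cpos gs" "p \<notin># ?G + cpos gs" "set_mset ?G \<inter> set_mset (cpos gs) = {}"
    "p \<noteq> p1" "p \<noteq> p2"
    using anet_simple[OF an] by (auto simp: simple_mset_add simp del: mset_map)
  have eq: "?G + cpos gs + src L + {#p1, p2#} = tgt L" using an by (simp add: anet_def add_ac)
  then have "set_mset (?G + cpos gs + src L + {#p1, p2#}) = set_mset (tgt L)" by simp
  then have sub: "p1 \<in> pos L" "p2 \<in> pos L" "set_mset ?G \<subseteq> pos L" "set_mset (cpos gs) \<subseteq> pos L"
    by (auto simp: pos_def simp del: mset_map)
  have pL: "p \<notin> pos L" using s by (simp add: pos_def)
  have an': "anet L (cpos ((g @ [(p1, A), (p2, B)]) # gs))" for A B :: "'a form"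
    using an s(1) eq by (simp add: anet_def add_ac add_mset_commute)
  have "\<exists>A B. F = TensorF A B"
  proof (rule ccontr)
    assume "\<nexists>A B. F = TensorF A B"
    from form_nottensor[OF this] obtain A B where F: "F = ParF A B \<or> (\<exists>X. A = Var X \<and> B = Var X \<and> F = Var X)"
      by (elim exE)
    let ?M = "{#AD (mset (map fst (g @ [(p1, A)])))#} + {#AD (mset (map fst [(p2, B)]))#} + {#AT p1 p2 p#}"
    have dg: "distinct (map fst g)" using s(3) simple_mset_mset by blast
    have "test (g @ [(p, F)]) ?M"
      by (rule test_tensor[OF test_daimon test_daimon _ _ _ F]) (use s dg in auto)
    moreover have "pos ?M \<inter> pos (daimons gs) = {}" using s by auto
    ultimately have "test_family (?M + daimons gs) ((g @ [(p, F)]) # gs)"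
      using test_family_daimons[OF s(4)] unfolding test_family.simps by blast
    moreover have "pos (?M + daimons gs) \<subseteq> pos (L + {#AT p1 p2 p#})" using sub by auto
    ultimately have "win (rn Inl (L + {#AT p1 p2 p#}) + rn Inr (?M + daimons gs) + bridge (cpos ((g @ [(p, F)]) # gs)))"
      using t unfolding tested_def by blast
    then have "win ((rn Inl L + rn Inr ({#AD (mset (map fst (g @ [(p1, A)])))#} + {#AD (mset (map fst [(p2, B)]))#} + daimons gs) +
        bridge (?G + cpos gs)) + {#AC {#Inl p, Inr p#}, AT (Inl p1) (Inl p2) (Inl p), AT (Inr p1) (Inr p2) (Inr p)#})"
      by (simp add: add_ac add_mset_commute)
    then show False by (rule win_clash) blast
  qed
  then obtain A B where F: "F = TensorF A B" by blast
  have t': "tested L ((g @ [(p1, A), (p2, B)]) # gs)" unfolding tested_def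
  proof (intro allI impI)
    fix N assume N: "test_family N ((g @ [(p1, A), (p2, B)]) # gs)" "pos N \<subseteq> pos L"
    then obtain M K where M: "N = M + K" "test (g @ [(p1, A), (p2, B)]) M" "test_family K gs" "pos M \<inter> pos K = {}"
      by auto
    have pM: "p \<notin> pos M" "p \<notin> pos K" using N(2) M(1) pL by auto
    have "test (g @ [(p, F)]) (M + {#AP p1 p2 p#})" by (rule test_par[OF M(2) pM(1)]) (simp add: F)
    moreover have "{p1, p2} \<subseteq> pos M"
      using anet_concl_subset[of M "mset (map fst (g @ [(p1, A), (p2, B)]))"] M(2) by (auto simp: test_def)
    then have "pos (M + {#AP p1 p2 p#}) \<inter> pos K = {}" using M(4) pM by auto
    ultimately have "test_family (M + {#AP p1 p2 p#} + K) ((g @ [(p, F)]) # gs)"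
      using M(3) unfolding test_family.simps by blast
    moreover have "pos (M + {#AP p1 p2 p#} + K) \<subseteq> pos (L + {#AT p1 p2 p#})" using N(2) M(1) by auto
    ultimately have "win (rn Inl (L + {#AT p1 p2 p#}) + rn Inr (M + {#AP p1 p2 p#} + K) + bridge (cpos ((g @ [(p, F)]) # gs)))"
      using t unfolding tested_def by blast
    then have "win ((rn Inl L + rn Inr N + bridge (?G + cpos gs)) +
        {#AC {#Inl p, Inr p#}, AT (Inl p1) (Inl p2) (Inl p), AP (Inr p1) (Inr p2) (Inr p)#})"
      by (simp add: M(1) add_ac add_mset_commute)
    from win_TP_inv[OF this] show "win (rn Inl L + rn Inr N + bridge (cpos ((g @ [(p1, A), (p2, B)]) # gs)))"
      by (simp add: add_ac add_mset_commute)
  qed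
  from IH[OF t' an'] obtain \<phi> where \<phi>: "labelled \<phi> L" "\<forall>h\<in>set ((g @ [(p1, A), (p2, B)]) # gs). \<forall>(p, A)\<in>set h. \<phi> p = A"
    and tr: "tree \<sigma> L ((\<lambda>g. fst ` set g) ` set ((g @ [(p1, A), (p2, B)]) # gs))"
    unfolding outcome_def by blast
  let ?\<G> = "(\<lambda>g. fst ` set g) ` set gs"
  have cg: "\<Union>?\<G> = set_mset (cpos gs)" by (induction gs) auto
  have "tree \<sigma> (L + {#AT p1 p2 p#}) (insert (insert p (fst ` set g)) ?\<G>)"
  proof (rule tree_AT)
    have "fst ` set (g @ [(p1, A), (p2, B)]) = insert p1 (insert p2 (fst ` set g))" by auto
    then show "tree \<sigma> L (insert (insert p1 (insert p2 (fst ` set g))) ?\<G>)" using tr by simp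
  qed (unfold cg, use s pL sub in \<open>auto\<close>)
  moreover have "fst ` set (g @ [(p, F)]) = insert p (fst ` set g)" by auto
  ultimately have "tree \<sigma> (L + {#AT p1 p2 p#}) ((\<lambda>g. fst ` set g) ` set ((g @ [(p, F)]) # gs))" by simp
  moreover have "labelled (\<phi>(p := F)) (L + {#AT p1 p2 p#})"
    using labelled_upd[OF \<phi>(1) pL, of F] \<phi>(2) s F by (simp add: labelled_def)
  moreover have "(\<phi>(p := F)) q = D" if "h \<in> set ((g @ [(p, F)]) # gs)" "(q, D) \<in> set h" for h q D
  proof (cases "(q, D) = (p, F)")
    case False
    then have h: "\<exists>h\<in>set ((g @ [(p1, A), (p2, B)]) # gs). (q, D) \<in> set h \<and> q \<in># ?G + cpos gs"
      using that cg by (force)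
    then have "q \<noteq> p" using s by auto
    moreover have "\<phi> q = D"
    proof -
      obtain h' where h': "h' \<in> set ((g @ [(p1, A), (p2, B)]) # gs)" "(q, D) \<in> set h'" using h by (elim bexE conjE)
      show ?thesis using bspec[OF bspec[OF \<phi>(2) h'(1)] h'(2)] by simp
    qed
    ultimately show ?thesis by simp
  qed simp
  ultimately show ?thesis unfolding outcome_def by blast
qed

text \<open>As for a tensor with the kinds exchanged, except that a tensor test comes in two
  separate parts: one premise must be chosen to remain in the group.\<close>

lemma tested_par:
  assumes t: "tested (L + {#AP p1 p2 p#}) ((g @ [(p, F)]) # gs)"
    and an: "anet (L + {#AP p1 p2 p#}) (cpos ((g @ [(p, F)]) # gs))"
    and IH: "\<And>s A e B. tested L ((g @ [(s, A)]) # [(e, B)] # gs) \<Longrightarrow> anet L (cpos ((g @ [(s, A)]) # [(e, B)] # gs)) \<Longrightarrow>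
      outcome \<sigma> L ((g @ [(s, A)]) # [(e, B)] # gs)"
  shows "outcome \<sigma> (L + {#AP p1 p2 p#}) ((g @ [(p, F)]) # gs)"
proof -
  let ?G = "mset (map fst g)"
  have s: "simple_mset (tgt L)" "simple_mset (src L)" "simple_mset ?G" "simple_mset (cpos gs)" "p1 \<noteq> p2"
    "p \<notin># tgt L" "p \<notin># src L" "p1 \<notin># src L" "p2 \<notin># src L"
    "p1 \<notin># ?G + cpos gs" "p2 \<notin># ?G + cpos gs" "p \<notin># ?G + cpos gs" "set_mset ?G \<inter> set_mset (cpos gs) = {}"
    "p \<noteq> p1" "p \<noteq> p2"
    using anet_simple[OF an] by (auto simp: simple_mset_add simp del: mset_map)
  have eq: "?G + cpos gs + src L + {#p1, p2#} = tgt L" using an by (simp add: anet_def add_ac)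
  then have "set_mset (?G + cpos gs + src L + {#p1, p2#}) = set_mset (tgt L)" by simp
  then have sub: "p1 \<in> pos L" "p2 \<in> pos L" "set_mset ?G \<subseteq> pos L" "set_mset (cpos gs) \<subseteq> pos L"
    by (auto simp: pos_def simp del: mset_map)
  have pL: "p \<notin> pos L" using s by (simp add: pos_def)
  have dg: "distinct (map fst g)" using s(3) simple_mset_mset by blast
  have "\<exists>A B. F = ParF A B"
  proof (rule ccontr)
    assume "\<nexists>A B. F = ParF A B"
    from form_notpar[OF this] obtain A B where F: "F = TensorF A B \<or> (\<exists>X. A = Var X \<and> B = Var X \<and> F = Var X)"
      by (elim exE)
    let ?M = "{#AD (mset (map fst (g @ [(p1, A), (p2, B)])))#} + {#AP p1 p2 p#}"
    have "test (g @ [(p, F)]) ?M"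
      by (rule test_par[OF test_daimon _ F]) (use s dg in auto)
    moreover have "pos ?M \<inter> pos (daimons gs) = {}" using s by auto
    ultimately have "test_family (?M + daimons gs) ((g @ [(p, F)]) # gs)"
      using test_family_daimons[OF s(4)] unfolding test_family.simps by blast
    moreover have "pos (?M + daimons gs) \<subseteq> pos (L + {#AP p1 p2 p#})" using sub by auto
    ultimately have "win (rn Inl (L + {#AP p1 p2 p#}) + rn Inr (?M + daimons gs) + bridge (cpos ((g @ [(p, F)]) # gs)))"
      using t unfolding tested_def by blast
    then have "win ((rn Inl L + rn Inr ({#AD (mset (map fst (g @ [(p1, A), (p2, B)])))#} + daimons gs) +
        bridge (?G + cpos gs)) + {#AC {#Inl p, Inr p#}, AP (Inl p1) (Inl p2) (Inl p), AP (Inr p1) (Inr p2) (Inr p)#})"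
      by (simp add: add_ac add_mset_commute)
    then show False by (rule win_clash) blast
  qed
  then obtain A B where F: "F = ParF A B" by blast
  \<comment> \<open>The selected premise stays with the group and the other one, \<open>e\<close>,
    is tested alone, so the edges kept are those of the switching \<open>\<sigma>\<close>.\<close>
  define s' where "s' = (if \<sigma> p then p1 else p2)"
  define e where "e = (if \<sigma> p then p2 else p1)"
  define A' where "A' = (if \<sigma> p then A else B)"
  define B' where "B' = (if \<sigma> p then B else A)"
  have cs: "(p1 = s' \<and> p2 = e \<and> A = A' \<and> B = B') \<or> (p1 = e \<and> p2 = s' \<and> A = B' \<and> B = A')"
    by (simp add: s'_def e_def A'_def B'_def)
  have se: "{#s', e#} = {#p1, p2#}" "s' \<noteq> e" using s(5) by (auto simp: s'_def e_def add_mset_commute)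
  have ceq: "cpos ((g @ [(s', A')]) # [(e, B')] # gs) = ?G + cpos gs + {#p1, p2#}"
    unfolding se(1)[symmetric] by (simp add: add_mset_commute)
  have an': "anet L (cpos ((g @ [(s', A')]) # [(e, B')] # gs))"
    unfolding ceq using an s(1) eq by (simp add: anet_def add_ac add_mset_commute)
  have t': "tested L ((g @ [(s', A')]) # [(e, B')] # gs)" unfolding tested_def
  proof (intro allI impI)
    fix N assume N: "test_family N ((g @ [(s', A')]) # [(e, B')] # gs)" "pos N \<subseteq> pos L"
    then obtain M M2 K where M: "N = M + (M2 + K)" "test (g @ [(s', A')]) M" "test [(e, B')] M2" "test_family K gs"
      "pos M2 \<inter> pos K = {}" "pos M \<inter> pos (M2 + K) = {}"
      by auto
    have pM: "p \<notin> pos M" "p \<notin> pos M2" "p \<notin> pos K" using N(2) M(1) pL by auto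
    have dM: "pos M \<inter> pos M2 = {}" using M(6) by auto
    have "test (g @ [(p, F)]) (M + M2 + {#AT p1 p2 p#})"
      by (rule test_tensor[OF M(2,3) dM _ cs]) (use pM F in auto)
    moreover have "s' \<in> pos M" "e \<in> pos M2"
      using anet_concl_subset[of M "mset (map fst (g @ [(s', A')]))"] anet_concl_subset[of M2 "mset (map fst [(e, B')])"] M(2,3)
      by (auto simp: test_def)
    then have "{p1, p2} \<subseteq> pos M \<union> pos M2" using cs by blast
    then have "pos (M + M2 + {#AT p1 p2 p#}) \<inter> pos K = {}" using M(5,6) pM by auto
    ultimately have "test_family (M + M2 + {#AT p1 p2 p#} + K) ((g @ [(p, F)]) # gs)"
      using M(4) unfolding test_family.simps by blast
    moreover have "pos (M + M2 + {#AT p1 p2 p#} + K) \<subseteq> pos (L + {#AP p1 p2 p#})" using N(2) M(1) by auto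
    ultimately have "win (rn Inl (L + {#AP p1 p2 p#}) + rn Inr (M + M2 + {#AT p1 p2 p#} + K) + bridge (cpos ((g @ [(p, F)]) # gs)))"
      using t unfolding tested_def by blast
    then have "win ((rn Inl L + rn Inr N + bridge (?G + cpos gs)) +
        {#AC {#Inr p, Inl p#}, AT (Inr p1) (Inr p2) (Inr p), AP (Inl p1) (Inl p2) (Inl p)#})"
      by (simp add: M(1) add_ac add_mset_commute)
    from win_TP_inv[OF this]
    have "win (rn Inl L + rn Inr N + bridge (?G + cpos gs + {#p1, p2#}))" by (simp add: add_mset_commute)
    then show "win (rn Inl L + rn Inr N + bridge (cpos ((g @ [(s', A')]) # [(e, B')] # gs)))"
      unfolding ceq .
  qed
  from IH[OF t' an'] obtain \<phi> where \<phi>: "labelled \<phi> L" "\<forall>h\<in>set ((g @ [(s', A')]) # [(e, B')] # gs). \<forall>(p, A)\<in>set h. \<phi> p = A"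
    and tr: "tree \<sigma> L ((\<lambda>g. fst ` set g) ` set ((g @ [(s', A')]) # [(e, B')] # gs))"
    unfolding outcome_def by blast
  let ?\<G> = "(\<lambda>g. fst ` set g) ` set gs"
  have cg: "\<Union>?\<G> = set_mset (cpos gs)" by (induction gs) auto
  have sp: "s' = prem \<sigma> p1 p2 p" by (simp add: s'_def prem_def)
  have "tree \<sigma> (L + {#AP p1 p2 p#}) (insert (insert p (fst ` set g)) ?\<G>)"
  proof (rule tree_AP[OF _ _ _ _ _ _ _ _ sp])
    have "fst ` set (g @ [(s', A')]) = insert s' (fst ` set g)" by auto
    then show "tree \<sigma> L (insert (insert s' (fst ` set g)) (insert {e} ?\<G>))" using tr by simp
  qed (unfold cg, use s pL sub se(2) in \<open>auto simp: s'_def\<close>)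
  moreover have "fst ` set (g @ [(p, F)]) = insert p (fst ` set g)" by auto
  ultimately have "tree \<sigma> (L + {#AP p1 p2 p#}) ((\<lambda>g. fst ` set g) ` set ((g @ [(p, F)]) # gs))" by simp
  moreover have "\<phi> s' = A'" "\<phi> e = B'" using \<phi>(2) by auto
  then have "\<phi> p1 = A" "\<phi> p2 = B" using cs by auto
  then have "labelled (\<phi>(p := F)) (L + {#AP p1 p2 p#})"
    using labelled_upd[OF \<phi>(1) pL, of F] s F by (simp add: labelled_def)
  moreover have "(\<phi>(p := F)) q = D" if "h \<in> set ((g @ [(p, F)]) # gs)" "(q, D) \<in> set h" for h q D
  proof (cases "(q, D) = (p, F)")
    case False
    then have h: "\<exists>h\<in>set ((g @ [(s', A')]) # [(e, B')] # gs). (q, D) \<in> set h \<and> q \<in># ?G + cpos gs"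
      using that cg by (force)
    then have "q \<noteq> p" using s by auto
    moreover have "\<phi> q = D"
    proof -
      obtain h' where h': "h' \<in> set ((g @ [(s', A')]) # [(e, B')] # gs)" "(q, D) \<in> set h'" using h by (elim bexE conjE)
      show ?thesis using bspec[OF bspec[OF \<phi>(2) h'(1)] h'(2)] by simp
    qed
    ultimately show ?thesis by simp
  qed simp
  ultimately show ?thesis unfolding outcome_def by blast
qed

lemma cpos_concat: "cpos gs = mset (map fst (concat gs))"
  by (induction gs) auto

lemma cpos_singletons: "length cs = length \<Gamma> \<Longrightarrow> cpos (map (\<lambda>x. [x]) (zip cs \<Gamma>)) = mset cs"
  by (induction cs \<Gamma> rule: list_induct2) auto

lemma simple_cpos_distinct: "simple_mset (cpos gs) \<Longrightarrow> distinct (map fst (concat gs))"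
  by (simp only: cpos_concat simple_mset_mset)

text \<open>The family of daimons is available whatever the formulas, and a single winning play
  already excludes cycles of connectives.\<close>

lemma tested_rank:
  assumes "tested L gs" "anet L (cpos gs)"
  shows "win (rn Inl L + rn Inr (daimons gs) + bridge (cpos gs))" "\<exists>h. ranked h L"
proof -
  have "simple_mset (cpos gs)" "set_mset (cpos gs) \<subseteq> pos L" using anet_simple[OF assms(2)] anet_concl_subset[OF assms(2)] by auto
  then show w: "win (rn Inl L + rn Inr (daimons gs) + bridge (cpos gs))"
    using assms(1) test_family_daimons[of gs] unfolding tested_def by simp
  show "\<exists>h. ranked h L" using win_ranked[OF w] ranked_rn by auto
qed

text \<open>Connectives are removed from the bottom until only daimons remain; labels and trees are
  rebuilt on the way back. The chosen conclusion is moved to the end of the first group.\<close>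

lemma tested_outcome:
  assumes "tested L gs" "anet L (cpos gs)" "\<And>ps. AC ps \<notin># L"
  shows "outcome \<sigma> L gs"
  using assms
proof (induction "size L" arbitrary: L gs rule: less_induct)
  case less
  obtain h where h: "ranked h L" using tested_rank[OF less.prems(1,2)] by blast
  show ?case
  proof (cases "\<exists>p1 p2 p. AT p1 p2 p \<in># L \<or> AP p1 p2 p \<in># L")
    case False
    have ad: "\<exists>ps. l = AD ps" if "l \<in># L" for l using that False less.prems(3) by (cases l) auto
    let ?\<phi> = "\<lambda>p. the (map_of (concat gs) p)"
    have "labelled ?\<phi> L" using False by (auto simp: labelled_def)
    moreover have "?\<phi> p = A" if "g \<in> set gs" "(p, A) \<in> set g" for g p A
    proof -
      have "(p, A) \<in> set (concat gs)" using that by auto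
      moreover have "distinct (map fst (concat gs))"
        by (rule simple_cpos_distinct) (use anet_simple[OF less.prems(2)] in blast)
      ultimately show ?thesis by (simp add: map_of_is_SomeI)
    qed
    ultimately have "\<exists>\<phi>. labelled \<phi> L \<and> (\<forall>g\<in>set gs. \<forall>(p, A)\<in>set g. \<phi> p = A)" by (intro exI[of _ ?\<phi>]) auto
    moreover have "tree \<sigma> L ((\<lambda>g. fst ` set g) ` set gs)"
      by (rule flat_tested[OF tested_rank(1)[OF less.prems(1,2)] less.prems(2) ad])
    ultimately show ?thesis unfolding outcome_def by blast
  next
    case True
    obtain p1 p2 p where p: "AT p1 p2 p \<in># L \<or> AP p1 p2 p \<in># L" "p \<in># cpos gs"
      using exists_terminal[OF less.prems(2) h less.prems(3) True] by metis
    have "p \<in> fst ` set (concat gs)" using p(2) by (simp only: cpos_concat set_mset_mset set_map)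
    then obtain g F where gF: "g \<in> set gs" "(p, F) \<in> set g" by auto
    obtain xs ys where xs: "gs = xs @ g # ys" using gF(1) by (metis split_list)
    obtain us vs where us: "g = us @ (p, F) # vs" using gF(2) by (metis split_list)
    let ?g = "(us @ vs) @ [(p, F)]" and ?gs = "xs @ ys"
    have f: "mset gs = mset (g # ?gs)" "mset g = mset ?g" using xs us by simp_all
    have t: "tested L (?g # ?gs)" and c: "cpos gs = cpos (?g # ?gs)"
      using tested_focus[OF less.prems(1) f] by auto
    note an = less.prems(2)[unfolded c]
    have "outcome \<sigma> L (?g # ?gs)"
      using p(1)
    proof
      assume "AT p1 p2 p \<in># L"
      then obtain L' where L: "L = L' + {#AT p1 p2 p#}" by (metis mset_add add_mset_add_single)
      show ?thesis unfolding L
        by (rule tested_tensor[OF t[unfolded L] an[unfolded L]], rule less.hyps) (use less.prems(3) in \<open>auto simp: L\<close>)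
    next
      assume "AP p1 p2 p \<in># L"
      then obtain L' where L: "L = L' + {#AP p1 p2 p#}" by (metis mset_add add_mset_add_single)
      show ?thesis unfolding L
        by (rule tested_par[OF t[unfolded L] an[unfolded L]], rule less.hyps) (use less.prems(3) in \<open>auto simp: L\<close>)
    qed
    then show ?thesis by (rule outcome_focus[OF _ f])
  qed
qed

text \<open>Opponents plugged one conclusion at a time form a family of tests with singleton groups;
  \<open>e\<close> and \<open>o'\<close> place the conclusions and the tests apart.\<close>

lemma passes_test_family:
  assumes "length cs = length \<Gamma>" "inj o'" "passes K (zip (map e cs) (map (\<lambda>A. points (orth (interp (\<lambda>_. daimon_type) A))) \<Gamma>))"
    "test_family N (map (\<lambda>x. [x]) (zip cs \<Gamma>))" "pos K \<inter> o' ` pos N = {}" "e ` set cs \<subseteq> pos K"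
  shows "win (K + rn o' N + image_mset (\<lambda>c. AC {#e c, o' c#}) (mset cs))"
  using assms
proof (induction cs \<Gamma> arbitrary: K N rule: list_induct2)
  case Nil then show ?case by simp
next
  case (Cons c cs A \<Gamma>)
  obtain M N' where N: "N = M + N'" "test [(c, A)] M" "test_family N' (map (\<lambda>x. [x]) (zip cs \<Gamma>))" "pos M \<inter> pos N' = {}"
    using Cons.prems(3) by auto
  have "(M, c) \<in> points (orth (interp (\<lambda>_. daimon_type) A))"
    using N(2) unary_points_orth[OF unary_tests] by (auto simp: test_def)
  from behavedD(2)[OF unary_behaved[OF unary_orth[OF unary_tests]] this, of o']
  have m: "(rn o' M, o' c) \<in> points (orth (interp (\<lambda>_. daimon_type) A))"
    using inj_on_subset[OF Cons.prems(1)] by blast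
  have cM: "c \<in> pos M" using N(2) anet_concl_subset[of M "{#c#}"] by (auto simp: test_def)
  have "passes (K + rn o' M + {#AC {#e c, o' c#}#}) (zip (map e cs) (map (\<lambda>A. points (orth (interp (\<lambda>_. daimon_type) A))) \<Gamma>))"
    by (rule passes_ConsD[OF _ m]) (use Cons.prems N in auto)
  then have "win (K + rn o' M + {#AC {#e c, o' c#}#} + rn o' N' + image_mset (\<lambda>c. AC {#e c, o' c#}) (mset cs))"
  proof (rule Cons.IH[OF Cons.prems(1) _ N(3)])
    have "o' ` pos M \<inter> o' ` pos N' = {}" using N(4) Cons.prems(1) by (simp flip: image_Int)
    moreover have "o' c \<in> o' ` pos M" using cM by blast
    ultimately show "pos (K + rn o' M + {#AC {#e c, o' c#}#}) \<inter> o' ` pos N' = {}"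
      using Cons.prems(4,5) N(1) by auto
  qed (use Cons.prems(5) in auto)
  then show ?case by (simp add: N(1) add_ac add_mset_commute)
qed

lemma passing_net_tested:
  assumes "passing_net (map (\<lambda>A. points (orth (interp (\<lambda>_. daimon_type) A))) \<Gamma>) S"
  shows "tested (alinks (links S)) (map (\<lambda>x. [x]) (zip (concl S) \<Gamma>))"
    "anet (alinks (links S)) (cpos (map (\<lambda>x. [x]) (zip (concl S) \<Gamma>)))"
proof -
  let ?L = "alinks (links S)" and ?cs = "concl S" and ?gs = "map (\<lambda>x. [x]) (zip (concl S) \<Gamma>)"
  have S: "anet ?L (mset ?cs)" "length ?cs = length \<Gamma>" "passes ?L (zip ?cs (map (\<lambda>A. points (orth (interp (\<lambda>_. daimon_type) A))) \<Gamma>))"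
    using assms by (auto simp: passing_net_def is_net_anet)
  have c: "cpos ?gs = mset ?cs"
    by (rule cpos_singletons[OF S(2)])
  then show "anet ?L (cpos ?gs)" using S by simp
  have cs: "set ?cs \<subseteq> pos ?L" using anet_concl_subset[OF S(1)] by simp
  have "win (rn Inl ?L + rn Inr N + bridge (cpos ?gs))" if N: "test_family N ?gs" for N
  proof -
    let ?f = "\<lambda>n::nat. 2 * n" and ?g = "\<lambda>n::nat. 2 * n + 1"
    have ev: "?f x \<noteq> ?g y" for x y by presburger
    have i: "inj ?f" "inj ?g" by (auto simp: inj_on_def)
    have "passes (rn ?f ?L) (map (\<lambda>(p, P). (?f p, P)) (zip ?cs (map (\<lambda>A. points (orth (interp (\<lambda>_. daimon_type) A))) \<Gamma>)))"
    proof (rule passes_rn[OF inj_on_subset[OF i(1)] _ _ S(3)])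
      show "\<forall>(p, P)\<in>set (zip ?cs (map (\<lambda>A. points (orth (interp (\<lambda>_. daimon_type) A))) \<Gamma>)). behaved P"
        using unary_behaved[OF unary_orth[OF unary_tests]] by (auto dest!: set_zip_rightD)
    qed (use cs S(2) in auto)
    then have "passes (rn ?f ?L) (zip (map ?f ?cs) (map (\<lambda>A. points (orth (interp (\<lambda>_. daimon_type) A))) \<Gamma>))"
      unfolding zip_map1 .
    then have "win (rn ?f ?L + rn ?g N + image_mset (\<lambda>c. AC {#?f c, ?g c#}) (mset ?cs))"
      by (rule passes_test_family[OF S(2) i(2) _ N]) (unfold pos_rn, rule parity_disjoint, use cs in blast)
    moreover define k where "k = case_sum ?f ?g"
    have "rn k (rn Inl ?L + rn Inr N + bridge (mset ?cs)) = rn ?f ?L + rn ?g N + image_mset (\<lambda>c. AC {#?f c, ?g c#}) (mset ?cs)"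
      unfolding rn_simps rn_comp by (simp add: k_def comp_def bridge_def rn_def multiset.map_comp)
    moreover have "inj k"
    proof (rule injI)
      fix x y assume "k x = k y" then show "x = y" using ev by (cases x; cases y) (auto simp: k_def dest: sym)
    qed
    then have "inj_on k (pos (rn Inl ?L + rn Inr N + bridge (mset ?cs)))" by (rule inj_on_subset) simp
    ultimately have "win (rn Inl ?L + rn Inr N + bridge (mset ?cs))" using win_rn_iff by metis
    then show ?thesis by (simp only: c)
  qed
  then show "tested ?L ?gs" unfolding tested_def by blast
qed

text \<open>At the start every conclusion is a group by itself, so the trees obtained for all
  switchings amount to plain correctness, and any one of the labellings gives back
  \<open>\<Gamma>\<close>.\<close>

lemma completeness:
  assumes n: "is_net S" and cf: "cut_free S" and p: "passing_net (map (\<lambda>A. points (orth (interp (\<lambda>_. daimon_type) A))) \<Gamma>) S"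
  shows "derives dual S \<Gamma>"
proof -
  let ?L = "alinks (links S)" and ?gs = "map (\<lambda>x. [x]) (zip (concl S) \<Gamma>)"
  note t = passing_net_tested[OF p]
  have len: "length (concl S) = length \<Gamma>" using p by (simp add: passing_net_def)
  have nc: "AC ps \<notin># ?L" for ps
  proof
    assume "AC ps \<in># ?L"
    then obtain l where l: "l \<in># links S" "unord l = AC ps" by (auto simp: alinks_def)
    then obtain a b where "l = Cut a b" by (cases l) auto
    then show False using l(1) cf by (simp add: cut_free_def)
  qed
  have o: "outcome \<sigma> ?L ?gs" for \<sigma> by (rule tested_outcome[OF t nc])
  then obtain \<phi> where \<phi>: "labelled \<phi> ?L" "\<forall>g\<in>set ?gs. \<forall>(p, A)\<in>set g. \<phi> p = A" unfolding outcome_def by blast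
  have G: "map \<phi> (concl S) = \<Gamma>"
  proof (rule nth_equalityI)
    fix i assume i: "i < length (map \<phi> (concl S))"
    then have "[(concl S ! i, \<Gamma> ! i)] \<in> set ?gs" using len by (auto simp: set_zip)
    then show "map \<phi> (concl S) ! i = \<Gamma> ! i" using \<phi>(2) i by fastforce
  qed (use len in simp)
  have corr: "corr \<sigma> ?L" for \<sigma>
  proof (rule tree_corr)
    show "tree \<sigma> ?L ((\<lambda>g. fst ` set g) ` set ?gs)" using o unfolding outcome_def by blast
  qed auto
  obtain h where h: "ranked h ?L" using tested_rank(2)[OF t] by blast
  note w = tested_rank(1)[OF t]
  \<comment> \<open>The empty net would fit the empty sequent by its conclusions, but no play starts
    from it.\<close>
  have ne: "?L \<noteq> {#}"
  proof
    assume e: "?L = {#}"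
    then have "concl S = []" using n by (simp add: is_net_anet anet_def)
    then have "win ({#} :: (nat + nat) alink multiset)" using w e by simp
    then show False by cases (auto simp: redex_def)
  qed
  have em: "?L = {#AD {#}#}" if m: "AD {#} \<in># ?L"
  proof -
    obtain M where M: "?L = add_mset (AD {#}) M" using m by (metis mset_add)
    then have "win (add_mset (AD {#}) (rn Inl M + rn Inr (daimons ?gs) + bridge (cpos ?gs)))" using w by simp
    from win_empty_daimon[OF this] have "M = {#}" by (simp add: rn_def)
    then show ?thesis using M by simp
  qed
  have "deriv \<phi> ?L (mset (concl S))"
    using corr_deriv[OF n[unfolded is_net_anet] h corr nc \<phi>(1) ne em] .
  from deriv_derives[OF this refl refl, of dual] show ?thesis by (simp add: G)
qed

theorem theorem85:
  fixes dual :: "'v::countable \<Rightarrow> 'v" and S :: net and \<Gamma> :: "'v form list"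
  assumes "\<forall>X. dual (dual X) = X"
    and "is_net S" and "cut_free S"
  shows "((\<forall>\<B>. is_basis dual \<B> \<longrightarrow> S \<in> interp_sequent \<B> \<Gamma>) \<longrightarrow> derives dual S \<Gamma>) \<and>
         ((\<forall>\<B>. is_basis dual \<B> \<and> approximable \<B> \<longrightarrow> S \<in> interp_sequent \<B> \<Gamma>)
            \<longleftrightarrow> derives dual S \<Gamma>)"
proof -
  \<comment> \<open>The constant daimon type is one approximable basis, so membership there settles
    (1) as well as the completeness half of (2).\<close>
  have c: "derives dual S \<Gamma>" if "\<forall>\<B>. is_basis dual \<B> \<and> approximable \<B> \<longrightarrow> S \<in> interp_sequent \<B> \<Gamma>"
  proof (rule completeness[OF assms(2,3)])
    have "S \<in> interp_sequent (\<lambda>_. daimon_type) \<Gamma>"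
      using that is_basis_daimon_type approximable_daimon_type by blast
    then show "passing_net (map (\<lambda>A. points (orth (interp (\<lambda>_. daimon_type) A))) \<Gamma>) S"
      using interp_sequent_passing_net unary_tests by blast
  qed
  moreover have "S \<in> interp_sequent \<B> \<Gamma>" if d: "derives dual S \<Gamma>" and b: "is_basis dual \<B> \<and> approximable \<B>" for \<B>
  proof -
    obtain \<pi> where "represents S \<pi>" "proof_of dual \<pi> \<Gamma>" using d unfolding derives_def by blast
    then have "passing_net (map (\<lambda>A. points (orth (interp \<B> A))) \<Gamma>) S" using soundness b by blast
    moreover have "\<forall>A. unary (interp \<B> A)" using unary_interp b by blast
    ultimately show ?thesis using interp_sequent_passing_net by blast
  qed
  ultimately show ?thesis by blast
qed

end
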